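(* Let $H \in \mathbb{R}^{K \times K}$ be a matrix with zero diagonal and assume that the random support $I \subseteq \{1,\dots,K\}$ is chosen according to the rejective sampling model with probabilities $p_1, \dots, p_K$ such that $\sum_{i=1}^K p_i = S$; denote by $\mathbb{P}_S$ the corresponding probability measure. Let $W = \operatorname{diag}(\sqrt{p_1},\dots,\sqrt{p_K})$ be the corresponding weight matrix. Then, for all $r \geq 2e^2 \|WHW\|_{2,2}$, \[ \mathbb{P}_S\big( \| H_{I,I} \|_{2,2} \geq r \big) \leq 216\, K \exp\left( -\min\left\{ \frac{r^2}{4e^2 \|HW\|_{\infty,2}^2}, \frac{r^2}{4e^2 \|WH\|_{2,1}^2}, \frac{r}{2\|H\|_{\infty,1}} \right\} \right). \]
   Context: Norms: $\|A\|_{p,q} := \max_{\|x\|_q = 1} \|Ax\|_p$. Thus $\|A\|_{2,2}$ is the operator (spectral) norm, $\|A\|_{\infty,2}$ is the maximal $\ell_2$-norm of a row of $A$, $\|A\|_{2,1}$ is the maximal $\ell_2$-norm of a column of $A$, and $\|A\|_{\infty,1}$ is the maximal absolute entry of $A$. $H_{I,I}$ is the submatrix of $H$ with rows and columns indexed by $I$. Poisson sampling model: let $p_1,\dots,p_K \in [0,1]$ with $\sum_{j} p_j = S$, $S$ a positive integer, and let $\delta_1,\dots,\delta_K$ be independent Bernoulli $0$-$1$ random variables with $\mathbb{E}\,\delta_j = p_j$; the random support is $\{i : \delta_i = 1\}$, so $\mathbb{P}(I) = \prod_{i\in I} p_i \prod_{j \notin I}(1-p_j)$ for $I \subseteq \{1,\dots,K\}$.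 Rejective sampling model: the support $I$ is drawn from the Poisson sampling model conditioned on $|I| = S$, i.e. $\mathbb{P}_S(I) := \mathbb{P}(I \mid |I| = S)$. *)

theory Defs
  imports
    "HOL-Probability.Probability"
    "Jordan_Normal_Form.DL_Submatrix"
begin

unbundle no vec_syntax

definition lp_norm :: "ereal \<Rightarrow> real Matrix.vec \<Rightarrow> real" where
  "lp_norm p v =
     (if p = \<infinity> then Max {\<bar>v $ i\<bar> | i. i < dim_vec v}
      else (\<Sum>i<dim_vec v. \<bar>v $ i\<bar> powr real_of_ereal p) powr (1 / real_of_ereal p))"

text \<open>
  The first index is the norm on the codomain, the second one the norm on the domain. The supremum
  is a maximum by compactness. It is unspecified for a matrix without columns, as no vector of
  dimension 0 has norm 1.
\<close>
definition mixed_norm :: "ereal \<Rightarrow> ereal \<Rightarrow> real Matrix.mat \<Rightarrow> real" where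
  "mixed_norm p q A =
     Sup {lp_norm p (A *\<^sub>v x) | x. x \<in> carrier_vec (dim_col A) \<and> lp_norm q x = 1}"

definition weight_mat :: "nat \<Rightarrow> (nat \<Rightarrow> real) \<Rightarrow> real Matrix.mat" where
  "weight_mat K p = mat_diag K (\<lambda>i. sqrt (p i))"

text \<open>The index set is \<open>{..<K}\<close> instead of \<open>{1..K}\<close>, as matrix entries are counted from 0.\<close>
definition poisson_sampling :: "nat \<Rightarrow> (nat \<Rightarrow> real) \<Rightarrow> nat set pmf" where
  "poisson_sampling K p =
     map_pmf (\<lambda>\<delta>. {i. i < K \<and> \<delta> i}) (Pi_pmf {..<K} False (\<lambda>i. bernoulli_pmf (p i)))"

definition rejective_sampling :: "nat \<Rightarrow> (nat \<Rightarrow> real) \<Rightarrow> nat \<Rightarrow> nat set pmf" where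
  "rejective_sampling K p S = cond_pmf (poisson_sampling K p) {I. card I = S}"

text \<open>
  The exponential function on the extended reals. In the tail bound the exponent is an extended
  real so that a quotient \<open>a / 0\<close> with \<open>a > 0\<close> is \<open>\<infinity>\<close>: a vanishing norm in a denominator then
  drops out of the minimum, whereas real division would make the bound trivial.
\<close>
definition exp_ereal :: "ereal \<Rightarrow> ereal" where
  "exp_ereal x = (case x of ereal t \<Rightarrow> ereal (exp t) | PInfty \<Rightarrow> \<infinity> | MInfty \<Rightarrow> 0)"

end

theory Submission
  imports Defs
begin

text \<open>
  By log-convexity of the moments \<open>m\<^sub>k = z\<^sup>T A\<^sup>k z\<close> the expected traces of the powers of a random Gram matrix
  satisfy the recurrence of the moments of a Poisson variable, which gives a matrix Chernoff bound
  with dimension factor one.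

  If \<open>H\<close> restricted to \<open>I\<close> has norm at least \<open>r\<close>, attained at \<open>u, v\<close>, and \<open>A\<close> is a uniformly random index set,
  then with probability at least 1/36 one of the blocks \<open>(I \<inter> A) \<times> (I - A)\<close> and
  \<open>(I - A) \<times> (I \<inter> A)\<close> has norm at least \<open>r/2\<close>: this needs a Rademacher chaos of order two to be
  nonnegative, which its kurtosis bound 15 implies. For fixed \<open>A\<close> the rows and the columns of a block
  are chosen independently, and conditional applications of the Chernoff bound give, for the two
  blocks together, the tail \<open>3 K exp (- m)\<close>.

  Rejective sampling costs a factor 2: conditional on its size, the support is stochastically
  increasing in the size, and its size is at least \<open>S\<close> with probability at least 1/2, because an integer
  mean of a sum of independent indicators is a median. This makes \<open>2 * 36 * 3 = 216\<close>.
\<close>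

text \<open>The constant 2 e^2 and the three quotients come from one calibration. With Laplace
  parameter 2 / M the Chernoff bound says: if e^2 times the mean quadratic form is at most t, the
  tail at level t is at most the dimension times exp (- t / M). Given the rows, the mean over the
  columns is itself random, so the bound is nested and e^2 occurs twice: the inner mean must satisfy
  ||WHW||^2 \<le> (r / 2)^2 / e^4, that is, r \<ge> 2 e^2 ||WHW||. With \<open>m\<close> as the
  common exponent, the norm of \<open>H W\<close> governs the exponent of this inner bound, while
  for the column lengths the norm of \<open>W H\<close> governs the mean and the largest entry of
  \<open>H\<close> the exponent.

  Spectral norms are handled through witness vectors (\<open>norm_ge\<close>). This makes the events
  increasing in the support, by extension with zero, and gives them a meaning for empty blocks,
  where the supremum over unit vectors has no candidates.\<close>

section \<open>Expectations over random sets with independent membership\<close>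

definition bern_weight :: "'a set \<Rightarrow> ('a \<Rightarrow> real) \<Rightarrow> 'a set \<Rightarrow> real" where
  "bern_weight V p I = (\<Prod>i\<in>I. p i) * (\<Prod>i\<in>V - I. 1 - p i)"

text \<open>The expectation of \<open>f\<close> over a random subset of \<open>V\<close> that
  contains each \<open>i\<close> independently with probability \<open>p i\<close>. As a finite sum
  it turns independence and interchange of expectations into rearrangements of sums.\<close>

definition bern_exp :: "'a set \<Rightarrow> ('a \<Rightarrow> real) \<Rightarrow> ('a set \<Rightarrow> real) \<Rightarrow> real" where
  "bern_exp V p f = (\<Sum>I\<in>Pow V. bern_weight V p I * f I)"

lemma bern_exp_empty [simp]: "bern_exp {} p f = f {}"
  by (simp add: bern_exp_def bern_weight_def)

lemma bern_weight_insert: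
  assumes "finite V" "i \<notin> V" "I \<subseteq> V"
  shows "bern_weight (insert i V) p (insert i I) = p i * bern_weight V p I"
    and "bern_weight (insert i V) p I = (1 - p i) * bern_weight V p I"
proof -
  have "finite I" "i \<notin> I" using assms finite_subset by auto
  moreover have "insert i V - insert i I = V - I" "insert i V - I = insert i (V - I)"
    using assms by auto
  ultimately show "bern_weight (insert i V) p (insert i I) = p i * bern_weight V p I"
    "bern_weight (insert i V) p I = (1 - p i) * bern_weight V p I"
    using assms by (simp_all add: bern_weight_def)
qed

text \<open>Conditioning on whether \<open>i\<close> is selected; the inductions over the index set
  rest on this rule.\<close>

lemma bern_exp_insert:
  assumes "finite V" "i \<notin> V"
  shows "bern_exp (insert i V) p f
    = p i * bern_exp V p (\<lambda>I. f (insert i I)) + (1 - p i) * bern_exp V p f"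
proof -
  have disj: "Pow V \<inter> insert i ` Pow V = {}" and inj: "inj_on (insert i) (Pow V)"
    using assms(2) by (auto intro!: inj_onI)
  have "bern_exp (insert i V) p f
    = (\<Sum>I\<in>Pow V. bern_weight (insert i V) p I * f I)
      + (\<Sum>I\<in>Pow V. bern_weight (insert i V) p (insert i I) * f (insert i I))"
    unfolding bern_exp_def Pow_insert using disj inj assms(1)
    by (subst sum.union_disjoint) (simp_all add: sum.reindex)
  also have "\<dots> = (1 - p i) * bern_exp V p f + p i * bern_exp V p (\<lambda>I. f (insert i I))"
    unfolding bern_exp_def sum_distrib_left
    using assms by (intro arg_cong2[where f="(+)"] sum.cong) (auto simp: bern_weight_insert)
  finally show ?thesis by simp
qed

lemma bern_weight_nonneg:
  assumes "\<And>i. i \<in> V \<Longrightarrow> p i \<in> {0..1}" "I \<subseteq> V"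
  shows "0 \<le> bern_weight V p I"
  unfolding bern_weight_def using assms by (intro mult_nonneg_nonneg prod_nonneg) force+

lemma bern_exp_mono:
  assumes "\<And>i. i \<in> V \<Longrightarrow> p i \<in> {0..1}" "\<And>I. I \<subseteq> V \<Longrightarrow> f I \<le> g I"
  shows "bern_exp V p f \<le> bern_exp V p g"
  unfolding bern_exp_def using assms
  by (intro sum_mono mult_left_mono bern_weight_nonneg) auto

lemma bern_exp_add: "bern_exp V p (\<lambda>I. f I + g I) = bern_exp V p f + bern_exp V p g"
  by (simp add: bern_exp_def distrib_left sum.distrib)

lemma bern_exp_cmult: "bern_exp V p (\<lambda>I. c * f I) = c * bern_exp V p f"
  by (simp add: bern_exp_def sum_distrib_left mult_ac)

lemma bern_exp_diff: "bern_exp V p (\<lambda>I. f I - g I) = bern_exp V p f - bern_exp V p g"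
  using bern_exp_add[of V p f "\<lambda>I. -1 * g I"] bern_exp_cmult[of V p "-1" g] by simp

lemma bern_exp_sum: "bern_exp V p (\<lambda>I. \<Sum>a\<in>A. f a I) = (\<Sum>a\<in>A. bern_exp V p (f a))"
  unfolding bern_exp_def sum_distrib_left by (rule sum.swap)

lemma bern_exp_const [simp]: "finite V \<Longrightarrow> bern_exp V p (\<lambda>_. c) = c"
  by (induction V rule: finite_induct) (simp_all add: bern_exp_insert algebra_simps)

lemma bern_exp_nonneg:
  assumes "\<And>i. i \<in> V \<Longrightarrow> p i \<in> {0..1}" "\<And>I. I \<subseteq> V \<Longrightarrow> 0 \<le> f I"
  shows "0 \<le> bern_exp V p f"
  using bern_exp_mono[of V p "\<lambda>_. 0" f] assms by (simp add: bern_exp_def)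

lemma bern_exp_cong:
  assumes "\<And>I. I \<subseteq> V \<Longrightarrow> f I = g I" and "\<And>i. i \<in> V \<Longrightarrow> p i = q i"
  shows "bern_exp V p f = bern_exp V q g"
proof -
  have "bern_weight V p I = bern_weight V q I" if "I \<subseteq> V" for I
    unfolding bern_weight_def using that assms(2) by (intro arg_cong2[where f="(*)"] prod.cong) auto
  then show ?thesis unfolding bern_exp_def using assms(1) by (intro sum.cong) auto
qed

text \<open>Independence of the parts of the random set in disjoint index sets, in the form of
  Fubini's theorem.\<close>

lemma bern_exp_union:
  assumes "finite A" "finite B" "A \<inter> B = {}"
  shows "bern_exp (A \<union> B) p f = bern_exp A p (\<lambda>I. bern_exp B p (\<lambda>J. f (I \<union> J)))"
  using assms
proof (induction A arbitrary: f rule: finite_induct)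
  case (insert x A)
  then show ?case
    using bern_exp_insert[of "A \<union> B" x] bern_exp_insert[of A x] by simp
qed simp

lemma bern_exp_swap:
  "bern_exp A p (\<lambda>I. bern_exp B q (\<lambda>J. f I J)) = bern_exp B q (\<lambda>J. bern_exp A p (\<lambda>I. f I J))"
  unfolding bern_exp_def sum_distrib_left
  by (subst sum.swap) (simp add: mult_ac)

section \<open>A Chernoff bound for random Gram matrices\<close>

definition dotp :: "'b set \<Rightarrow> ('b \<Rightarrow> real) \<Rightarrow> ('b \<Rightarrow> real) \<Rightarrow> real" where
  "dotp D x y = (\<Sum>r\<in>D. x r * y r)"

text \<open>The operator whose matrix is the sum of z_i z_i^T over \<open>i\<close> in
  \<open>I\<close>, acting on functions as vectors with coordinates in \<open>D\<close>.\<close>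

definition gram :: "'b set \<Rightarrow> ('a \<Rightarrow> 'b \<Rightarrow> real) \<Rightarrow> 'a set \<Rightarrow> ('b \<Rightarrow> real) \<Rightarrow> 'b \<Rightarrow> real" where
  "gram D z I x = (\<lambda>r. \<Sum>i\<in>I. dotp D (z i) x * z i r)"

text \<open>The trace of the \<open>k\<close>-th power: \<open>of_bool \<circ> (=) r\<close> is the
  unit vector of coordinate \<open>r\<close>.\<close>

definition gram_trace :: "'b set \<Rightarrow> ('a \<Rightarrow> 'b \<Rightarrow> real) \<Rightarrow> 'a set \<Rightarrow> nat \<Rightarrow> real" where
  "gram_trace D z I k = (\<Sum>r\<in>D. (gram D z I ^^ k) (of_bool \<circ> (=) r) r)"

lemma dotp_commute: "dotp D x y = dotp D y x"
  by (simp add: dotp_def mult.commute)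

lemma dotp_lincomb: "dotp D x (\<lambda>r. y r + c * w r) = dotp D x y + c * dotp D x w"
  by (simp add: dotp_def algebra_simps sum.distrib sum_distrib_left)

lemma dotp_self_nonneg: "0 \<le> dotp D x x"
  by (simp add: dotp_def sum_nonneg)

lemma dotp_Cauchy_Schwarz: "(dotp D x y)\<^sup>2 \<le> dotp D x x * dotp D y y"
  using Cauchy_Schwarz_ineq_sum[of x y D] by (simp add: dotp_def power2_eq_square)

lemma dotp_unit: "finite D \<Longrightarrow> r \<in> D \<Longrightarrow> dotp D (of_bool \<circ> (=) r) x = x r"
  by (simp add: dotp_def of_bool_def if_distrib if_distribR sum.delta cong: if_cong)

lemma dotp_gram: "dotp D x (gram D z I y) = (\<Sum>i\<in>I. dotp D (z i) x * dotp D (z i) y)"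
proof -
  have "dotp D x (gram D z I y) = (\<Sum>r\<in>D. \<Sum>i\<in>I. (z i r * x r) * dotp D (z i) y)"
    by (simp add: dotp_def[of D x] gram_def sum_distrib_left mult_ac)
  also have "\<dots> = (\<Sum>i\<in>I. dotp D (z i) x * dotp D (z i) y)"
    by (subst sum.swap) (simp add: dotp_def[of D _ x] sum_distrib_right)
  finally show ?thesis .
qed

lemma dotp_gram_sym: "dotp D x (gram D z I y) = dotp D (gram D z I x) y"
  by (simp add: dotp_gram dotp_commute[of D "gram D z I x"] mult.commute)

lemma dotp_gram_pow_sym:
  "dotp D x ((gram D z I ^^ k) y) = dotp D ((gram D z I ^^ k) x) y"
  by (induction k arbitrary: x) (simp_all add: dotp_gram_sym flip: funpow_swap1)

lemma gram_lincomb: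
  "gram D z I (\<lambda>r. x r + c * y r) = (\<lambda>r. gram D z I x r + c * gram D z I y r)"
  by (simp add: gram_def dotp_lincomb algebra_simps sum.distrib sum_distrib_left fun_eq_iff)

lemma gram_pow_lincomb:
  "(gram D z I ^^ k) (\<lambda>r. x r + c * y r)
    = (\<lambda>r. (gram D z I ^^ k) x r + c * (gram D z I ^^ k) y r)"
  by (induction k) (simp_all add: gram_lincomb)

lemma gram_pow_split:
  "dotp D x ((gram D z I ^^ (a + b)) y) = dotp D ((gram D z I ^^ a) x) ((gram D z I ^^ b) y)"
  by (simp add: funpow_add dotp_gram_pow_sym)

text \<open>
  No spectral theory is needed: an even power is a square, and in an odd power the middle factor is
  itself a sum of squares.
\<close>
lemma gram_pow_quadform:
  assumes "finite D" "finite I"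
  shows "\<exists>ys. \<forall>x. dotp D x ((gram D z I ^^ k) x) = (\<Sum>y\<leftarrow>ys. (dotp D y x)\<^sup>2)"
proof (induction k rule: induct_nat_012)
  case 0
  obtain rs where rs: "set rs = D" "distinct rs" using finite_distinct_list[OF assms(1)] by auto
  have "dotp D x x = (\<Sum>y\<leftarrow>map (\<lambda>r. of_bool \<circ> (=) r) rs. (dotp D y x)\<^sup>2)" for x
  proof -
    have "dotp D x x = (\<Sum>r\<in>D. (dotp D (of_bool \<circ> (=) r) x)\<^sup>2)"
      using assms(1) by (simp add: dotp_unit) (simp add: dotp_def power2_eq_square)
    also have "\<dots> = (\<Sum>r\<leftarrow>rs. (dotp D (of_bool \<circ> (=) r) x)\<^sup>2)"
      by (subst sum.distinct_set_conv_list[OF rs(2), symmetric]) (simp add: rs(1))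
    finally show ?thesis by (simp add: o_def)
  qed
  then show ?case unfolding funpow_0 by blast
next
  case 1
  obtain js where js: "set js = I" "distinct js" using finite_distinct_list[OF assms(2)] by auto
  have "dotp D x (gram D z I x) = (\<Sum>y\<leftarrow>map z js. (dotp D y x)\<^sup>2)" for x
    using sum.distinct_set_conv_list[OF js(2), of "\<lambda>i. (dotp D (z i) x)\<^sup>2"] js(1)
    by (simp add: dotp_gram power2_eq_square o_def)
  then show ?case unfolding One_nat_def funpow.simps o_def id_def by blast
next
  case (ge2 k)
  then obtain ys where ys: "\<And>x. dotp D x ((gram D z I ^^ k) x) = (\<Sum>y\<leftarrow>ys. (dotp D y x)\<^sup>2)"
    by auto
  have "dotp D x ((gram D z I ^^ Suc (Suc k)) x)
    = (\<Sum>y\<leftarrow>map (gram D z I) ys. (dotp D y x)\<^sup>2)" for x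
  proof -
    have "dotp D x ((gram D z I ^^ Suc (Suc k)) x)
      = dotp D (gram D z I x) ((gram D z I ^^ k) (gram D z I x))"
      by (subst dotp_gram_sym[symmetric]) (simp add: funpow_swap1)
    then show ?thesis by (simp add: ys dotp_gram_sym o_def)
  qed
  then show ?case by blast
qed

text \<open>If A^k is a sum of rank-one matrices y y^T, its trace is the sum of their squared
  lengths. This gives access to the trace without eigenvalues.\<close>

lemma gram_trace_quadform:
  assumes "finite D" "\<And>x. dotp D x ((gram D z I ^^ k) x) = (\<Sum>y\<leftarrow>ys. (dotp D y x)\<^sup>2)"
  shows "gram_trace D z I k = (\<Sum>y\<leftarrow>ys. dotp D y y)"
proof -
  have "gram_trace D z I k
    = (\<Sum>r\<in>D. dotp D (of_bool \<circ> (=) r) ((gram D z I ^^ k) (of_bool \<circ> (=) r)))"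
    using assms(1) by (simp add: gram_trace_def dotp_unit)
  also have "\<dots> = (\<Sum>r\<in>D. \<Sum>y\<leftarrow>ys. (y r)\<^sup>2)"
    using assms(1) by (simp add: assms(2) dotp_unit dotp_commute[of D _ "of_bool \<circ> _"])
  also have "\<dots> = (\<Sum>y\<leftarrow>ys. dotp D y y)"
    by (induction ys) (simp_all add: sum.distrib dotp_def power2_eq_square)
  finally show ?thesis .
qed

lemma gram_pow_nonneg:
  assumes "finite D" "finite I"
  shows "0 \<le> dotp D x ((gram D z I ^^ k) x)"
proof -
  obtain ys where "\<And>x. dotp D x ((gram D z I ^^ k) x) = (\<Sum>y\<leftarrow>ys. (dotp D y x)\<^sup>2)"
    using gram_pow_quadform[OF assms] by metis
  then show ?thesis by (auto intro!: sum_list_nonneg)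
qed

text \<open>Cauchy-Schwarz for each square in the representation of A^k: a positive semidefinite
  matrix is bounded by its trace.\<close>

lemma gram_pow_le_trace:
  assumes "finite D" "finite I"
  shows "dotp D x ((gram D z I ^^ k) x) \<le> gram_trace D z I k * dotp D x x"
proof -
  obtain ys where ys: "\<And>x. dotp D x ((gram D z I ^^ k) x) = (\<Sum>y\<leftarrow>ys. (dotp D y x)\<^sup>2)"
    using gram_pow_quadform[OF assms] by metis
  have "(\<Sum>y\<leftarrow>ys. (dotp D y x)\<^sup>2) \<le> (\<Sum>y\<leftarrow>ys. dotp D y y * dotp D x x)"
    by (intro sum_list_mono dotp_Cauchy_Schwarz)
  then show ?thesis using gram_trace_quadform[OF assms(1) ys] ys
    by (simp add: sum_list_mult_const)
qed

text \<open>The left side is the trace of A^k times the mean matrix, the sum of p_i z_i z_i^T.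
  Writing A^k as a sum of y y^T reduces the claim to the hypothesis at each y.\<close>

lemma sum_gram_pow_le_trace:
  assumes "finite D" "finite I"
    and "\<And>x. (\<Sum>i\<in>V. p i * (dotp D (z i) x)\<^sup>2) \<le> mu * dotp D x x"
  shows "(\<Sum>i\<in>V. p i * dotp D (z i) ((gram D z I ^^ k) (z i))) \<le> mu * gram_trace D z I k"
proof -
  obtain ys where ys: "\<And>x. dotp D x ((gram D z I ^^ k) x) = (\<Sum>y\<leftarrow>ys. (dotp D y x)\<^sup>2)"
    using gram_pow_quadform[OF assms(1,2)] by metis
  have "(\<Sum>i\<in>V. p i * dotp D (z i) ((gram D z I ^^ k) (z i)))
    = (\<Sum>y\<leftarrow>ys. \<Sum>i\<in>V. p i * (dotp D (z i) y)\<^sup>2)"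
    unfolding ys by (induction ys) (simp_all add: algebra_simps sum.distrib dotp_commute)
  also have "\<dots> \<le> (\<Sum>y\<leftarrow>ys. mu * dotp D y y)"
    by (intro sum_list_mono assms(3))
  finally show ?thesis using gram_trace_quadform[OF assms(1) ys]
    by (simp add: sum_list_const_mult)
qed

lemma gram_trace_0: "finite D \<Longrightarrow> gram_trace D z I 0 = card D"
  by (simp add: gram_trace_def)

text \<open>One factor A of the power is split into its rank-one terms, and the trace of A^k z_i
  z_i^T is a quadratic form in z_i.\<close>

lemma gram_trace_Suc:
  fixes z :: "'a \<Rightarrow> 'b \<Rightarrow> real"
  assumes "finite D"
  shows "gram_trace D z I (Suc k) = (\<Sum>i\<in>I. dotp D (z i) ((gram D z I ^^ k) (z i)))"
proof -
  let ?e = "\<lambda>r. of_bool \<circ> (=) r :: 'b \<Rightarrow> real"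
  have "gram_trace D z I (Suc k) = (\<Sum>r\<in>D. dotp D ((gram D z I ^^ k) (?e r)) (gram D z I (?e r)))"
    using assms unfolding gram_trace_def
    by (intro sum.cong) (simp_all add: dotp_unit funpow_swap1 flip: dotp_gram_pow_sym)
  also have "\<dots> = (\<Sum>r\<in>D. \<Sum>i\<in>I. (gram D z I ^^ k) (z i) r * z i r)"
    using assms unfolding dotp_gram
    by (intro sum.cong refl)
       (simp add: dotp_unit dotp_gram_pow_sym dotp_commute[of D "z _"] flip: dotp_gram_pow_sym)
  also have "\<dots> = (\<Sum>i\<in>I. dotp D (z i) ((gram D z I ^^ k) (z i)))"
    by (subst sum.swap) (simp add: dotp_def mult.commute)
  finally show ?thesis .
qed

text \<open>Log-convexity makes the ratios m (k + 1) / m k increase, so moving the smaller index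
  down and the larger one up does not decrease a product. \<open>shift\<close> is one such move,
  stated without division.\<close>

lemma log_convex_mult_le:
  fixes m :: "nat \<Rightarrow> real"
  assumes nonneg: "\<And>k. 0 \<le> m k" and conv: "\<And>k. (m (Suc k))\<^sup>2 \<le> m k * m (Suc (Suc k))"
  shows "m a * m b \<le> m 0 * m (a + b)"
proof -
  have shift: "m (Suc a) * m (a + d) \<le> m a * m (Suc (a + d))" for a d
  proof (induction d)
    case (Suc d)
    let ?b = "a + d"
    show ?case
    proof (cases "m (Suc ?b) = 0")
      case False
      have "(m (Suc a) * m (Suc ?b)) * m (Suc ?b) = m (Suc a) * (m (Suc ?b))\<^sup>2"
        by (simp add: power2_eq_square)
      also have "\<dots> \<le> m (Suc a) * (m ?b * m (Suc (Suc ?b)))"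
        using conv nonneg by (intro mult_left_mono) auto
      also have "\<dots> = (m (Suc a) * m ?b) * m (Suc (Suc ?b))" by simp
      also have "\<dots> \<le> (m a * m (Suc ?b)) * m (Suc (Suc ?b))"
        using Suc nonneg by (intro mult_right_mono) auto
      also have "\<dots> = (m a * m (Suc (Suc ?b))) * m (Suc ?b)" by simp
      finally show ?thesis using False nonneg[of "Suc ?b"]
        by (simp add: mult_le_cancel_right)
    qed (use nonneg in simp)
  qed simp
  have le: "m a * m b \<le> m 0 * m (a + b)" if "a \<le> b" for a b
    using that
  proof (induction a arbitrary: b)
    case (Suc a)
    have "m (Suc a) * m b \<le> m a * m (Suc b)"
      using shift[of a "b - a"] Suc.prems by simp
    also have "\<dots> \<le> m 0 * m (a + Suc b)" using Suc by (intro Suc.IH) simp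
    finally show ?case by simp
  qed simp
  show ?thesis
    using le[of a b] le[of b a] by (cases "a \<le> b") (simp_all add: mult.commute add.commute)
qed

text \<open>Cauchy-Schwarz in one of two inner products. For k = 2 i the vectors are A^i x and
  A^(i+1) x. For k = 2 i + 1 they are the same vectors under the semi-inner product defined by A,
  where A^i x has the coordinates z_j^T A^i x.\<close>

lemma gram_pow_log_convex:
  fixes z :: "'a \<Rightarrow> 'b \<Rightarrow> real" and x :: "'b \<Rightarrow> real"
  assumes "finite D" "finite I"
  defines "m \<equiv> \<lambda>k. dotp D x ((gram D z I ^^ k) x)"
  shows "(m (Suc k))\<^sup>2 \<le> m k * m (Suc (Suc k))"
proof (cases "even k")
  case True
  then obtain i where "k = i + i" by (metis even_two_times_div_two mult_2)
  then have "m k = m (i + i)" "m (Suc k) = m (i + Suc i)" "m (Suc (Suc k)) = m (Suc i + Suc i)"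
    by simp_all
  then show ?thesis unfolding m_def gram_pow_split by (simp only: dotp_Cauchy_Schwarz)
next
  case False
  then obtain i where k: "k = Suc (i + i)" by (metis oddE add.commute mult_2 plus_1_eq_Suc)
  let ?u = "(gram D z I ^^ i) x"
  have *: "m (Suc (a + b)) = (\<Sum>j\<in>I. dotp D (z j) ((gram D z I ^^ a) x) * dotp D (z j) ((gram D z I ^^ b) x))"
    for a b
  proof -
    have "m (Suc (a + b)) = m (a + Suc b)" by simp
    then show ?thesis unfolding m_def by (simp only: gram_pow_split) (simp add: dotp_gram)
  qed
  have "m (Suc k) = m (Suc (i + Suc i))" "m k = m (Suc (i + i))"
    "m (Suc (Suc k)) = m (Suc (Suc i + Suc i))" by (simp_all add: k)
  then show ?thesis unfolding *
    using Cauchy_Schwarz_ineq_sum[of "\<lambda>j. dotp D (z j) ?u" "\<lambda>j. dotp D (z j) ((gram D z I ^^ Suc i) x)" I]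
    by (simp only: power2_eq_square)
qed

lemma gram_pow_mult_le:
  assumes "finite D" "finite I"
  shows "dotp D x ((gram D z I ^^ a) x) * dotp D x ((gram D z I ^^ b) x)
    \<le> dotp D x x * dotp D x ((gram D z I ^^ (a + b)) x)"
  using log_convex_mult_le[of "\<lambda>k. dotp D x ((gram D z I ^^ k) x)" a b]
    gram_pow_nonneg[OF assms] gram_pow_log_convex[OF assms] by simp

section \<open>Adding one vector to a Gram matrix\<close>

lemma gram_insert:
  assumes "finite I" "i \<notin> I"
  shows "gram D z (insert i I) x = (\<lambda>r. gram D z I x r + dotp D (z i) x * z i r)"
  using assms by (simp add: gram_def add.commute)

lemma gram_pow_insert:
  assumes "finite I" "i \<notin> I"
  shows "dotp D x ((gram D z I ^^ a) ((gram D z (insert i I) ^^ Suc k) y))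
    = dotp D x ((gram D z I ^^ Suc a) ((gram D z (insert i I) ^^ k) y))
      + dotp D (z i) ((gram D z (insert i I) ^^ k) y) * dotp D x ((gram D z I ^^ a) (z i))"
  using assms by (simp add: gram_insert gram_pow_lincomb dotp_lincomb flip: funpow_swap1)

text \<open>
  For the vector \<open>z i\<close> itself, \<open>m j\<close> is monotone in the index set even for \<open>j > 1\<close>, where the
  power is not operator monotone: expanding the power of the enlarged matrix gives products of
  terms \<open>m a\<close>, which are nonnegative.
\<close>
lemma gram_pow_insert_bounds:
  fixes z :: "'a \<Rightarrow> 'b \<Rightarrow> real"
  assumes fin: "finite D" "finite I" and i: "i \<notin> I" and M: "dotp D (z i) (z i) \<le> M"
  defines "m \<equiv> \<lambda>j. dotp D (z i) ((gram D z I ^^ j) (z i))"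
    and "g \<equiv> \<lambda>a k. dotp D (z i) ((gram D z I ^^ a) ((gram D z (insert i I) ^^ k) (z i)))"
  shows "m (a + k) \<le> g a k" (is ?lower)
    and "g a k \<le> (\<Sum>j\<le>k. real (k choose j) * M ^ (k - j) * m (a + j))" (is ?upper)
proof -
  have m0: "0 \<le> m j" for j unfolding m_def by (rule gram_pow_nonneg[OF fin])
  \<comment> \<open>The leftmost factor A + z z^T of the enlarged power is expanded: A joins the
    power to its left, while z z^T splits off the complete factor \<open>m a\<close>.\<close>
  have rec: "g a (Suc k) = g (Suc a) k + g 0 k * m a" for a k
    unfolding g_def m_def by (subst gram_pow_insert[OF fin(2) i]) simp
  have lower: "m (a + k) \<le> g a k" for a k
  proof (induction k arbitrary: a)
    case (Suc k)
    have "0 \<le> g 0 k * m a" using Suc[of 0] m0[of k] m0[of a] by simp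
    then show ?case using Suc[of "Suc a"] by (simp add: rec)
  qed (simp add: g_def m_def)
  then show ?lower .
  have M0: "0 \<le> M" using M dotp_self_nonneg order_trans by blast
  \<comment> \<open>Log-convexity merges two moments of \<open>z i\<close> into one, at the price of
    the factor m 0 \<le> M.\<close>
  have mm: "m a * m b \<le> M * m (a + b)" for a b
  proof -
    have "m a * m b \<le> dotp D (z i) (z i) * m (a + b)"
      unfolding m_def by (rule gram_pow_mult_le[OF fin])
    also have "\<dots> \<le> M * m (a + b)" using M m0 by (intro mult_right_mono)
    finally show ?thesis .
  qed
  have "g a k \<le> (\<Sum>j\<le>k. real (k choose j) * M ^ (k - j) * m (a + j))" for a
  proof (induction k arbitrary: a)
    case (Suc k)
    have "g 0 k * m a \<le> (\<Sum>j\<le>k. real (k choose j) * M ^ (k - j) * m j) * m a"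
      using Suc[of 0] m0 by (intro mult_right_mono) auto
    also have "\<dots> = (\<Sum>j\<le>k. real (k choose j) * M ^ (k - j) * (m a * m j))"
      by (simp add: sum_distrib_left mult_ac)
    also have "\<dots> \<le> (\<Sum>j\<le>k. real (k choose j) * M ^ (k - j) * (M * m (a + j)))"
      using mm M0 by (intro sum_mono mult_left_mono) auto
    also have "\<dots> = (\<Sum>j\<le>k. real (k choose j) * M ^ (Suc k - j) * m (a + j))"
      by (intro sum.cong) (auto simp: Suc_diff_le)
    also have "\<dots> = (\<Sum>j\<le>Suc k. real (k choose j) * M ^ (Suc k - j) * m (a + j))"
      by simp
    finally have 1: "g 0 k * m a \<le> (\<Sum>j\<le>Suc k. real (k choose j) * M ^ (Suc k - j) * m (a + j))" .
    have 2: "g (Suc a) k \<le> (\<Sum>j\<le>k. real (k choose j) * M ^ (k - j) * m (a + Suc j))"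
      using Suc[of "Suc a"] by simp
    have "g a (Suc k) \<le> (\<Sum>j\<le>k. real (k choose j) * M ^ (k - j) * m (a + Suc j))
        + (\<Sum>j\<le>Suc k. real (k choose j) * M ^ (Suc k - j) * m (a + j))"
      using 1 2 rec[of a k] by linarith
    \<comment> \<open>Pascal's rule, after an index shift in the first sum.\<close>
    also have "\<dots> = (\<Sum>j\<le>Suc k. real (Suc k choose j) * M ^ (Suc k - j) * m (a + j))"
      unfolding sum.atMost_Suc_shift[of _ k]
      by (simp add: sum.distrib[symmetric] algebra_simps)
    finally show ?case .
  qed (simp add: g_def m_def)
  then show ?upper .
qed

text \<open>
  By Dobinski's formula, \<open>poisson_moment x M k\<close> is the \<open>k\<close>-th moment of \<open>M\<close> times a Poisson
  variable of mean \<open>x\<close>. These moments satisfy with equality the recurrence that the expected traces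
  satisfy as an inequality.
\<close>
definition poisson_moment :: "real \<Rightarrow> real \<Rightarrow> nat \<Rightarrow> real" where
  "poisson_moment x M k = exp (- x) * (\<Sum>n. (real n * M) ^ k * (x ^ n / fact n))"

lemma power_le_fact_exp:
  assumes "0 \<le> (y::real)"
  shows "y ^ k \<le> fact k * exp y"
proof -
  have s: "(\<lambda>n. y ^ n / fact n) sums exp y"
    using exp_converges[of y] by (simp add: divide_inverse scaleR_conv_of_real mult.commute)
  have "sum (\<lambda>n. y ^ n / fact n) {k} \<le> exp y"
    using sums_unique[OF s] sum_le_suminf[OF sums_summable[OF s], of "{k}"] assms by simp
  then show ?thesis by (simp add: divide_simps mult.commute)
qed

lemma exp_partial_sum_le:
  assumes "0 \<le> (y::real)"
  shows "(\<Sum>k\<le>N. y ^ k / fact k) \<le> exp y"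
proof -
  have s: "(\<lambda>n. y ^ n / fact n) sums exp y"
    using exp_converges[of y] by (simp add: divide_inverse scaleR_conv_of_real mult.commute)
  show ?thesis
    using sums_unique[OF s] sum_le_suminf[OF sums_summable[OF s], of "{..N}"] assms by simp
qed

text \<open>Up to the factor exp (- x), the moment generating function of a Poisson variable of mean
  \<open>x\<close>.\<close>

lemma exp_mult_sums: "(\<lambda>n. exp (real n * c) * (x ^ n / fact n)) sums exp (x * exp (c::real))"
proof -
  have "(\<lambda>n. (x * exp c) ^ n / fact n) sums exp (x * exp c)"
    using exp_converges[of "x * exp c"] by (simp add: divide_inverse scaleR_conv_of_real mult.commute)
  moreover have "(x * exp c) ^ n / fact n = exp (real n * c) * (x ^ n / fact n)" for n
    by (simp add: power_mult_distrib exp_of_nat_mult)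
  ultimately show ?thesis by simp
qed

lemma poisson_moment_summable:
  assumes "0 \<le> x" "0 \<le> M"
  shows "summable (\<lambda>n. (real n * M) ^ k * (x ^ n / fact n))"
proof (rule summable_comparison_test')
  show "summable (\<lambda>n. fact k * (exp (real n * M) * (x ^ n / fact n)))"
    using exp_mult_sums[of M x] by (intro summable_mult sums_summable)
  fix n :: nat
  show "norm ((real n * M) ^ k * (x ^ n / fact n)) \<le> fact k * (exp (real n * M) * (x ^ n / fact n))"
    using power_le_fact_exp[of "real n * M" k] assms
    by (simp add: abs_mult mult.assoc[symmetric] mult_right_mono divide_right_mono)
qed

lemma poisson_moment_0: "poisson_moment x M 0 = 1"
  using exp_mult_sums[of 0 x] by (simp add: poisson_moment_def sums_iff exp_minus)

text \<open>The Stein-Chen identity E [N f(N)] = x E [f(N + 1)] for a Poisson variable N of mean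
  \<open>x\<close>, with f(n) = (n M)^k expanded by the binomial theorem.\<close>

lemma poisson_moment_Suc:
  assumes "0 \<le> x" "0 \<le> M"
  shows "poisson_moment x M (Suc k)
    = x * M * (\<Sum>j\<le>k. real (k choose j) * M ^ (k - j) * poisson_moment x M j)"
proof -
  let ?f = "\<lambda>k n. (real n * M) ^ k * (x ^ n / fact n)"
  note sm = poisson_moment_summable[OF assms]
  have "(\<Sum>j\<le>k. real (k choose j) * M ^ (k - j) * poisson_moment x M j)
    = exp (- x) * (\<Sum>j\<le>k. \<Sum>n. real (k choose j) * M ^ (k - j) * ?f j n)"
    unfolding poisson_moment_def sum_distrib_left
    by (intro sum.cong refl, subst suminf_mult[OF sm]) simp
  also have "(\<Sum>j\<le>k. \<Sum>n. real (k choose j) * M ^ (k - j) * ?f j n)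
    = (\<Sum>n. \<Sum>j\<le>k. real (k choose j) * M ^ (k - j) * ?f j n)"
    by (rule suminf_sum[symmetric]) (intro summable_mult sm)
  also have "(\<lambda>n. \<Sum>j\<le>k. real (k choose j) * M ^ (k - j) * ?f j n)
    = (\<lambda>n. (real (Suc n) * M) ^ k * (x ^ n / fact n))"
  proof
    fix n
    have "(real (Suc n) * M) ^ k = (real n * M + M) ^ k" by (simp add: algebra_simps)
    then show "(\<Sum>j\<le>k. real (k choose j) * M ^ (k - j) * ?f j n)
      = (real (Suc n) * M) ^ k * (x ^ n / fact n)"
      by (simp add: binomial_ring sum_distrib_left sum_distrib_right mult_ac sum_divide_distrib)
  qed
  finally have 1: "(\<Sum>j\<le>k. real (k choose j) * M ^ (k - j) * poisson_moment x M j)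
    = exp (- x) * (\<Sum>n. (real (Suc n) * M) ^ k * (x ^ n / fact n))" .
  have step: "?f (Suc k) (Suc n) = x * M * ((real (Suc n) * M) ^ k * (x ^ n / fact n))" for n
    unfolding fact_Suc by (simp add: field_simps del: of_nat_Suc)
  have sm': "summable (\<lambda>n. x * M * ((real (Suc n) * M) ^ k * (x ^ n / fact n)))"
    using sm[of "Suc k"] unfolding step[symmetric] by (subst summable_Suc_iff)
  have sm'': "summable (\<lambda>n. (real (Suc n) * M) ^ k * (x ^ n / fact n))" if "x * M \<noteq> 0"
    using sm' summable_mult_D[OF sm' that] by simp
  have "(\<Sum>n. ?f (Suc k) n) = (\<Sum>n. ?f (Suc k) (Suc n))"
    using suminf_split_head[OF sm[of "Suc k"]] by simp
  also have "\<dots> = x * M * (\<Sum>n. (real (Suc n) * M) ^ k * (x ^ n / fact n))"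
    unfolding step
  proof (cases "x * M = 0")
    case False
    show "(\<Sum>n. x * M * ((real (Suc n) * M) ^ k * (x ^ n / fact n)))
      = x * M * (\<Sum>n. (real (Suc n) * M) ^ k * (x ^ n / fact n))"
      by (rule suminf_mult[OF sm''[OF False]])
  next
    case True
    show "(\<Sum>n. x * M * ((real (Suc n) * M) ^ k * (x ^ n / fact n)))
      = x * M * (\<Sum>n. (real (Suc n) * M) ^ k * (x ^ n / fact n))"
      unfolding True by simp
  qed
  finally show ?thesis using 1 by (simp add: poisson_moment_def)
qed

text \<open>The Poisson moment generating function, truncated at \<open>N\<close>: the bounds on
  expected traces are inserted into a finite sum, and the limit is taken afterwards.\<close>

lemma poisson_moment_exp_le:
  assumes "0 \<le> x" "0 \<le> M" "0 \<le> \<theta>"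
  shows "(\<Sum>k\<le>N. \<theta> ^ k / fact k * poisson_moment x M k) \<le> exp (x * (exp (\<theta> * M) - 1))"
proof -
  let ?f = "\<lambda>k n. (real n * M) ^ k * (x ^ n / fact n)"
  note sm = poisson_moment_summable[OF assms(1,2)]
  have "(\<Sum>k\<le>N. \<theta> ^ k / fact k * poisson_moment x M k)
    = exp (- x) * (\<Sum>k\<le>N. \<Sum>n. \<theta> ^ k / fact k * ?f k n)"
    unfolding poisson_moment_def sum_distrib_left
    by (intro sum.cong refl, subst suminf_mult[OF sm]) simp
  also have "(\<Sum>k\<le>N. \<Sum>n. \<theta> ^ k / fact k * ?f k n) = (\<Sum>n. \<Sum>k\<le>N. \<theta> ^ k / fact k * ?f k n)"
    by (rule suminf_sum[symmetric]) (intro summable_mult sm)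
  also have "\<dots> \<le> (\<Sum>n. exp (real n * (\<theta> * M)) * (x ^ n / fact n))"
  proof (intro suminf_le)
    fix n
    have "(\<Sum>k\<le>N. \<theta> ^ k / fact k * ?f k n)
      = (\<Sum>k\<le>N. (real n * (\<theta> * M)) ^ k / fact k) * (x ^ n / fact n)"
      unfolding sum_distrib_right by (intro sum.cong) (simp_all add: power_mult_distrib mult_ac)
    also have "\<dots> \<le> exp (real n * (\<theta> * M)) * (x ^ n / fact n)"
      using assms by (intro mult_right_mono exp_partial_sum_le) auto
    finally show "(\<Sum>k\<le>N. \<theta> ^ k / fact k * ?f k n) \<le> exp (real n * (\<theta> * M)) * (x ^ n / fact n)" .
    show "summable (\<lambda>n. \<Sum>k\<le>N. \<theta> ^ k / fact k * ?f k n)"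
      by (intro summable_sum summable_mult sm)
  qed (rule sums_summable[OF exp_mult_sums])
  also have "\<dots> = exp (x * exp (\<theta> * M))"
    using exp_mult_sums[of "\<theta> * M" x] by (simp add: sums_iff)
  finally show ?thesis by (simp add: right_diff_distrib exp_diff exp_minus divide_simps mult_ac)
qed

section \<open>Expected traces and the Chernoff bound\<close>

text \<open>The trace of the power \<open>Suc k\<close> is the sum over the selected
  \<open>i\<close> of z_i^T A^k z_i. Given that \<open>i\<close> is selected, A is A' + z_i z_i^T
  with A' independent of that choice. The upper bound for the enlarged power leads to moments under
  A', monotonicity replaces A' by A again, and the bound on the mean matrix turns the sum over
  \<open>i\<close> back into traces.\<close>

lemma expected_gram_trace_Suc_le:
  fixes z :: "'a \<Rightarrow> 'b \<Rightarrow> real"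
  assumes fin: "finite V" "finite D" and p: "\<And>i. i \<in> V \<Longrightarrow> p i \<in> {0..1}"
    and M: "\<And>i. i \<in> V \<Longrightarrow> dotp D (z i) (z i) \<le> M" "0 \<le> M"
    and mu: "\<And>x. (\<Sum>i\<in>V. p i * (dotp D (z i) x)\<^sup>2) \<le> mu * dotp D x x"
  shows "bern_exp V p (\<lambda>I. gram_trace D z I (Suc k))
    \<le> mu * (\<Sum>j\<le>k. real (k choose j) * M ^ (k - j) * bern_exp V p (\<lambda>I. gram_trace D z I j))"
proof -
  define q where "q i j I = dotp D (z i) ((gram D z I ^^ j) (z i))" for i j I
  have sub: "finite I" if "I \<subseteq> V" for I using fin(1) that finite_subset by auto
  have q0: "0 \<le> q i j I" if "I \<subseteq> V" for i j I
    unfolding q_def using fin(2) sub[OF that] by (rule gram_pow_nonneg)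
  have one: "bern_exp V p (\<lambda>I. of_bool (i \<in> I) * q i k I)
    \<le> p i * (\<Sum>j\<le>k. real (k choose j) * M ^ (k - j) * bern_exp V p (q i j))"
    if i: "i \<in> V" for i
  proof -
    define V' where "V' = V - {i}"
    have V: "V = insert i V'" "i \<notin> V'" "finite V'" using i fin by (auto simp: V'_def)
    have pi: "0 \<le> p i" "0 \<le> 1 - p i" using p[OF i] by auto
    have pV': "\<And>i. i \<in> V' \<Longrightarrow> p i \<in> {0..1}" using p V by auto
    \<comment> \<open>Adding z_i only increases its moments, so their expectation without
      \<open>i\<close> is at most the unconditional one.\<close>
    have mono: "bern_exp V' p (q i j) \<le> bern_exp V p (q i j)" for j
    proof -
      have "bern_exp V' p (q i j) \<le> bern_exp V' p (\<lambda>I. q i j (insert i I))"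
      proof (rule bern_exp_mono[OF pV'])
        fix I assume "I \<subseteq> V'"
        then show "q i j I \<le> q i j (insert i I)"
          using gram_pow_insert_bounds(1)[OF fin(2), of I i z M 0 j] V sub[of I] M(1)[OF i]
          by (auto simp: q_def)
      qed
      then show ?thesis
        using mult_left_mono[OF _ pi(1)] unfolding V(1) bern_exp_insert[OF V(3,2)]
        by (smt (verit, ccfv_SIG) left_diff_distrib mult_cancel_right1)
    qed
    have "bern_exp V p (\<lambda>I. of_bool (i \<in> I) * q i k I)
      = p i * bern_exp V' p (\<lambda>I. q i k (insert i I))"
    proof -
      have "bern_exp V' p (\<lambda>I. of_bool (i \<in> I) * q i k I) = bern_exp V' p (\<lambda>I. 0)"
        using V by (intro bern_exp_cong) auto
      then show ?thesis using V(3) unfolding V(1) bern_exp_insert[OF V(3,2)] by simp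
    qed
    also have "\<dots> \<le> p i * bern_exp V' p (\<lambda>I. \<Sum>j\<le>k. real (k choose j) * M ^ (k - j) * q i j I)"
    proof (intro mult_left_mono bern_exp_mono pV' pi)
      fix I assume "I \<subseteq> V'"
      then show "q i k (insert i I) \<le> (\<Sum>j\<le>k. real (k choose j) * M ^ (k - j) * q i j I)"
        using gram_pow_insert_bounds(2)[OF fin(2), of I i z M 0 k] V sub[of I] M(1)[OF i]
        by (auto simp: q_def)
    qed
    also have "\<dots> = p i * (\<Sum>j\<le>k. real (k choose j) * M ^ (k - j) * bern_exp V' p (q i j))"
      by (simp add: bern_exp_sum bern_exp_cmult)
    also have "\<dots> \<le> p i * (\<Sum>j\<le>k. real (k choose j) * M ^ (k - j) * bern_exp V p (q i j))"
      using mono pi M(2) by (intro mult_left_mono sum_mono) auto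
    finally show ?thesis .
  qed
  have "bern_exp V p (\<lambda>I. gram_trace D z I (Suc k))
    = bern_exp V p (\<lambda>I. \<Sum>i\<in>V. of_bool (i \<in> I) * q i k I)"
  proof (rule bern_exp_cong)
    fix I assume I: "I \<subseteq> V"
    have "(\<Sum>i\<in>V. of_bool (i \<in> I) * q i k I) = (\<Sum>i\<in>I. q i k I)"
      using I fin(1) by (intro sum.mono_neutral_cong_right) auto
    then show "gram_trace D z I (Suc k) = (\<Sum>i\<in>V. of_bool (i \<in> I) * q i k I)"
      using fin(2) by (simp add: gram_trace_Suc q_def)
  qed simp
  also have "\<dots> \<le> (\<Sum>i\<in>V. p i * (\<Sum>j\<le>k. real (k choose j) * M ^ (k - j) * bern_exp V p (q i j)))"
    unfolding bern_exp_sum by (intro sum_mono one)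
  also have "\<dots> = (\<Sum>j\<le>k. real (k choose j) * M ^ (k - j) * bern_exp V p (\<lambda>I. \<Sum>i\<in>V. p i * q i j I))"
    unfolding bern_exp_sum bern_exp_cmult sum_distrib_left
    by (subst sum.swap) (simp add: mult_ac)
  also have "\<dots> \<le> (\<Sum>j\<le>k. real (k choose j) * M ^ (k - j) * (mu * bern_exp V p (\<lambda>I. gram_trace D z I j)))"
    unfolding bern_exp_cmult[symmetric, where c = mu]
    using M(2) fin sub sum_gram_pow_le_trace[OF _ _ mu]
    by (intro sum_mono mult_left_mono bern_exp_mono p) (auto simp: q_def)
  also have "\<dots> = mu * (\<Sum>j\<le>k. real (k choose j) * M ^ (k - j) * bern_exp V p (\<lambda>I. gram_trace D z I j))"
    by (simp add: sum_distrib_left mult_ac)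
  finally show ?thesis .
qed

text \<open>The Poisson mean \<open>mu / M\<close> is chosen so that its product with
  \<open>M\<close> is \<open>mu\<close>, the factor in front of the recurrence for the
  traces.\<close>

lemma expected_gram_trace_le:
  assumes fin: "finite V" "finite D" and p: "\<And>i. i \<in> V \<Longrightarrow> p i \<in> {0..1}"
    and M: "\<And>i. i \<in> V \<Longrightarrow> dotp D (z i) (z i) \<le> M" "0 < M"
    and mu: "\<And>x. (\<Sum>i\<in>V. p i * (dotp D (z i) x)\<^sup>2) \<le> mu * dotp D x x" "0 \<le> mu"
  shows "bern_exp V p (\<lambda>I. gram_trace D z I k) \<le> card D * poisson_moment (mu / M) M k"
proof (induction k rule: less_induct)
  case (less k)
  show ?case
  proof (cases k)
    case 0
    then show ?thesis using fin by (simp add: poisson_moment_0 gram_trace_0)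
  next
    case (Suc l)
    have "bern_exp V p (\<lambda>I. gram_trace D z I k)
      \<le> mu * (\<Sum>j\<le>l. real (l choose j) * M ^ (l - j) * bern_exp V p (\<lambda>I. gram_trace D z I j))"
      unfolding Suc by (rule expected_gram_trace_Suc_le[OF fin p M(1) less_imp_le[OF M(2)] mu(1)])
    also have "\<dots> \<le> mu * (\<Sum>j\<le>l. real (l choose j) * M ^ (l - j)
        * (card D * poisson_moment (mu / M) M j))"
      using less M mu Suc by (intro mult_left_mono sum_mono) auto
    also have "\<dots> = card D * ((mu / M) * M * (\<Sum>j\<le>l. real (l choose j) * M ^ (l - j)
        * poisson_moment (mu / M) M j))"
      using M(2) by (simp add: sum_distrib_left mult_ac)
    also have "\<dots> = card D * poisson_moment (mu / M) M k"
      unfolding Suc using M(2) mu(2) by (subst poisson_moment_Suc) auto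
    finally show ?thesis .
  qed
qed

text \<open>For k \<ge> 1, log-convexity and m 0 \<le> 1 give t^k \<le> (m 1)^k \<le> m k, and the
  trace dominates m k. For k = 0 the claim is that \<open>D\<close> is nonempty, which 0 < t
  forces.\<close>

lemma gram_trace_ge_power:
  assumes fin: "finite D" "finite I" and x: "dotp D x x \<le> 1"
    and t: "0 < t" "t \<le> dotp D x (gram D z I x)"
  shows "t ^ k \<le> gram_trace D z I k"
proof -
  define m where "m j = dotp D x ((gram D z I ^^ j) x)" for j
  have m0: "0 \<le> m j" for j unfolding m_def by (rule gram_pow_nonneg[OF fin])
  have le1: "a * m 0 \<le> a" if "0 \<le> a" for a
    using x that mult_left_mono[of "m 0" 1 a] by (simp add: m_def)
  have pow: "t ^ Suc k \<le> m (Suc k)" for k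
  proof (induction k)
    case (Suc k)
    have "t ^ Suc (Suc k) \<le> m 1 * m (Suc k)"
      using mult_mono[of t "m 1" "t ^ Suc k" "m (Suc k)"] Suc t m0 by (simp add: m_def)
    also have "\<dots> \<le> m 0 * m (Suc (Suc k))"
      using gram_pow_mult_le[OF fin, where a = 1 and b = "Suc k" and x = x and z = z] by (simp add: m_def)
    also have "\<dots> \<le> m (Suc (Suc k))" using le1[of "m (Suc (Suc k))", OF m0] by (simp add: mult.commute)
    finally show ?case .
  qed (use t in \<open>simp add: m_def\<close>)
  show ?thesis
  proof (cases k)
    case 0
    have "D \<noteq> {}" using t by (auto simp: dotp_def)
    then have "1 \<le> card D" using fin by (simp add: Suc_le_eq card_gt_0_iff)
    then show ?thesis using 0 fin by (simp add: gram_trace_0)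
  next
    case (Suc l)
    have T: "m k \<le> gram_trace D z I k * dotp D x x"
      unfolding m_def by (rule gram_pow_le_trace[OF fin])
    have "0 \<le> gram_trace D z I k"
    proof -
      have "0 < m k" using pow[of l] Suc t(1) by (meson less_le_trans zero_less_power)
      then show ?thesis using T dotp_self_nonneg[of D x] by (smt (verit) mult_nonpos_nonneg)
    qed
    then have "gram_trace D z I k * dotp D x x \<le> gram_trace D z I k"
      using x mult_left_mono[of "dotp D x x" 1] by simp
    then show ?thesis using T pow[of l] Suc by simp
  qed
qed

text \<open>The event says that the Gram matrix has an eigenvalue of at least \<open>t\<close>.
  Markov's inequality for each trace moment, summed with the weights theta^k / k!, bounds exp (theta
  t) times its probability by card D times exp (mu / M * (exp (theta M) - 1)).\<close>

lemma matrix_chernoff: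
  assumes fin: "finite V" "finite D" and p: "\<And>i. i \<in> V \<Longrightarrow> p i \<in> {0..1}"
    and M: "\<And>i. i \<in> V \<Longrightarrow> (\<Sum>r\<in>D. (z i r)\<^sup>2) \<le> M" "0 < M" and t: "0 < t"
    and mu: "\<And>x. (\<Sum>r\<in>D. (x r)\<^sup>2) \<le> 1 \<Longrightarrow> exp 1 ^ 2 * (\<Sum>i\<in>V. p i * (\<Sum>r\<in>D. z i r * x r)\<^sup>2) \<le> t"
  shows "bern_exp V p (\<lambda>I. of_bool (\<exists>x. (\<Sum>r\<in>D. (x r)\<^sup>2) \<le> 1 \<and> t \<le> (\<Sum>i\<in>I. (\<Sum>r\<in>D. z i r * x r)\<^sup>2)))
    \<le> card D * exp (- t / M)"
proof -
  define E where "E I = (\<exists>x. (\<Sum>r\<in>D. (x r)\<^sup>2) \<le> 1 \<and> t \<le> (\<Sum>i\<in>I. (\<Sum>r\<in>D. z i r * x r)\<^sup>2))" for I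
  define mu' where "mu' = t / exp 1 ^ 2"
  \<comment> \<open>With this choice exp (theta M) = e^2, so the exponent on the right is at most
    e^2 mu' / M = t / M, against theta t = 2 t / M on the left.\<close>
  define \<theta> where "\<theta> = 2 / M"
  define P where "P = bern_exp V p (\<lambda>I. of_bool (E I))"
  have mu'_e: "mu' * exp 1 ^ 2 = t" by (simp add: mu'_def)
  have mu'0: "0 \<le> mu'" using t by (simp add: mu'_def)
  have \<theta>: "0 \<le> \<theta>" using M by (simp add: \<theta>_def)
  have P0: "0 \<le> P" unfolding P_def by (rule bern_exp_nonneg[OF p]) auto
  have mu2: "(\<Sum>i\<in>V. p i * (dotp D (z i) x)\<^sup>2) \<le> mu' * dotp D x x" for x
  proof (cases "dotp D x x = 0")
    case True
    have "(dotp D (z i) x)\<^sup>2 \<le> 0" for i using dotp_Cauchy_Schwarz[of D "z i" x] True by simp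
    then show ?thesis using True by simp
  next
    case False
    define s where "s = sqrt (dotp D x x)"
    have s: "0 < s" "s\<^sup>2 = dotp D x x" using False dotp_self_nonneg[of D x] by (simp_all add: s_def)
    have "(\<Sum>r\<in>D. (x r / s)\<^sup>2) = dotp D x x / s\<^sup>2"
      by (simp add: dotp_def power2_eq_square sum_divide_distrib)
    then have "exp 1 ^ 2 * (\<Sum>i\<in>V. p i * (\<Sum>r\<in>D. z i r * (x r / s))\<^sup>2) \<le> t"
      using s by (intro mu) (simp add: False)
    moreover have "(\<Sum>i\<in>V. p i * (\<Sum>r\<in>D. z i r * (x r / s))\<^sup>2) = (\<Sum>i\<in>V. p i * (dotp D (z i) x)\<^sup>2) / s\<^sup>2"
      by (simp add: dotp_def sum_divide_distrib[symmetric] power_divide)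
    ultimately have "exp 1 ^ 2 * ((\<Sum>i\<in>V. p i * (dotp D (z i) x)\<^sup>2) / s\<^sup>2) \<le> t" by simp
    then show ?thesis using s(1) unfolding mu'_def s(2)[symmetric]
      by (simp add: divide_le_eq le_divide_eq mult.commute)
  qed
  have moment: "t ^ k * P \<le> card D * poisson_moment (mu' / M) M k" for k
  proof -
    have "t ^ k * P \<le> bern_exp V p (\<lambda>I. gram_trace D z I k)"
      unfolding P_def bern_exp_cmult[symmetric]
    proof (rule bern_exp_mono[OF p])
      fix I assume "I \<subseteq> V"
      then have I: "finite I" using fin finite_subset by auto
      have "0 \<le> gram_trace D z I k"
      proof -
        obtain ys where ys: "\<And>x. dotp D x ((gram D z I ^^ k) x) = (\<Sum>y\<leftarrow>ys. (dotp D y x)\<^sup>2)"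
          using gram_pow_quadform[OF fin(2) I] by metis
        show ?thesis unfolding gram_trace_quadform[OF fin(2) ys]
          by (auto intro!: sum_list_nonneg dotp_self_nonneg)
      qed
      moreover have "t ^ k \<le> gram_trace D z I k" if EI: "E I"
      proof -
        obtain x where x: "(\<Sum>r\<in>D. (x r)\<^sup>2) \<le> 1" "t \<le> (\<Sum>i\<in>I. (\<Sum>r\<in>D. z i r * x r)\<^sup>2)"
          using EI unfolding E_def by blast
        show ?thesis
          by (rule gram_trace_ge_power[OF fin(2) I _ t, of x])
             (use x in \<open>simp_all add: dotp_gram, simp_all add: dotp_def power2_eq_square\<close>)
      qed
      ultimately show "t ^ k * of_bool (E I) \<le> gram_trace D z I k" by auto
    qed
    also have "\<dots> \<le> card D * poisson_moment (mu' / M) M k"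
      by (rule expected_gram_trace_le[OF fin p _ M(2) mu2 mu'0])
         (use M(1) in \<open>auto simp: dotp_def power2_eq_square\<close>)
    finally show ?thesis .
  qed
  have partial: "(\<Sum>k\<le>N. (\<theta> * t) ^ k / fact k) * P \<le> card D * exp (t / M)" for N
  proof -
    have "(\<Sum>k\<le>N. (\<theta> * t) ^ k / fact k) * P = (\<Sum>k\<le>N. \<theta> ^ k / fact k * (t ^ k * P))"
      unfolding sum_distrib_right by (intro sum.cong) (simp_all add: power_mult_distrib mult_ac)
    also have "\<dots> \<le> (\<Sum>k\<le>N. \<theta> ^ k / fact k * (card D * poisson_moment (mu' / M) M k))"
      using \<theta> by (intro sum_mono mult_left_mono moment) auto
    also have "\<dots> = card D * (\<Sum>k\<le>N. \<theta> ^ k / fact k * poisson_moment (mu' / M) M k)"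
      by (simp add: sum_distrib_left mult_ac)
    also have "\<dots> \<le> card D * exp (mu' / M * (exp (\<theta> * M) - 1))"
      using mu'0 M \<theta> by (intro mult_left_mono poisson_moment_exp_le) auto
    also have "\<dots> \<le> card D * exp (t / M)"
    proof -
      have "exp (\<theta> * M) = exp 1 ^ 2" using M(2) by (simp add: \<theta>_def exp_of_nat_mult[symmetric])
      then have "mu' / M * (exp (\<theta> * M) - 1) = t / M - mu' / M"
        using mu'_e by (simp add: right_diff_distrib diff_divide_distrib)
      then show ?thesis using mu'0 M by (intro mult_left_mono) auto
    qed
    finally show ?thesis .
  qed
  have "(\<lambda>N. (\<Sum>k\<le>N. (\<theta> * t) ^ k / fact k) * P) \<longlonglongrightarrow> exp (\<theta> * t) * P"
  proof -
    have "(\<lambda>n. (\<theta> * t) ^ n / fact n) sums exp (\<theta> * t)"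
      using exp_converges[of "\<theta> * t"] by (simp add: divide_inverse scaleR_conv_of_real mult.commute)
    then show ?thesis unfolding sums_def_le by (intro tendsto_mult tendsto_const)
  qed
  then have "exp (\<theta> * t) * P \<le> card D * exp (t / M)"
    by (rule LIMSEQ_le_const2) (use partial in blast)
  then have "exp (\<theta> * t) * P * exp (- 2 * t / M) \<le> card D * exp (t / M) * exp (- 2 * t / M)"
    by (rule mult_right_mono) simp
  moreover have "exp (\<theta> * t) * P * exp (- 2 * t / M) = P"
    by (simp add: \<theta>_def exp_minus)
  moreover have "exp (t / M) * exp (- 2 * t / M) = exp (- t / M)"
    by (simp add: exp_add[symmetric] add_divide_distrib[symmetric])
  ultimately have "P \<le> card D * exp (- t / M)" by (metis mult.assoc)
  then show ?thesis unfolding P_def E_def .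
qed

section \<open>Rademacher chaos of order two\<close>

text \<open>Rademacher signs are encoded by a uniformly random set: its expectation is
  \<open>bern_exp\<close> with all probabilities 1/2, and the same set later serves as the partition
  in the decoupling.\<close>

definition sgn_in :: "'a set \<Rightarrow> 'a \<Rightarrow> real" where
  "sgn_in I i = (if i \<in> I then 1 else - 1)"

abbreviation rad_exp :: "'a set \<Rightarrow> ('a set \<Rightarrow> real) \<Rightarrow> real" where
  "rad_exp V \<equiv> bern_exp V (\<lambda>_. 1/2)"

definition rad_lin :: "'a set \<Rightarrow> ('a \<Rightarrow> real) \<Rightarrow> 'a set \<Rightarrow> real" where
  "rad_lin V a I = (\<Sum>i\<in>V. a i * sgn_in I i)"

definition rad_quad :: "'a set \<Rightarrow> ('a \<Rightarrow> 'a \<Rightarrow> real) \<Rightarrow> 'a set \<Rightarrow> real" where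
  "rad_quad V c I = (\<Sum>i\<in>V. \<Sum>j\<in>V - {i}. c i j * sgn_in I i * sgn_in I j)"

lemma rad_lin_empty [simp]: "rad_lin {} a I = 0"
  by (simp add: rad_lin_def)

lemma rad_quad_empty [simp]: "rad_quad {} c I = 0"
  by (simp add: rad_quad_def)

lemma sgn_in_insert: "i \<in> V \<Longrightarrow> v \<notin> V \<Longrightarrow> sgn_in (insert v I) i = sgn_in I i"
  by (auto simp: sgn_in_def)

lemma rad_lin_insert:
  assumes "finite V" "v \<notin> V"
  shows "rad_lin (insert v V) a (insert v I) = rad_lin V a I + a v"
    and "I \<subseteq> V \<Longrightarrow> rad_lin (insert v V) a I = rad_lin V a I - a v"
  using assms by (simp_all add: rad_lin_def sgn_in_insert cong: sum.cong) (auto simp: sgn_in_def)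

text \<open>With s the sign of \<open>v\<close>, the form is Q + s N, where N is linear in the other
  signs. The sum runs over ordered pairs, so both orders contribute to the coefficients of
  N.\<close>

lemma rad_quad_insert:
  assumes "finite V" "v \<notin> V"
  shows "rad_quad (insert v V) c (insert v I) = rad_quad V c I + rad_lin V (\<lambda>i. c v i + c i v) I"
    and "I \<subseteq> V \<Longrightarrow> rad_quad (insert v V) c I = rad_quad V c I - rad_lin V (\<lambda>i. c v i + c i v) I"
proof -
  have split: "rad_quad (insert v V) c J
    = rad_quad V c J + (\<Sum>i\<in>V. (c v i + c i v) * sgn_in J i) * sgn_in J v" for J
  proof -
    have "(\<Sum>j\<in>insert v V - {i}. c i j * sgn_in J i * sgn_in J j)
      = c i v * sgn_in J i * sgn_in J v + (\<Sum>j\<in>V - {i}. c i j * sgn_in J i * sgn_in J j)"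
      if "i \<in> V" for i
    proof -
      have "insert v V - {i} = insert v (V - {i})" using that assms by auto
      then show ?thesis using assms by simp
    qed
    moreover have "insert v V - {v} = V" using assms by auto
    ultimately show ?thesis using assms
      by (simp add: rad_quad_def sum.distrib sum_distrib_left sum_distrib_right algebra_simps)
  qed
  have cong: "rad_quad V c (insert v I) = rad_quad V c I"
    unfolding rad_quad_def using assms by (intro sum.cong) (auto simp: sgn_in_def)
  show "rad_quad (insert v V) c (insert v I) = rad_quad V c I + rad_lin V (\<lambda>i. c v i + c i v) I"
    unfolding split cong using assms
    by (simp add: rad_lin_def sgn_in_insert cong: sum.cong) (simp add: sgn_in_def)
  show "rad_quad (insert v V) c I = rad_quad V c I - rad_lin V (\<lambda>i. c v i + c i v) I" if "I \<subseteq> V"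
    unfolding split using assms that by (simp add: rad_lin_def) (auto simp: sgn_in_def)
qed

text \<open>The sign of \<open>v\<close> is averaged out first, so that in \<open>g\<close> its odd
  powers cancel.\<close>

lemma rad_exp_insert:
  assumes "finite V" "v \<notin> V" "\<And>I. I \<subseteq> V \<Longrightarrow> (f (insert v I) + f I) / 2 = g I"
  shows "rad_exp (insert v V) f = rad_exp V g"
proof -
  have "rad_exp (insert v V) f = rad_exp V (\<lambda>I. (1/2) * f (insert v I) + (1/2) * f I)"
    unfolding bern_exp_insert[OF assms(1,2)] bern_exp_add bern_exp_cmult by simp
  also have "\<dots> = rad_exp V g"
    using assms(3) by (intro bern_exp_cong) (auto simp: field_simps)
  finally show ?thesis .
qed

lemma rad_exp_nonneg: "(\<And>I. I \<subseteq> V \<Longrightarrow> 0 \<le> f I) \<Longrightarrow> 0 \<le> rad_exp V f"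
  by (rule bern_exp_nonneg) auto

lemma rad_exp_Cauchy_Schwarz:
  "(rad_exp V (\<lambda>I. f I * g I))\<^sup>2 \<le> rad_exp V (\<lambda>I. (f I)\<^sup>2) * rad_exp V (\<lambda>I. (g I)\<^sup>2)"
proof -
  define w where "w I = sqrt (bern_weight V (\<lambda>_. 1/2) I)" for I
  have w: "w I * w I = bern_weight V (\<lambda>_. 1/2) I" if "I \<in> Pow V" for I
    using bern_weight_nonneg[of V "\<lambda>_. 1/2" I] that by (simp add: w_def)
  have eq: "rad_exp V (\<lambda>I. f I * g I) = (\<Sum>I\<in>Pow V. (w I * f I) * (w I * g I))" for f g
    unfolding bern_exp_def by (intro sum.cong) (simp_all add: w[symmetric] mult_ac)
  show ?thesis
    using Cauchy_Schwarz_ineq_sum[of "\<lambda>I. w I * f I" "\<lambda>I. w I * g I" "Pow V"]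
    by (simp only: power2_eq_square eq)
qed

text \<open>The inequality of arithmetic and geometric means, in a form that starts from a bound on
  X^2 and involves no roots.\<close>

lemma double_le_add_of_square_le:
  fixes X u v :: real
  assumes "X\<^sup>2 \<le> u * v" "0 \<le> u" "0 \<le> v"
  shows "2 * X \<le> u + v"
proof (rule power2_le_imp_le)
  have "0 \<le> (u - v)\<^sup>2" by simp
  then show "(2 * X)\<^sup>2 \<le> (u + v)\<^sup>2" using assms(1) by (simp add: power2_eq_square algebra_simps)
qed (use assms in simp)

lemma rad_quad_mean: "finite V \<Longrightarrow> rad_exp V (rad_quad V c) = 0"
proof (induction V rule: finite_induct)
  case (insert v V)
  have "rad_exp (insert v V) (rad_quad (insert v V) c) = rad_exp V (rad_quad V c)"
    using insert by (intro rad_exp_insert) (auto simp: rad_quad_insert)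
  then show ?case using insert by simp
qed simp

lemma rad_lin_square_insert:
  assumes "finite V" "v \<notin> V"
  shows "rad_exp (insert v V) (\<lambda>I. (rad_lin (insert v V) a I)\<^sup>2)
    = rad_exp V (\<lambda>I. (rad_lin V a I)\<^sup>2) + (a v)\<^sup>2"
proof -
  have "rad_exp (insert v V) (\<lambda>I. (rad_lin (insert v V) a I)\<^sup>2)
    = rad_exp V (\<lambda>I. (rad_lin V a I)\<^sup>2 + (a v)\<^sup>2)"
    using assms by (intro rad_exp_insert) (auto simp: rad_lin_insert power2_eq_square algebra_simps)
  then show ?thesis using assms by (simp add: bern_exp_add)
qed

lemma rad_quad_square_insert:
  assumes "finite V" "v \<notin> V"
  shows "rad_exp (insert v V) (\<lambda>I. (rad_quad (insert v V) c I)\<^sup>2)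
    = rad_exp V (\<lambda>I. (rad_quad V c I)\<^sup>2) + rad_exp V (\<lambda>I. (rad_lin V (\<lambda>i. c v i + c i v) I)\<^sup>2)"
proof -
  have "rad_exp (insert v V) (\<lambda>I. (rad_quad (insert v V) c I)\<^sup>2)
    = rad_exp V (\<lambda>I. (rad_quad V c I)\<^sup>2 + (rad_lin V (\<lambda>i. c v i + c i v) I)\<^sup>2)"
    using assms by (intro rad_exp_insert) (auto simp: rad_quad_insert power2_eq_square algebra_simps)
  then show ?thesis by (simp add: bern_exp_add)
qed

lemma rad_lin_mult_le:
  "2 * (s * t * rad_exp V (\<lambda>I. rad_lin V a I * rad_lin V b I))
    \<le> s\<^sup>2 * rad_exp V (\<lambda>I. (rad_lin V a I)\<^sup>2) + t\<^sup>2 * rad_exp V (\<lambda>I. (rad_lin V b I)\<^sup>2)"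
proof (rule double_le_add_of_square_le)
  show "(s * t * rad_exp V (\<lambda>I. rad_lin V a I * rad_lin V b I))\<^sup>2
    \<le> s\<^sup>2 * rad_exp V (\<lambda>I. (rad_lin V a I)\<^sup>2) * (t\<^sup>2 * rad_exp V (\<lambda>I. (rad_lin V b I)\<^sup>2))"
    using mult_left_mono[OF rad_exp_Cauchy_Schwarz[of V "rad_lin V a" "rad_lin V b"], of "(s * t)\<^sup>2"]
    by (simp add: power_mult_distrib mult_ac)
qed (auto intro!: mult_nonneg_nonneg rad_exp_nonneg)

text \<open>The constant 3 reproduces itself: the new terms a^2 m + b^2 l come with a cross term 4 a
  b x, which costs at most twice their sum. It is the kurtosis of a Gaussian variable.\<close>

lemma rad_lin_square_mult:
  assumes "finite V"
  shows "rad_exp V (\<lambda>I. (rad_lin V a I)\<^sup>2 * (rad_lin V b I)\<^sup>2)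
    \<le> 3 * rad_exp V (\<lambda>I. (rad_lin V a I)\<^sup>2) * rad_exp V (\<lambda>I. (rad_lin V b I)\<^sup>2)"
  using assms
proof (induction V rule: finite_induct)
  case (insert v V)
  let ?L = "rad_lin V a" and ?M = "rad_lin V b"
  define l where "l = rad_exp V (\<lambda>I. (?L I)\<^sup>2)"
  define m where "m = rad_exp V (\<lambda>I. (?M I)\<^sup>2)"
  define x where "x = rad_exp V (\<lambda>I. ?L I * ?M I)"
  have "rad_exp (insert v V) (\<lambda>I. (rad_lin (insert v V) a I)\<^sup>2 * (rad_lin (insert v V) b I)\<^sup>2)
    = rad_exp V (\<lambda>I. (?L I)\<^sup>2 * (?M I)\<^sup>2 + (a v)\<^sup>2 * (?M I)\<^sup>2 + (b v)\<^sup>2 * (?L I)\<^sup>2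
        + (a v)\<^sup>2 * (b v)\<^sup>2 + 4 * (a v * b v) * (?L I * ?M I))"
    using insert(1,2) by (intro rad_exp_insert) (auto simp: rad_lin_insert power2_eq_square algebra_simps)
  also have "\<dots> = rad_exp V (\<lambda>I. (?L I)\<^sup>2 * (?M I)\<^sup>2) + (a v)\<^sup>2 * m + (b v)\<^sup>2 * l
        + (a v)\<^sup>2 * (b v)\<^sup>2 + 4 * (a v * b v) * x"
    using insert(1) by (simp only: bern_exp_add bern_exp_cmult bern_exp_const l_def m_def x_def)
  also have "\<dots> \<le> 3 * l * m + (a v)\<^sup>2 * m + (b v)\<^sup>2 * l + (a v)\<^sup>2 * (b v)\<^sup>2
        + 2 * ((b v)\<^sup>2 * l + (a v)\<^sup>2 * m)"
    using insert.IH rad_lin_mult_le[of "b v" "a v" V a b] by (simp add: l_def m_def x_def mult_ac)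
  also have "\<dots> \<le> 3 * (l + (a v)\<^sup>2) * (m + (b v)\<^sup>2)" by (simp add: algebra_simps)
  finally show ?case using insert(1,2) by (simp add: rad_lin_square_insert l_def m_def)
qed simp

text \<open>Only the part of the product of the linear forms that has order two in the signs
  correlates with the chaos, and its second moment is at most twice the product of theirs. The
  induction obtains this as (X + Y)^2 \<le> (q + n) (A + B), with X the old and Y the new
  contribution.\<close>

lemma rad_lin_lin_quad:
  assumes "finite V"
  shows "(rad_exp V (\<lambda>I. rad_lin V a I * rad_lin V b I * rad_quad V c I))\<^sup>2
    \<le> 2 * rad_exp V (\<lambda>I. (rad_lin V a I)\<^sup>2) * rad_exp V (\<lambda>I. (rad_lin V b I)\<^sup>2)
      * rad_exp V (\<lambda>I. (rad_quad V c I)\<^sup>2)"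
  using assms
proof (induction V rule: finite_induct)
  case (insert v V)
  let ?L = "rad_lin V a" and ?M = "rad_lin V b" and ?Q = "rad_quad V c"
    and ?N = "rad_lin V (\<lambda>i. c v i + c i v)"
  define l where "l = rad_exp V (\<lambda>I. (?L I)\<^sup>2)"
  define m where "m = rad_exp V (\<lambda>I. (?M I)\<^sup>2)"
  define q where "q = rad_exp V (\<lambda>I. (?Q I)\<^sup>2)"
  define n where "n = rad_exp V (\<lambda>I. (?N I)\<^sup>2)"
  define X where "X = rad_exp V (\<lambda>I. ?L I * ?M I * ?Q I)"
  define Y where "Y = rad_exp V (\<lambda>I. (a v * ?M I + b v * ?L I) * ?N I)"
  have nn: "0 \<le> l" "0 \<le> m" "0 \<le> q" "0 \<le> n"
    by (auto simp: l_def m_def q_def n_def intro!: rad_exp_nonneg)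
  define A where "A = 2 * l * m"
  define B where "B = 2 * ((a v)\<^sup>2 * m + (b v)\<^sup>2 * l)"
  have AB: "0 \<le> A" "0 \<le> B" using nn by (auto simp: A_def B_def)
  have "rad_exp (insert v V) (\<lambda>I. rad_lin (insert v V) a I * rad_lin (insert v V) b I * rad_quad (insert v V) c I)
    = rad_exp V (\<lambda>I. ?L I * ?M I * ?Q I + (a v * b v) * ?Q I + (a v * ?M I + b v * ?L I) * ?N I)"
    using insert(1,2) by (intro rad_exp_insert) (auto simp: rad_lin_insert rad_quad_insert algebra_simps)
  also have "\<dots> = X + Y"
    using rad_quad_mean[OF insert(1), of c]
    by (simp only: bern_exp_add[of _ _ "\<lambda>I. _ I + _ I" "\<lambda>I. _ I * _ I"] bern_exp_add bern_exp_cmult X_def Y_def)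
  finally have XY: "rad_exp (insert v V) (\<lambda>I. rad_lin (insert v V) a I * rad_lin (insert v V) b I
      * rad_quad (insert v V) c I) = X + Y" .
  have X: "X\<^sup>2 \<le> q * A" using insert.IH by (simp add: X_def q_def A_def l_def m_def mult_ac)
  have Y: "Y\<^sup>2 \<le> n * B"
  proof -
    have "rad_exp V (\<lambda>I. (a v * ?M I + b v * ?L I)\<^sup>2)
      = rad_exp V (\<lambda>I. (a v)\<^sup>2 * (?M I)\<^sup>2 + (b v)\<^sup>2 * (?L I)\<^sup>2 + 2 * (a v * b v) * (?M I * ?L I))"
      by (intro bern_exp_cong) (auto simp: power2_eq_square algebra_simps)
    also have "\<dots> = (a v)\<^sup>2 * m + (b v)\<^sup>2 * l + 2 * (a v * b v) * rad_exp V (\<lambda>I. ?M I * ?L I)"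
      by (simp only: bern_exp_add bern_exp_cmult l_def m_def)
    also have "\<dots> \<le> B"
      using rad_lin_mult_le[of "a v" "b v" V b a] by (simp add: B_def l_def m_def)
    finally have "rad_exp V (\<lambda>I. (a v * ?M I + b v * ?L I)\<^sup>2) * n \<le> B * n"
      using nn by (intro mult_right_mono)
    then show ?thesis
      using rad_exp_Cauchy_Schwarz[of V "\<lambda>I. a v * ?M I + b v * ?L I" ?N]
      unfolding Y_def n_def by (simp add: mult.commute)
  qed
  \<comment> \<open>The mixed term of (X + Y)^2: from X^2 \<le> q A and Y^2 \<le> n B follows (X
    Y)^2 \<le> (q B) (n A).\<close>
  have "2 * (X * Y) \<le> q * B + n * A"
  proof (rule double_le_add_of_square_le)
    have "X\<^sup>2 * Y\<^sup>2 \<le> (q * A) * (n * B)" using X Y nn AB by (intro mult_mono) auto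
    then show "(X * Y)\<^sup>2 \<le> q * B * (n * A)" by (simp add: power_mult_distrib mult_ac)
  qed (use nn AB in auto)
  then have "(X + Y)\<^sup>2 \<le> (q + n) * (A + B)"
    using X Y by (simp add: power2_eq_square algebra_simps)
  also have "\<dots> \<le> (q + n) * (2 * (l + (a v)\<^sup>2) * (m + (b v)\<^sup>2))"
    using nn by (intro mult_left_mono) (auto simp: A_def B_def algebra_simps)
  finally show ?case using insert(1,2) XY
    by (simp add: rad_lin_square_insert rad_quad_square_insert l_def m_def n_def q_def mult_ac)
qed simp

text \<open>The constant 5 balances the cross term 4 a X, where X^2 \<le> 2 l n q: bounding it by 2
  l n + 4 a^2 q raises the coefficient of l n from 3 to 5 and that of a^2 q from 1 to 5.\<close>

lemma rad_lin_square_quad_square: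
  assumes "finite V"
  shows "rad_exp V (\<lambda>I. (rad_lin V a I)\<^sup>2 * (rad_quad V c I)\<^sup>2)
    \<le> 5 * rad_exp V (\<lambda>I. (rad_lin V a I)\<^sup>2) * rad_exp V (\<lambda>I. (rad_quad V c I)\<^sup>2)"
  using assms
proof (induction V rule: finite_induct)
  case (insert v V)
  let ?L = "rad_lin V a" and ?Q = "rad_quad V c" and ?N = "rad_lin V (\<lambda>i. c v i + c i v)"
  define l where "l = rad_exp V (\<lambda>I. (?L I)\<^sup>2)"
  define q where "q = rad_exp V (\<lambda>I. (?Q I)\<^sup>2)"
  define n where "n = rad_exp V (\<lambda>I. (?N I)\<^sup>2)"
  define X where "X = rad_exp V (\<lambda>I. ?L I * ?N I * ?Q I)"
  have nn: "0 \<le> l" "0 \<le> q" "0 \<le> n"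
    by (auto simp: l_def q_def n_def intro!: rad_exp_nonneg)
  have "rad_exp (insert v V) (\<lambda>I. (rad_lin (insert v V) a I)\<^sup>2 * (rad_quad (insert v V) c I)\<^sup>2)
    = rad_exp V (\<lambda>I. (?L I)\<^sup>2 * (?Q I)\<^sup>2 + (?L I)\<^sup>2 * (?N I)\<^sup>2 + (a v)\<^sup>2 * (?Q I)\<^sup>2
        + (a v)\<^sup>2 * (?N I)\<^sup>2 + (4 * a v) * (?L I * ?N I * ?Q I))"
    using insert(1,2) by (intro rad_exp_insert)
      (auto simp: rad_lin_insert rad_quad_insert power2_eq_square algebra_simps)
  also have "\<dots> = rad_exp V (\<lambda>I. (?L I)\<^sup>2 * (?Q I)\<^sup>2) + rad_exp V (\<lambda>I. (?L I)\<^sup>2 * (?N I)\<^sup>2)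
        + (a v)\<^sup>2 * q + (a v)\<^sup>2 * n + 4 * a v * X"
    by (simp only: bern_exp_add bern_exp_cmult q_def n_def X_def)
  also have "\<dots> \<le> 5 * l * q + 3 * l * n + (a v)\<^sup>2 * q + (a v)\<^sup>2 * n + (2 * l * n + 4 * (a v)\<^sup>2 * q)"
  proof -
    have "2 * (2 * a v * X) \<le> 2 * l * n + 4 * (a v)\<^sup>2 * q"
    proof (rule double_le_add_of_square_le)
      have "4 * (a v)\<^sup>2 * X\<^sup>2 \<le> 4 * (a v)\<^sup>2 * (2 * l * n * q)"
        using rad_lin_lin_quad[OF insert(1)] unfolding X_def l_def n_def q_def
        by (intro mult_left_mono) auto
      then show "(2 * a v * X)\<^sup>2 \<le> 2 * l * n * (4 * (a v)\<^sup>2 * q)"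
        by (simp add: power_mult_distrib mult_ac)
    qed (use nn in auto)
    moreover have "rad_exp V (\<lambda>I. (?L I)\<^sup>2 * (?N I)\<^sup>2) \<le> 3 * l * n"
      unfolding l_def n_def by (rule rad_lin_square_mult[OF insert(1)])
    moreover have "rad_exp V (\<lambda>I. (?L I)\<^sup>2 * (?Q I)\<^sup>2) \<le> 5 * l * q"
      unfolding l_def q_def by (rule insert.IH)
    ultimately show ?thesis by linarith
  qed
  also have "\<dots> \<le> 5 * (l + (a v)\<^sup>2) * (q + n)" using nn by (simp add: algebra_simps)
  finally show ?case using insert(1,2)
    by (simp add: rad_lin_square_insert rad_quad_square_insert l_def n_def q_def)
qed simp

text \<open>The mixed term in the fourth power of Q + s N has coefficient 6, and 6 * 5 = 2 * 15 is
  exactly what 15 (q + n)^2 provides.\<close>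

lemma rad_quad_fourth_moment:
  assumes "finite V"
  shows "rad_exp V (\<lambda>I. (rad_quad V c I) ^ 4) \<le> 15 * (rad_exp V (\<lambda>I. (rad_quad V c I)\<^sup>2))\<^sup>2"
  using assms
proof (induction V rule: finite_induct)
  case (insert v V)
  let ?Q = "rad_quad V c" and ?N = "rad_lin V (\<lambda>i. c v i + c i v)"
  define q where "q = rad_exp V (\<lambda>I. (?Q I)\<^sup>2)"
  define n where "n = rad_exp V (\<lambda>I. (?N I)\<^sup>2)"
  have nn: "0 \<le> q" "0 \<le> n" by (auto simp: q_def n_def intro!: rad_exp_nonneg)
  have "rad_exp (insert v V) (\<lambda>I. (rad_quad (insert v V) c I) ^ 4)
    = rad_exp V (\<lambda>I. (?Q I) ^ 4 + 6 * ((?N I)\<^sup>2 * (?Q I)\<^sup>2) + (?N I)\<^sup>2 * (?N I)\<^sup>2)"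
    using insert(1,2) by (intro rad_exp_insert)
      (auto simp: rad_quad_insert power2_eq_square power4_eq_xxxx algebra_simps)
  also have "\<dots> = rad_exp V (\<lambda>I. (?Q I) ^ 4) + 6 * rad_exp V (\<lambda>I. (?N I)\<^sup>2 * (?Q I)\<^sup>2)
      + rad_exp V (\<lambda>I. (?N I)\<^sup>2 * (?N I)\<^sup>2)"
    by (simp only: bern_exp_add bern_exp_cmult)
  also have "\<dots> \<le> 15 * q\<^sup>2 + 6 * (5 * n * q) + 3 * n * n"
    using insert.IH rad_lin_square_quad_square[OF insert(1), of "\<lambda>i. c v i + c i v" c]
      rad_lin_square_mult[OF insert(1), of "\<lambda>i. c v i + c i v" "\<lambda>i. c v i + c i v"]
    unfolding q_def n_def by linarith
  also have "\<dots> \<le> 15 * (q + n)\<^sup>2" using nn by (simp add: power2_eq_square algebra_simps)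
  finally show ?case using insert(1,2) by (simp add: rad_quad_square_insert n_def q_def)
qed simp

text \<open>
  The quartic \<open>3w\<^sup>2 + 2w - w^4 = - w (w - 2) (w + 1)\<^sup>2\<close> is nonpositive for \<open>w \<le> 0\<close> and at most
  \<open>27/5\<close>, so its mean, computed from the second and fourth moments, bounds a probability.
\<close>
lemma rad_quad_nonneg_prob:
  assumes "finite V"
  shows "1 / 36 \<le> rad_exp V (\<lambda>I. of_bool (0 \<le> rad_quad V c I))"
proof -
  let ?Q = "rad_quad V c"
  define q where "q = rad_exp V (\<lambda>I. (?Q I)\<^sup>2)"
  have q0: "0 \<le> q" by (auto simp: q_def intro!: rad_exp_nonneg)
  show ?thesis
  proof (cases "q = 0")
    case True
    have "?Q I = 0" if "I \<subseteq> V" for I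
    proof -
      have w: "0 < bern_weight V (\<lambda>_. 1/2) J" if "J \<subseteq> V" for J
        by (simp add: bern_weight_def prod_pos)
      have "\<forall>J\<in>Pow V. bern_weight V (\<lambda>_. 1/2) J * (?Q J)\<^sup>2 = 0"
        using True unfolding q_def bern_exp_def
        by (subst (asm) sum_nonneg_eq_0_iff) (use assms w in \<open>auto simp: less_imp_le\<close>)
      then have "bern_weight V (\<lambda>_. 1/2) I * (?Q I)\<^sup>2 = 0" using that by blast
      then show ?thesis using w[OF that] by simp
    qed
    then have "rad_exp V (\<lambda>I. of_bool (0 \<le> ?Q I)) = rad_exp V (\<lambda>I. 1)"
      by (intro bern_exp_cong) auto
    then show ?thesis using assms by simp
  next
    case False
    \<comment> \<open>The scale that maximises 3 q / s^2 - 15 q^2 / s^4; the maximum is 3 / 20, and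
      5 / 27 times this is 1 / 36.\<close>
    define s where "s = sqrt (10 * q)"
    have s: "0 < s" "s\<^sup>2 = 10 * q" using False q0 by (simp_all add: s_def)
    have s4: "s ^ 4 = 100 * q\<^sup>2" using s(2) by (simp add: power4_eq_xxxx power2_eq_square)
    have pt: "(5 / 27) * (3 * w\<^sup>2 + 2 * w - w ^ 4) \<le> of_bool (0 \<le> w)" for w :: real
    proof (cases "0 \<le> w")
      case True
      have "27 / 5 - (3 * w\<^sup>2 + 2 * w - w ^ 4) = (w\<^sup>2 - 2)\<^sup>2 + (w - 1)\<^sup>2 + 2 / 5"
        by (simp add: power2_eq_square power4_eq_xxxx algebra_simps)
      moreover have "0 \<le> (w\<^sup>2 - 2)\<^sup>2 + (w - 1)\<^sup>2" by simp
      ultimately have "3 * w\<^sup>2 + 2 * w - w ^ 4 \<le> 27 / 5" by linarith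
      then show ?thesis using True by simp
    next
      case False
      have "3 * w\<^sup>2 + 2 * w - w ^ 4 = - (w * (w - 2)) * (w + 1)\<^sup>2"
        by (simp add: power2_eq_square power4_eq_xxxx algebra_simps)
      also have "\<dots> \<le> 0" using False by (intro mult_nonpos_nonneg) (auto simp: mult_nonpos_nonpos)
      finally show ?thesis using False by simp
    qed
    have "1 / 36 = (5 / 27) * (3 * q / s\<^sup>2 - 15 * q\<^sup>2 / s ^ 4)"
      using False unfolding s s4 by (simp add: field_simps)
    also have "\<dots> \<le> (5 / 27) * (3 * q / s\<^sup>2 + 2 / s * rad_exp V ?Q - rad_exp V (\<lambda>I. (?Q I) ^ 4) / s ^ 4)"
      using rad_quad_fourth_moment[OF assms, of c] rad_quad_mean[OF assms, of c]
      by (simp add: q_def divide_right_mono)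
    also have "\<dots> = rad_exp V (\<lambda>I. (5 / 27) * ((3 / s\<^sup>2) * (?Q I)\<^sup>2 + (2 / s) * ?Q I - (1 / s ^ 4) * (?Q I) ^ 4))"
      by (simp only: bern_exp_add bern_exp_diff bern_exp_cmult q_def) simp
    also have "\<dots> \<le> rad_exp V (\<lambda>I. of_bool (0 \<le> ?Q I))"
    proof (rule bern_exp_mono)
      fix I
      have "0 \<le> ?Q I / s \<longleftrightarrow> 0 \<le> ?Q I" using s by (simp add: zero_le_divide_iff)
      then show "(5 / 27) * ((3 / s\<^sup>2) * (?Q I)\<^sup>2 + (2 / s) * ?Q I - (1 / s ^ 4) * (?Q I) ^ 4)
        \<le> of_bool (0 \<le> ?Q I)"
        using pt[of "?Q I / s"] by (simp add: power_divide)
    qed auto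
    finally show ?thesis .
  qed
qed

section \<open>Conditioning on the size of the support\<close>

text \<open>The product of two weights depends only on how many of the two sets contain each index,
  and moving \<open>Z\<close> from \<open>J\<close> to \<open>I\<close> preserves these
  counts.\<close>

lemma bern_weight_swap:
  assumes "finite V" "I \<subseteq> V" "J \<subseteq> V" "Z \<subseteq> J - I"
  shows "bern_weight V p I * bern_weight V p J = bern_weight V p (I \<union> Z) * bern_weight V p (J - Z)"
proof -
  have alt: "bern_weight V p A = (\<Prod>i\<in>V. if i \<in> A then p i else 1 - p i)" if "A \<subseteq> V" for A
  proof -
    have "V \<inter> {i. i \<in> A} = A" "V \<inter> - {i. i \<in> A} = V - A" using that by auto
    then show ?thesis using assms(1) by (simp add: bern_weight_def prod.If_cases)
  qed
  have "I \<union> Z \<subseteq> V" "J - Z \<subseteq> V" using assms by auto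
  then show ?thesis
    using assms unfolding alt[OF assms(2)] alt[OF assms(3)] alt[OF \<open>I \<union> Z \<subseteq> V\<close>] alt[OF \<open>J - Z \<subseteq> V\<close>]
      prod.distrib[symmetric]
    by (intro prod.cong) auto
qed

lemma sum_subsets_card:
  assumes "finite A" "k \<le> card A"
  shows "(\<Sum>Z | Z \<subseteq> A \<and> card Z = k. (x::real) / real (card A choose k)) = x"
  using assms by (simp add: n_subsets)

text \<open>
  Given supports \<open>I\<close>, \<open>J\<close> of sizes \<open>S \<le> l\<close>, move a random set \<open>Z \<subseteq> J - I\<close> of size \<open>l - S\<close> from
  \<open>J\<close> to \<open>I\<close>. This preserves the product of the weights, can be undone, and enlarges \<open>I\<close>; as
  \<open>|J - I|\<close> becomes \<open>|I - J|\<close>, the number of choices of \<open>Z\<close> is the same in both directions.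
\<close>
lemma fixed_card_mono:
  fixes V :: "'a set"
  assumes V: "finite V" and p: "\<And>i. i \<in> V \<Longrightarrow> p i \<in> {0..1}"
    and F: "\<And>I J. I \<subseteq> J \<Longrightarrow> J \<subseteq> V \<Longrightarrow> F I \<Longrightarrow> F J" and le: "S \<le> l"
  shows "bern_exp V p (\<lambda>I. of_bool (card I = S \<and> F I)) * bern_exp V p (\<lambda>I. of_bool (card I = l))
    \<le> bern_exp V p (\<lambda>I. of_bool (card I = l \<and> F I)) * bern_exp V p (\<lambda>I. of_bool (card I = S))"
proof -
  let ?w = "bern_weight V p"
  let ?U = "\<lambda>k. {I. I \<subseteq> V \<and> card I = k \<and> F I}" and ?W = "\<lambda>k. {J. J \<subseteq> V \<and> card J = k}"
  have E: "bern_exp V p (\<lambda>I. of_bool (P I)) = (\<Sum>I | I \<subseteq> V \<and> P I. ?w I)" for P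
    unfolding bern_exp_def using V by (intro sum.mono_neutral_cong_right) auto
  have fin: "finite A" if "A \<subseteq> V" for A using V that finite_subset by auto
  have prod: "(\<Sum>I | I \<subseteq> V \<and> P I. ?w I) * (\<Sum>I | I \<subseteq> V \<and> Q I. ?w I)
    = (\<Sum>(I, J)\<in>{I. I \<subseteq> V \<and> P I} \<times> {J. J \<subseteq> V \<and> Q J}. ?w I * ?w J)" for P Q
    by (simp add: sum_product sum.cartesian_product)
  define T where "T = (SIGMA x:?U S \<times> ?W l.
    {Z. Z \<subseteq> snd x - fst x \<and> card Z = l - S})"
  define T' where "T' = (SIGMA x:?U l \<times> ?W S.
    {Z. Z \<subseteq> fst x - snd x \<and> card Z = l - S})"
  \<comment> \<open>The weight of a pair is divided evenly among its admissible sets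
    \<open>Z\<close>, so that summing over \<open>Z\<close> returns it.\<close>
  define h where "h = (\<lambda>((I, J), Z :: 'a set). ?w I * ?w J / real (card (J - I) choose (l - S)))"
  define h' where "h' = (\<lambda>((I, J), Z :: 'a set). ?w I * ?w J / real (card (I - J) choose (l - S)))"
  define \<phi> where "\<phi> = (\<lambda>((I, J), Z :: 'a set). ((I \<union> Z, J - Z), Z))"
  have finPow: "finite {I. I \<subseteq> V \<and> P I}" for P using V by simp
  have diff: "l - S \<le> card (J - I)" if "I \<subseteq> V" "card J = l" "card I = S" for I J
    using diff_card_le_card_Diff[OF fin[OF that(1)], of J] that by simp
  have avg: "x = (\<Sum>Z | Z \<subseteq> J - I \<and> card Z = l - S. x / real (card (J - I) choose (l - S)))"
    if "I \<subseteq> V" "J \<subseteq> V" "card I = S" "card J = l" for I J and x :: real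
    using that diff[of I J] fin[of J] by (intro sum_subsets_card[symmetric]) auto
  have "(\<Sum>(I, J)\<in>?U S \<times> ?W l. ?w I * ?w J) = (\<Sum>x\<in>T. h x)"
  proof -
    have "(\<Sum>x\<in>T. h x) = (\<Sum>x\<in>?U S \<times> ?W l. \<Sum>Z | Z \<subseteq> snd x - fst x \<and> card Z = l - S. h (x, Z))"
      unfolding T_def using finPow fin
      by (subst sum.Sigma) (auto intro!: finite_subset[OF _ finPow[of "\<lambda>_. True"]])
    also have "\<dots> = (\<Sum>x\<in>?U S \<times> ?W l. ?w (fst x) * ?w (snd x))"
    proof (rule sum.cong[OF refl])
      fix x assume "x \<in> ?U S \<times> ?W l"
      then show "(\<Sum>Z | Z \<subseteq> snd x - fst x \<and> card Z = l - S. h (x, Z)) = ?w (fst x) * ?w (snd x)"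
        using avg[of "fst x" "snd x" "?w (fst x) * ?w (snd x)"] by (simp add: h_def split_beta mem_Times_iff)
    qed
    finally show ?thesis by (simp add: split_beta)
  qed
  moreover have "(\<Sum>(I, J)\<in>?U l \<times> ?W S. ?w I * ?w J) = (\<Sum>x\<in>T'. h' x)"
  proof -
    have "(\<Sum>x\<in>T'. h' x) = (\<Sum>x\<in>?U l \<times> ?W S. \<Sum>Z | Z \<subseteq> fst x - snd x \<and> card Z = l - S. h' (x, Z))"
      unfolding T'_def using finPow fin
      by (subst sum.Sigma) (auto intro!: finite_subset[OF _ finPow[of "\<lambda>_. True"]])
    also have "\<dots> = (\<Sum>x\<in>?U l \<times> ?W S. ?w (fst x) * ?w (snd x))"
    proof (rule sum.cong[OF refl])
      fix x assume "x \<in> ?U l \<times> ?W S"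
      then show "(\<Sum>Z | Z \<subseteq> fst x - snd x \<and> card Z = l - S. h' (x, Z)) = ?w (fst x) * ?w (snd x)"
        using avg[of "snd x" "fst x" "?w (fst x) * ?w (snd x)"] by (simp add: h'_def split_beta mem_Times_iff)
    qed
    finally show ?thesis by (simp add: split_beta)
  qed
  moreover have "(\<Sum>x\<in>T. h x) \<le> (\<Sum>x\<in>T'. h' x)"
  proof -
    have inj: "inj_on \<phi> T"
    proof (rule inj_on_inverseI[where g = "\<lambda>((A, B), Z). ((A - Z, B \<union> Z), Z)"])
      fix x assume xT: "x \<in> T"
      obtain I J Z where x: "x = ((I, J), Z)" by (metis surj_pair)
      have "Z \<subseteq> J - I" using xT by (simp add: T_def x)
      then have "I \<union> Z - Z = I" "J - Z \<union> Z = J" by auto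
      then show "(\<lambda>((A, B), Z). ((A - Z, B \<union> Z), Z)) (\<phi> x) = x" by (simp add: x \<phi>_def)
    qed
    have hh: "h x = h' (\<phi> x)" and sub: "\<phi> x \<in> T'" if xT: "x \<in> T" for x
    proof -
      obtain I J Z where x: "x = ((I, J), Z)" by (metis surj_pair)
      have I: "I \<subseteq> V" "card I = S" "F I" and J: "J \<subseteq> V" "card J = l"
        and Z: "Z \<subseteq> J - I" "card Z = l - S" using xT by (auto simp: T_def x)
      have fins: "finite I" "finite J" "finite Z"
        using fin[OF I(1)] fin[OF J(1)] Z(1) by (auto dest: finite_subset)
      have "I \<union> Z - (J - Z) = (I - J) \<union> Z" "(I - J) \<inter> Z = {}" using Z by auto
      then have "card (I \<union> Z - (J - Z)) = card (I - J) + (l - S)"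
        using Z fins by (simp add: card_Un_disjoint)
      also have "\<dots> = card (J - I)"
      proof -
        have "card I = card (I - J) + card (I \<inter> J)" "card J = card (J - I) + card (I \<inter> J)"
          using card_Diff_subset_Int[of I J] card_Diff_subset_Int[of J I] fins
            card_mono[of I "I \<inter> J"] card_mono[of J "I \<inter> J"] by (auto simp: Int_commute)
        then show ?thesis using I J le by simp
      qed
      finally have c: "card (I \<union> Z - (J - Z)) = card (J - I)" .
      show "h x = h' (\<phi> x)"
        using bern_weight_swap[OF V I(1) J(1) Z(1), of p] c by (simp add: x h_def h'_def \<phi>_def)
      have "card (I \<union> Z) = l" "card (J - Z) = S"
      proof -
        have "I \<inter> Z = {}" "Z \<subseteq> J" using Z by auto
        then show "card (I \<union> Z) = l" "card (J - Z) = S"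
          using fins Z(2) I(2) J(2) le by (simp_all add: card_Un_disjoint card_Diff_subset)
      qed
      moreover have "I \<union> Z \<subseteq> V" using I J Z by auto
      moreover have "F (I \<union> Z)" using F[of I "I \<union> Z"] I \<open>I \<union> Z \<subseteq> V\<close> by auto
      ultimately show "\<phi> x \<in> T'" using J Z by (auto simp: x \<phi>_def T'_def)
    qed
    have "(\<Sum>x\<in>T. h x) = (\<Sum>y\<in>\<phi> ` T. h' y)"
      using inj hh by (simp add: sum.reindex)
    also have "\<dots> \<le> (\<Sum>x\<in>T'. h' x)"
    proof (rule sum_mono2)
      show "finite T'" unfolding T'_def
      proof (intro finite_SigmaI finite_cartesian_product finPow)
        fix x assume "x \<in> ?U l \<times> ?W S"
        then have "fst x \<subseteq> V" by auto
        then have "{Z. Z \<subseteq> fst x - snd x \<and> card Z = l - S} \<subseteq> Pow V" by blast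
        then show "finite {Z. Z \<subseteq> fst x - snd x \<and> card Z = l - S}"
          by (rule finite_subset) (simp add: V)
      qed
      show "\<phi> ` T \<subseteq> T'" using sub by auto
      show "0 \<le> h' y" if yT: "y \<in> T' - \<phi> ` T" for y
      proof -
        obtain I J Z where y: "y = ((I, J), Z)" by (metis surj_pair)
        have IJ: "I \<subseteq> V" "J \<subseteq> V" using yT by (simp_all add: y T'_def)
        have "0 \<le> ?w I" "0 \<le> ?w J" by (rule bern_weight_nonneg[OF p]; use IJ in simp)+
        then show ?thesis by (simp add: y h'_def)
      qed
    qed
    finally show ?thesis .
  qed
  ultimately show ?thesis unfolding E prod by simp
qed

text \<open>For each l \<ge> S the event is at least as likely given size l as given size
  \<open>S\<close>. Hence its probability given size \<open>S\<close> is at most the one given size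
  at least \<open>S\<close>, a condition of probability at least 1/2. Products in place of
  conditional probabilities cover sizes of probability zero.\<close>

lemma bern_exp_fixed_card_le:
  assumes V: "finite V" and p: "\<And>i. i \<in> V \<Longrightarrow> p i \<in> {0..1}"
    and F: "\<And>I J. I \<subseteq> J \<Longrightarrow> J \<subseteq> V \<Longrightarrow> F I \<Longrightarrow> F J"
    and half: "1 / 2 \<le> bern_exp V p (\<lambda>I. of_bool (S \<le> card I))"
  shows "bern_exp V p (\<lambda>I. of_bool (card I = S \<and> F I))
    \<le> 2 * bern_exp V p (\<lambda>I. of_bool (F I)) * bern_exp V p (\<lambda>I. of_bool (card I = S))"
proof -
  let ?a = "bern_exp V p (\<lambda>I. of_bool (card I = S \<and> F I))" and ?w = "bern_exp V p (\<lambda>I. of_bool (card I = S))"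
  have a0: "0 \<le> ?a" "0 \<le> ?w" by (auto intro!: bern_exp_nonneg p)
  have "?a * (1 / 2) \<le> ?a * bern_exp V p (\<lambda>I. of_bool (S \<le> card I))"
    using half a0 by (intro mult_left_mono)
  also have "bern_exp V p (\<lambda>I. of_bool (S \<le> card I))
    = bern_exp V p (\<lambda>I. \<Sum>l\<in>{S..card V}. of_bool (card I = l))"
  proof (rule bern_exp_cong)
    fix I assume "I \<subseteq> V"
    then have "card I \<le> card V" using V card_mono by blast
    then show "of_bool (S \<le> card I) = (\<Sum>l\<in>{S..card V}. of_bool (card I = l) :: real)"
      by (simp add: of_bool_def)
  qed simp
  also have "?a * \<dots> = (\<Sum>l\<in>{S..card V}. ?a * bern_exp V p (\<lambda>I. of_bool (card I = l)))"
    by (simp only: bern_exp_sum sum_distrib_left)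
  also have "\<dots> \<le> (\<Sum>l\<in>{S..card V}. bern_exp V p (\<lambda>I. of_bool (card I = l \<and> F I)) * ?w)"
  proof (rule sum_mono)
    fix l assume "l \<in> {S..card V}"
    then show "?a * bern_exp V p (\<lambda>I. of_bool (card I = l))
      \<le> bern_exp V p (\<lambda>I. of_bool (card I = l \<and> F I)) * ?w"
      by (intro fixed_card_mono) (rule V, erule p, erule (2) F, simp)
  qed
  also have "\<dots> = bern_exp V p (\<lambda>I. \<Sum>l\<in>{S..card V}. of_bool (card I = l \<and> F I)) * ?w"
    by (simp only: bern_exp_sum sum_distrib_right)
  also have "\<dots> \<le> bern_exp V p (\<lambda>I. of_bool (F I)) * ?w"
  proof (intro mult_right_mono bern_exp_mono p a0)
    fix I assume "I \<subseteq> V"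
    show "(\<Sum>l\<in>{S..card V}. of_bool (card I = l \<and> F I) :: real) \<le> of_bool (F I)"
      by (cases "F I") (simp_all add: of_bool_def)
  qed
  finally show ?thesis by simp
qed

section \<open>The median of a sum of independent indicators\<close>

text \<open>Tychonoff's theorem for functions on the whole type. In the applications the coordinates
  outside the index range are pinned to 0 by a singleton factor.\<close>

lemma compact_box:
  fixes C :: "'a \<Rightarrow> real set"
  assumes "\<And>i. compact (C i)"
  shows "compact {f. \<forall>i. f i \<in> C i}"
proof -
  have "compactin (product_topology (\<lambda>_. euclidean) UNIV) (PiE UNIV C)"
    using assms by (simp add: compactin_PiE)
  then show ?thesis by (simp add: euclidean_product_topology PiE_def Pi_def)
qed

section \<open>Binomial probabilities\<close>

definition binom_prob :: "nat \<Rightarrow> real \<Rightarrow> nat \<Rightarrow> real" where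
  "binom_prob n q k = real (n choose k) * q ^ k * (1 - q) ^ (n - k)"

text \<open>The ratio of consecutive binomial probabilities, multiplied out to cover vanishing
  denominators.\<close>

lemma binom_prob_Suc:
  assumes "k < n"
  shows "binom_prob n q (Suc k) * (real (Suc k) * (1 - q)) = binom_prob n q k * (real (n - k) * q)"
proof -
  have "real (Suc k) * real (n choose Suc k) = real (n - k) * real (n choose k)"
    using binomial_absorb_comp[of n k] binomial_absorption[of k n]
    by (metis of_nat_mult)
  moreover have "(1 - q) ^ (n - k) = (1 - q) ^ (n - Suc k) * (1 - q)"
    using assms by (metis Suc_diff_Suc power_Suc2)
  ultimately show ?thesis by (simp add: binom_prob_def mult_ac del: of_nat_Suc)
qed

lemma binom_prob_nonneg: "0 \<le> q \<Longrightarrow> q \<le> 1 \<Longrightarrow> 0 \<le> binom_prob n q k"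
  by (simp add: binom_prob_def)

lemma binom_prob_sum: "(\<Sum>k\<le>n. binom_prob n q k) = 1"
  using binomial_ring[of q "1 - q" n] by (simp add: binom_prob_def)

lemma bern_exp_binom:
  assumes "finite G"
  shows "bern_exp G (\<lambda>_. q) (\<lambda>I. h (card I)) = (\<Sum>k\<le>card G. binom_prob (card G) q k * h k)"
proof -
  have "bern_exp G (\<lambda>_. q) (\<lambda>I. h (card I))
    = (\<Sum>I\<in>Pow G. q ^ card I * (1 - q) ^ (card G - card I) * h (card I))"
    unfolding bern_exp_def bern_weight_def using assms
    by (intro sum.cong) (auto simp: card_Diff_subset finite_subset)
  also have "\<dots> = (\<Sum>k\<le>card G. \<Sum>I | I \<in> Pow G \<and> card I = k. q ^ card I * (1 - q) ^ (card G - card I) * h (card I))"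
    using assms by (intro sum.group[symmetric]) (auto simp: card_mono)
  also have "\<dots> = (\<Sum>k\<le>card G. binom_prob (card G) q k * h k)"
    using assms by (intro sum.cong) (simp_all add: n_subsets binom_prob_def)
  finally show ?thesis .
qed

lemma bern_exp_zero:
  assumes "finite V" "\<And>i. i \<in> V \<Longrightarrow> p i = 0"
  shows "bern_exp V p f = f {}"
  using assms by (induction V arbitrary: f rule: finite_induct) (simp_all add: bern_exp_insert)

lemma bern_exp_one:
  assumes "finite V" "\<And>i. i \<in> V \<Longrightarrow> p i = 1"
  shows "bern_exp V p f = f V"
  using assms by (induction V arbitrary: f rule: finite_induct) (simp_all add: bern_exp_insert)

text \<open>The size is the constant \<open>card A\<close> plus a binomial variable. The extremal
  vector in the median theorem has this shape.\<close>

lemma bern_exp_card_three_values: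
  assumes "finite A" "finite G" "finite Z" "A \<inter> G = {}" "(A \<union> G) \<inter> Z = {}"
    and "\<And>i. i \<in> A \<Longrightarrow> p i = 1" "\<And>i. i \<in> G \<Longrightarrow> p i = q" "\<And>i. i \<in> Z \<Longrightarrow> p i = 0"
  shows "bern_exp (A \<union> G \<union> Z) p (\<lambda>I. h (card I))
    = (\<Sum>k\<le>card G. binom_prob (card G) q k * h (card A + k))"
proof -
  have "bern_exp (A \<union> G \<union> Z) p (\<lambda>I. h (card I)) = bern_exp (A \<union> G) p (\<lambda>I. h (card I))"
    using assms by (subst bern_exp_union) (auto simp: bern_exp_zero)
  also have "\<dots> = bern_exp G p (\<lambda>J. h (card (A \<union> J)))"
    using assms by (subst bern_exp_union) (auto simp: bern_exp_one)
  also have "\<dots> = bern_exp G (\<lambda>_. q) (\<lambda>J. h (card A + card J))"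
    using assms
    by (intro bern_exp_cong arg_cong[of _ _ h] card_Un_disjoint) (auto intro: finite_subset)
  finally show ?thesis using assms(2) by (simp add: bern_exp_binom[of G q "\<lambda>k. h (card A + k)"])
qed

text \<open>Reflection about m - 1/2: if the mean \<open>m\<close> is at most n / 2, the masses
  below it are dominated by their mirror images. The induction compares ratios of consecutive
  probabilities on the two sides.\<close>

lemma binom_prob_pairing:
  assumes m: "0 < m" "2 * m \<le> n" and q: "real n * q = real m" and "k < m"
  shows "binom_prob n q (m - 1 - k) \<le> binom_prob n q (m + k)"
  using \<open>k < m\<close>
proof (induction k)
  have n: "0 < n" "m < n" using m by auto
  have q01: "0 < q" "q < 1"
  proof -
    have "q = real m / real n" using q n by (simp add: field_simps)
    then show "0 < q" "q < 1" using m n by simp_all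
  qed
  note nonneg = binom_prob_nonneg[OF less_imp_le[OF q01(1)] less_imp_le[OF q01(2)]]
  {
    case 0
    have "binom_prob n q (m - 1) * (real m * (1 - q)) \<le> binom_prob n q (m - 1) * (real (n - (m - 1)) * q)"
    proof (intro mult_left_mono nonneg)
      have "real (n - (m - 1)) * q = real m - real m * q + q"
        using m n q by (simp add: of_nat_diff algebra_simps)
      then show "real m * (1 - q) \<le> real (n - (m - 1)) * q" using q01 by (simp add: algebra_simps)
    qed
    also have "\<dots> = binom_prob n q m * (real m * (1 - q))"
      using binom_prob_Suc[of "m - 1" n q] m n by simp
    finally show ?case using m q01 by (simp add: mult_le_cancel_right)
  next
    case (Suc k)
    define s where "s = real n - real m"
    have s: "real n * (1 - q) = s" "real m \<le> s" using q m by (auto simp: s_def algebra_simps)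
    have km: "Suc k < m" by (rule Suc.prems)
    let ?B = "real (n - (m + k)) * q" and ?C = "real (Suc (m + k)) * (1 - q)"
    let ?D = "real (m - 1 - k) * (1 - q)" and ?E = "real (n - (m - 1 - Suc k)) * q"
    have up: "binom_prob n q (m + Suc k) * ?C = binom_prob n q (m + k) * ?B"
      using binom_prob_Suc[of "m + k" n q] km m by simp
    have down: "binom_prob n q (m - 1 - k) * ?D = binom_prob n q (m - 1 - Suc k) * ?E"
    proof -
      have "Suc (m - 1 - Suc k) = m - 1 - k" using km by simp
      then show ?thesis using binom_prob_Suc[of "m - 1 - Suc k" n q] km m by simp
    qed
    have pos: "0 < ?E" "0 < ?C" "0 \<le> ?D" using q01 km n by auto
    \<comment> \<open>After multiplication by n^2 the factors n q and n (1 - q) become m and s, with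
      m \<le> s. It remains to compare (m^2 - (k + 1)^2) s^2 with ((s + 1)^2 - (k + 1)^2)
      m^2.\<close>
    have key: "?D * ?C \<le> ?B * ?E"
    proof -
      have "real (n - (m + k)) = s - real k" using km m by (simp add: s_def of_nat_diff)
      then have nB: "real n * ?B = (s - real k) * real m"
        using q by (simp only: mult.left_commute[of "real n"])
      have "real (n - (m - 1 - Suc k)) = s + real k + 2" using km m by (simp add: s_def of_nat_diff)
      then have nE: "real n * ?E = (s + real k + 2) * real m"
        using q by (simp only: mult.left_commute[of "real n"])
      have nC: "real n * ?C = (real m + real k + 1) * s"
        using s(1) by (simp add: mult.left_commute[of "real n"] mult.commute[of s])
      have nD: "real n * ?D = (real m - 1 - real k) * s"
        using s(1) km by (simp add: mult.left_commute[of "real n"] of_nat_diff)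
      have sq: "(real m)\<^sup>2 \<le> s\<^sup>2" using s(2) by (intro power_mono) auto
      have "(real m - 1 - real k) * s * ((real m + real k + 1) * s)
        = (real m)\<^sup>2 * s\<^sup>2 - (real k + 1)\<^sup>2 * s\<^sup>2" by (simp add: power2_eq_square algebra_simps)
      also have "\<dots> \<le> (real m)\<^sup>2 * (s + 1)\<^sup>2 - (real k + 1)\<^sup>2 * (real m)\<^sup>2"
        using sq s(2) by (intro diff_mono mult_left_mono) (auto simp: power2_eq_square algebra_simps)
      also have "\<dots> = (s - real k) * real m * ((s + real k + 2) * real m)"
        by (simp add: power2_eq_square algebra_simps)
      finally have "(real n * ?D) * (real n * ?C) \<le> (real n * ?B) * (real n * ?E)"
        unfolding nB nC nD nE .
      then have "(real n * real n) * (?D * ?C) \<le> (real n * real n) * (?B * ?E)"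
        by (simp only: mult_ac)
      then show ?thesis using n by (simp only: mult_le_cancel_left_pos of_nat_0_less_iff mult_pos_pos)
    qed
    have "(binom_prob n q (m - 1 - Suc k) * ?E) * ?C = binom_prob n q (m - 1 - k) * (?D * ?C)"
      using down by simp
    also have "\<dots> \<le> binom_prob n q (m + k) * (?B * ?E)"
    proof (rule mult_mono[OF _ key nonneg])
      show "binom_prob n q (m - 1 - k) \<le> binom_prob n q (m + k)" using Suc.IH km by simp
      show "0 \<le> ?D * ?C" by (rule mult_nonneg_nonneg[OF pos(3) less_imp_le[OF pos(2)]])
    qed
    also have "\<dots> = binom_prob n q (m + Suc k) * ?C * ?E" unfolding up by simp
    finally have "binom_prob n q (m - 1 - Suc k) * (?E * ?C) \<le> binom_prob n q (m + Suc k) * (?E * ?C)"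
      by (simp only: mult_ac)
    then show ?case using mult_pos_pos[OF pos(1,2)] by (simp only: mult_le_cancel_right_pos)
  }
qed

text \<open>The points below \<open>m\<close> are paired with m, ..., 2 m - 1, which lie in the
  range because 2 m \<le> n. So the upper part has at least half of the total mass 1.\<close>

lemma binom_prob_median:
  assumes m: "0 < m" "2 * m \<le> n" and q: "real n * q = real m"
  shows "1 / 2 \<le> (\<Sum>k\<le>n. binom_prob n q k * of_bool (m \<le> k))"
proof -
  have q01: "0 \<le> q" "q \<le> 1"
  proof -
    have "q = real m / real n" using q m by (simp add: field_simps)
    then show "0 \<le> q" "q \<le> 1" using m by simp_all
  qed
  have split: "{..n} = {..<m} \<union> {m..n}" using m by auto
  have "(\<Sum>k<m. binom_prob n q k) = (\<Sum>k<m. binom_prob n q (m - 1 - k))"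
    using sum.nat_diff_reindex[of "binom_prob n q" m] by simp
  also have "\<dots> \<le> (\<Sum>k<m. binom_prob n q (m + k))"
    by (intro sum_mono binom_prob_pairing[OF m q]) auto
  also have "\<dots> = (\<Sum>k\<in>{m..<m + m}. binom_prob n q k)"
    by (simp add: sum.shift_bounds_nat_ivl[of _ 0 m m, simplified] atLeast0LessThan add.commute)
  also have "\<dots> \<le> (\<Sum>k\<in>{m..n}. binom_prob n q k)"
    using m q01 by (intro sum_mono2) (auto simp: binom_prob_nonneg)
  finally have "(\<Sum>k<m. binom_prob n q k) \<le> (\<Sum>k\<in>{m..n}. binom_prob n q k)" .
  moreover have "(\<Sum>k<m. binom_prob n q k) + (\<Sum>k\<in>{m..n}. binom_prob n q k) = 1"
    using binom_prob_sum[of n q] unfolding split by (subst (asm) sum.union_disjoint) auto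
  moreover have "(\<Sum>k\<le>n. binom_prob n q k * of_bool (m \<le> k)) = (\<Sum>k\<in>{m..n}. binom_prob n q k)"
    by (intro sum.mono_neutral_cong_right) auto
  ultimately show ?thesis by linarith
qed

text \<open>The tail probability is symmetric and affine in the two entries, hence a function of
  their sum and product; with the sum fixed it is affine in the product. The slope compares the
  probabilities of sizes S - 2 and S - 1 for the remaining set, written with additions to avoid
  truncated subtraction.\<close>

lemma bern_exp_two_points:
  assumes V: "finite V" "i \<in> V" "j \<in> V" "i \<noteq> j"
    and q: "\<And>k. k \<in> V \<Longrightarrow> k \<noteq> i \<Longrightarrow> k \<noteq> j \<Longrightarrow> q k = p k" "q i + q j = p i + p j"
  shows "bern_exp V q (\<lambda>I. of_bool (S \<le> card I)) - bern_exp V p (\<lambda>I. of_bool (S \<le> card I))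
    = (q i * q j - p i * p j) * (bern_exp (V - {i, j}) p (\<lambda>I. of_bool (card I + 2 = S))
        - bern_exp (V - {i, j}) p (\<lambda>I. of_bool (card I + 1 = S)))"
proof -
  define W where "W = V - {i, j}"
  have W: "finite W" "i \<notin> insert j W" "j \<notin> W" "V = insert i (insert j W)" using V by (auto simp: W_def)
  have identity: "(a * b * x + (a + b - 2 * (a * b)) * y + (1 - a - b + a * b) * w)
      - (c * d * x + (c + d - 2 * (c * d)) * y + (1 - c - d + c * d) * w)
    = (a * b - c * d) * ((x - y) - (y - w))" if "a + b = c + d" for a b c d x y w :: real
  proof -
    have "b = c + d - a" using that by simp
    then show ?thesis by (simp add: algebra_simps)
  qed
  let ?e = "\<lambda>m. bern_exp W p (\<lambda>I. of_bool (S \<le> card I + m) :: real)"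
  have card: "card (insert j I) = card I + 1" "card (insert i (insert j I)) = card I + 2"
    "card (insert i I) = card I + 1" if "I \<subseteq> W" for I
    using that W finite_subset[OF that W(1)] by (auto simp: card_insert_if)
  have ex: "bern_exp V r (\<lambda>I. of_bool (S \<le> card I))
    = r i * r j * ?e 2 + (r i + r j - 2 * (r i * r j)) * ?e 1 + (1 - r i - r j + r i * r j) * ?e 0"
    if r: "\<forall>k\<in>V. k \<noteq> i \<longrightarrow> k \<noteq> j \<longrightarrow> r k = p k" for r
  proof -
    have rp: "\<And>k. k \<in> W \<Longrightarrow> r k = p k" using r by (auto simp: W_def)
    have "bern_exp V r (\<lambda>I. of_bool (S \<le> card I))
      = r i * (r j * bern_exp W r (\<lambda>I. of_bool (S \<le> card (insert i (insert j I))))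
          + (1 - r j) * bern_exp W r (\<lambda>I. of_bool (S \<le> card (insert i I))))
        + (1 - r i) * (r j * bern_exp W r (\<lambda>I. of_bool (S \<le> card (insert j I)))
          + (1 - r j) * bern_exp W r (\<lambda>I. of_bool (S \<le> card I)))"
      using W by (simp add: bern_exp_insert)
    also have "bern_exp W r (\<lambda>I. of_bool (S \<le> card (insert i (insert j I)))) = ?e 2"
      by (rule bern_exp_cong) (simp_all add: card rp)
    also have "bern_exp W r (\<lambda>I. of_bool (S \<le> card (insert i I))) = ?e 1"
      by (rule bern_exp_cong) (simp_all add: card rp)
    also have "bern_exp W r (\<lambda>I. of_bool (S \<le> card (insert j I))) = ?e 1"
      by (rule bern_exp_cong) (simp_all add: card rp)
    also have "bern_exp W r (\<lambda>I. of_bool (S \<le> card I)) = ?e 0"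
      by (rule bern_exp_cong) (simp_all add: rp)
    finally show ?thesis by (simp add: algebra_simps)
  qed
  have "bern_exp W p (\<lambda>I. of_bool (card I + 2 = S)) = ?e 2 - ?e 1"
    "bern_exp W p (\<lambda>I. of_bool (card I + 1 = S)) = ?e 1 - ?e 0"
    unfolding bern_exp_diff[symmetric] by (auto intro!: bern_exp_cong)
  moreover have "\<forall>k\<in>V. k \<noteq> i \<longrightarrow> k \<noteq> j \<longrightarrow> q k = p k" using q(1) by blast
  ultimately show ?thesis unfolding W_def[symmetric]
    using ex[of q] ex[of p] identity[OF q(2)] by simp
qed

text \<open>
  Jogdeo and Samuels: an integer mean is a median. Among all probability vectors with sum \<open>S\<close>
  take one that minimises the probability and, secondarily, the sum of squares. Moving two entries
  changes the probability by a multiple of the change of their product, so that at the minimiser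
  all entries in \<open>(0, 1)\<close> are equal. Padding the vector with zeros to length at least \<open>2S\<close> forces
  the common entry to be at most 1/2.
\<close>
lemma poisson_binomial_median:
  fixes p :: "nat \<Rightarrow> real"
  assumes p: "\<And>i. i < K \<Longrightarrow> p i \<in> {0..1}" and S: "(\<Sum>i<K. p i) = real S"
  shows "1 / 2 \<le> bern_exp {..<K} p (\<lambda>I. of_bool (S \<le> card I))"
proof -
  define N where "N = max K (2 * S)"
  define X where "X = {p. \<forall>i. p i \<in> (if i < N then {0..1} else {0 :: real})} \<inter> {p. (\<Sum>i<N. p i) = real S}"
  define f where "f p = bern_exp {..<N} p (\<lambda>I. of_bool (S \<le> card I))" for p :: "nat \<Rightarrow> real"
  define g where "g p = (\<Sum>i<N. (p i)\<^sup>2)" for p :: "nat \<Rightarrow> real"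
  have cont: "continuous_on UNIV f" "continuous_on UNIV g" "continuous_on UNIV (\<lambda>p. \<Sum>i<N. p i :: real)"
    unfolding f_def g_def bern_exp_def bern_weight_def
    by (intro continuous_intros continuous_on_product_coordinates)+
  have X: "compact X"
    unfolding X_def
    by (intro compact_Int_closed compact_box closed_Collect_eq cont continuous_on_const) auto
  define p0 where "p0 i = (if i < K then p i else 0)" for i
  have KN: "{..<N} = {..<K} \<union> {K..<N}" by (auto simp: N_def)
  have p0X: "p0 \<in> X"
  proof -
    have "(\<Sum>i<N. p0 i) = (\<Sum>i<K. p i)"
      unfolding p0_def KN by (subst sum.union_disjoint) auto
    then show ?thesis using p S by (auto simp: X_def p0_def N_def)
  qed
  have fp0: "f p0 = bern_exp {..<K} p (\<lambda>I. of_bool (S \<le> card I))"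
  proof -
    have zero: "bern_exp {K..<N} p0 h = h {}" for h
      by (rule bern_exp_zero) (auto simp: p0_def)
    have "f p0 = bern_exp {..<K} p0 (\<lambda>I. of_bool (S \<le> card I))"
      using zero unfolding f_def KN by (subst bern_exp_union) auto
    also have "\<dots> = bern_exp {..<K} p (\<lambda>I. of_bool (S \<le> card I))"
      by (rule bern_exp_cong) (auto simp: p0_def)
    finally show ?thesis .
  qed
  obtain p1 where p1: "p1 \<in> X" "\<And>q. q \<in> X \<Longrightarrow> f p1 \<le> f q"
    using continuous_attains_inf[OF X _ continuous_on_subset[OF cont(1)]] p0X by blast
  \<comment> \<open>The set of minimisers of \<open>f\<close>, on which \<open>g\<close> is
    minimised next.\<close>
  define Y where "Y = X \<inter> {p. f p \<le> f p1}"
  have "compact Y" unfolding Y_def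
    by (intro compact_Int_closed X closed_Collect_le cont continuous_on_const)
  then obtain u where uY: "u \<in> Y" and gu: "\<And>q. q \<in> Y \<Longrightarrow> g u \<le> g q"
    using continuous_attains_inf[OF _ _ continuous_on_subset[OF cont(2)], of Y] p1 unfolding Y_def by blast
  have uX: "u \<in> X" and fu: "\<And>q. q \<in> X \<Longrightarrow> f u \<le> f q"
    using uY p1(2) unfolding Y_def by (auto intro: order_trans)
  have u01: "0 \<le> u i" "u i \<le> 1" if "i < N" for i using uX that by (auto simp: X_def dest!: spec[of _ i])
  have u_out: "u i = 0" if "\<not> i < N" for i using uX that by (auto simp: X_def dest!: spec[of _ i])
  have sum_u: "(\<Sum>i<N. u i) = real S" using uX by (simp add: X_def)

  define D where "D i j = bern_exp ({..<N} - {i, j}) u (\<lambda>I. of_bool (card I + 2 = S))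
    - bern_exp ({..<N} - {i, j}) u (\<lambda>I. of_bool (card I + 1 = S))" for i j
  have move: "u(i := a, j := b) \<in> X" "f (u(i := a, j := b)) - f u = (a * b - u i * u j) * D i j"
    if ij: "i < N" "j < N" "i \<noteq> j" and ab: "a + b = u i + u j" "0 \<le> a" "a \<le> 1" "0 \<le> b" "b \<le> 1"
    for i j a b
  proof -
    have N: "{..<N} = insert i (insert j ({..<N} - {i, j}))" using ij by auto
    have "(\<Sum>k<N. (u(i := a, j := b)) k) = (\<Sum>k<N. u k)"
      using ij ab(1) by (subst (1 2) N) (simp add: sum.insert_remove)
    then show "u(i := a, j := b) \<in> X" using sum_u ij ab by (auto simp: X_def u01 u_out)
    show "f (u(i := a, j := b)) - f u = (a * b - u i * u j) * D i j"
      unfolding f_def D_def using ij ab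
      by (subst bern_exp_two_points[of "{..<N}" i j]) auto
  qed
  \<comment> \<open>Averaging two unequal entries raises their product and lowers the sum of
    squares. Minimality of \<open>f\<close> gives D \<ge> 0, and with D = 0 the averaged vector
    would be a minimiser with smaller \<open>g\<close>.\<close>
  have D_pos: "0 < D i j" if ij: "i < N" "j < N" "u i \<noteq> u j" for i j
  proof -
    define m where "m = (u i + u j) / 2"
    have ne: "i \<noteq> j" using ij by auto
    let ?q = "u(i := m, j := m)"
    have m: "m + m = u i + u j" "0 \<le> m" "m \<le> 1" using u01[OF ij(1)] u01[OF ij(2)] by (auto simp: m_def)
    note mv = move[OF ij(1,2) ne m(1) m(2,3) m(2,3)]
    have mm: "m * m - u i * u j = ((u i - u j) / 2)\<^sup>2" by (simp add: m_def power2_eq_square field_simps)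
    then have pos: "0 < m * m - u i * u j" using ij(3) by simp
    have "0 \<le> (m * m - u i * u j) * D i j" using fu[OF mv(1)] mv(2) by simp
    then have "0 \<le> D i j" using pos by (simp add: zero_le_mult_iff)
    moreover have "D i j \<noteq> 0"
    proof
      assume "D i j = 0"
      then have "f ?q = f u" using mv(2) by simp
      then have "?q \<in> Y" using mv(1) uY by (simp add: Y_def)
      then have "g u \<le> g ?q" by (rule gu)
      moreover have "g ?q - g u = 2 * m\<^sup>2 - (u i)\<^sup>2 - (u j)\<^sup>2"
      proof -
        have N: "{..<N} = insert i (insert j ({..<N} - {i, j}))" using ij by auto
        show ?thesis unfolding g_def using ne by (subst (1 2) N) (simp add: sum.insert_remove)
      qed
      moreover have "2 * m\<^sup>2 - (u i)\<^sup>2 - (u j)\<^sup>2 = - 2 * ((u i - u j) / 2)\<^sup>2"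
        by (simp add: m_def power2_eq_square field_simps)
      moreover have "0 < ((u i - u j) / 2)\<^sup>2" using ij(3) by simp
      ultimately show False by linarith
    qed
    ultimately show ?thesis by simp
  qed
  \<comment> \<open>Moving two distinct fractional entries apart lowers their product, and since D >
    0 this would lower \<open>f\<close>.\<close>
  have equal: "u i = u j" if ij: "i < N" "j < N" "0 < u i" "u i < 1" "0 < u j" "u j < 1" for i j
  proof -
    have "\<not> u i < u j" if ij: "i < N" "j < N" "0 < u i" "u j < 1" for i j
    proof
      assume less: "u i < u j"
      \<comment> \<open>The largest shift that keeps both entries in [0, 1].\<close>
      define d where "d = min (u i) (1 - u j)"
      have d: "0 < d" "d \<le> u i" "d \<le> 1 - u j" using ij by (auto simp: d_def)
      have ne: "i \<noteq> j" using less by auto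
      have ab: "(u i - d) + (u j + d) = u i + u j" "0 \<le> u i - d" "u i - d \<le> 1" "0 \<le> u j + d" "u j + d \<le> 1"
        using d less ij u01[OF ij(1)] u01[OF ij(2)] by auto
      note mv = move[OF ij(1,2) ne ab]
      have "(u i - d) * (u j + d) - u i * u j = - (d * (u j - u i) + d * d)" by (simp add: algebra_simps)
      moreover have "0 < d * (u j - u i) + d * d" using d less by (intro add_pos_pos mult_pos_pos) auto
      ultimately have "(u i - d) * (u j + d) - u i * u j < 0" by linarith
      then have "((u i - d) * (u j + d) - u i * u j) * D i j < 0"
        using D_pos[of i j] ij less by (intro mult_neg_pos) auto
      then show False using fu[OF mv(1)] mv(2) by simp
    qed
    then show ?thesis using ij by (meson linorder_neqE_linordered_idom)
  qed

  define A where "A = {i. i < N \<and> u i = 1}"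
  define G where "G = {i. i < N \<and> 0 < u i \<and> u i < 1}"
  define Z where "Z = {i. i < N \<and> u i = 0}"
  have AGZ: "{..<N} = A \<union> G \<union> Z" "finite A" "finite G" "finite Z" "A \<inter> G = {}" "(A \<union> G) \<inter> Z = {}"
    using u01 by (auto simp: A_def G_def Z_def order_less_le)
  have sumAG: "real S = real (card A) + (\<Sum>i\<in>G. u i)"
  proof -
    have "(\<Sum>i<N. u i) = (\<Sum>i\<in>A. u i) + (\<Sum>i\<in>G. u i) + (\<Sum>i\<in>Z. u i)"
      unfolding AGZ(1) using AGZ(2-) by (subst sum.union_disjoint, simp, simp, simp, subst sum.union_disjoint) auto
    then show ?thesis using sum_u by (simp add: A_def Z_def)
  qed
  have "1 / 2 \<le> f u"
  proof (cases "G = {}")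
    case True
    \<comment> \<open>Without fractional entries the size is the constant \<open>S\<close>; the
      success probability 0 is a placeholder for the empty group.\<close>
    have "f u = (\<Sum>k\<le>card G. binom_prob (card G) 0 k * of_bool (S \<le> card A + k))"
      unfolding f_def AGZ(1)
      by (rule bern_exp_card_three_values[OF AGZ(2-6)]) (use True in \<open>auto simp: A_def Z_def\<close>)
    then show ?thesis using True sumAG by (simp add: binom_prob_def)
  next
    case False
    then obtain i0 where i0: "i0 \<in> G" by auto
    define q where "q = u i0"
    define n where "n = card G"
    define m where "m = S - card A"
    have q: "0 < q" "q < 1" using i0 by (auto simp: q_def G_def)
    have uG: "u i = q" if "i \<in> G" for i using that i0 equal[of i i0] by (auto simp: q_def G_def)
    have n: "0 < n" using i0 AGZ(3) by (auto simp: n_def card_gt_0_iff)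
    have nq: "real S = real (card A) + real n * q" using sumAG uG by (simp add: n_def)
    have "0 < real n * q" using n q by simp
    then have Sm: "S = card A + m" "0 < m" using nq by (auto simp: m_def)
    have nqm: "real n * q = real m" using nq Sm by simp
    \<comment> \<open>A zero entry would differ from a fractional one, so D > 0. But D is the
      difference of the binomial probabilities at m - 2 and m - 1 for n - 1 trials (the former taken
      as 0 if m = 1), and these increase up to the mode. So no zero of the padding survives in the
      minimiser, and the length \<open>N\<close> is made up of ones and fractional entries.\<close>
    have "Z = {}"
    proof (rule ccontr)
      assume "Z \<noteq> {}"
      then obtain z where z: "z \<in> Z" by auto
      have zi: "z \<noteq> i0" using z i0 by (auto simp: Z_def G_def)
      have W: "{..<N} - {z, i0} = A \<union> (G - {i0}) \<union> (Z - {z})"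
        unfolding AGZ(1) using z i0 AGZ(5,6) by auto
      have vals: "bern_exp ({..<N} - {z, i0}) u (\<lambda>I. h (card I))
        = (\<Sum>k\<le>card (G - {i0}). binom_prob (card (G - {i0})) q k * h (card A + k))" for h
        unfolding W by (rule bern_exp_card_three_values)
          (use AGZ(2-6) uG in \<open>auto simp: A_def Z_def\<close>)
      have cG: "card (G - {i0}) = n - 1" using i0 AGZ(3) by (simp add: n_def)
      have "D z i0 = (\<Sum>k\<le>n - 1. binom_prob (n - 1) q k * of_bool (card A + k + 2 = S))
        - (\<Sum>k\<le>n - 1. binom_prob (n - 1) q k * of_bool (card A + k + 1 = S))"
        unfolding D_def using vals[of "\<lambda>k. of_bool (k + 2 = S)"] vals[of "\<lambda>k. of_bool (k + 1 = S)"] cG by simp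
      moreover have mn: "m < n"
      proof -
        have "real m < real n" using nqm q n by (metis mult.right_neutral mult_less_cancel_left_pos of_nat_0_less_iff)
        then show ?thesis by simp
      qed
      have single: "(\<Sum>k\<le>n - 1. binom_prob (n - 1) q k * of_bool (card A + k + c = S))
        = (if c \<le> m then binom_prob (n - 1) q (m - c) else 0)" for c
      proof -
        have "(\<Sum>k\<le>n - 1. binom_prob (n - 1) q k * of_bool (card A + k + c = S))
          = (\<Sum>k\<in>(if c \<le> m then {m - c} else {}). binom_prob (n - 1) q k)"
          using mn Sm by (intro sum.mono_neutral_cong_right) (auto split: if_splits)
        then show ?thesis by simp
      qed
      have "(\<Sum>k\<le>n - 1. binom_prob (n - 1) q k * of_bool (card A + k + 2 = S))
        \<le> (\<Sum>k\<le>n - 1. binom_prob (n - 1) q k * of_bool (card A + k + 1 = S))"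
      proof (cases "2 \<le> m")
        case True
        have "binom_prob (n - 1) q (Suc (m - 2)) * (real (Suc (m - 2)) * (1 - q))
          = binom_prob (n - 1) q (m - 2) * (real (n - 1 - (m - 2)) * q)"
          using True mn by (intro binom_prob_Suc) auto
        moreover have "real (Suc (m - 2)) * (1 - q) \<le> real (n - 1 - (m - 2)) * q"
        proof -
          have "real (Suc (m - 2)) = real m - 1" "real (n - 1 - (m - 2)) = real n - real m + 1"
            using True mn by (auto simp: of_nat_diff)
          then show ?thesis using nqm by (simp add: algebra_simps)
        qed
        ultimately have "binom_prob (n - 1) q (m - 2) * (real (Suc (m - 2)) * (1 - q))
          \<le> binom_prob (n - 1) q (Suc (m - 2)) * (real (Suc (m - 2)) * (1 - q))"
          using binom_prob_nonneg[of q "n - 1" "m - 2"] q by (simp only: mult_left_mono less_imp_le)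
        then have "binom_prob (n - 1) q (m - 2) \<le> binom_prob (n - 1) q (Suc (m - 2))"
          using q by (simp add: mult_le_cancel_right)
        moreover have "Suc (m - 2) = m - 1" using True by simp
        ultimately show ?thesis unfolding single using True by simp
      next
        case False
        then show ?thesis unfolding single using binom_prob_nonneg[of q "n - 1"] q by auto
      qed
      ultimately have "D z i0 \<le> 0" by simp
      moreover have "0 < D z i0" using z i0 by (intro D_pos) (auto simp: Z_def G_def)
      ultimately show False by simp
    qed
    then have fin: "f u = (\<Sum>k\<le>n. binom_prob n q k * of_bool (S \<le> card A + k))"
      unfolding f_def AGZ(1) n_def using AGZ(2-6) uG
      by (intro bern_exp_card_three_values) (auto simp: A_def)
    have "N = card A + n"
    proof -
      have "N = card (A \<union> G)"
        using AGZ(1) \<open>Z = {}\<close> by (metis card_lessThan sup_bot.right_neutral)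
      then show ?thesis using AGZ(2-5) by (simp add: card_Un_disjoint n_def)
    qed
    then have "2 * m \<le> n" using Sm by (simp add: N_def)
    from binom_prob_median[OF Sm(2) this nqm] show ?thesis unfolding fin Sm(1) by simp
  qed
  then show ?thesis using fu[OF p0X] fp0 by simp
qed

section \<open>Decoupling\<close>

definition bilin :: "('a \<Rightarrow> 'b \<Rightarrow> real) \<Rightarrow> 'a set \<Rightarrow> 'b set \<Rightarrow> ('a \<Rightarrow> real) \<Rightarrow> ('b \<Rightarrow> real) \<Rightarrow> real" where
  "bilin H I J u v = (\<Sum>i\<in>I. \<Sum>j\<in>J. u i * H i j * v j)"

text \<open>
  For \<open>r > 0\<close> this says that the \<open>I \<times> J\<close> block of \<open>H\<close> has spectral norm at least \<open>r\<close>, by vectors that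
  attain it.
\<close>
definition norm_ge :: "('a \<Rightarrow> 'b \<Rightarrow> real) \<Rightarrow> 'a set \<Rightarrow> 'b set \<Rightarrow> real \<Rightarrow> bool" where
  "norm_ge H I J r \<longleftrightarrow>
    (\<exists>u v. (\<Sum>i\<in>I. (u i)\<^sup>2) \<le> 1 \<and> (\<Sum>j\<in>J. (v j)\<^sup>2) \<le> 1 \<and> r \<le> bilin H I J u v)"

lemma norm_geI:
  "(\<Sum>i\<in>I. (u i)\<^sup>2) \<le> 1 \<Longrightarrow> (\<Sum>j\<in>J. (v j)\<^sup>2) \<le> 1 \<Longrightarrow> r \<le> bilin H I J u v \<Longrightarrow> norm_ge H I J r"
  unfolding norm_ge_def by blast

lemma norm_ge_cong:
  assumes "\<And>i j. i \<in> I \<Longrightarrow> j \<in> J \<Longrightarrow> G i j = H i j"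
  shows "norm_ge G I J r \<longleftrightarrow> norm_ge H I J r"
proof -
  have "bilin G I J u v = bilin H I J u v" for u v
    unfolding bilin_def using assms by (intro sum.cong) auto
  then show ?thesis unfolding norm_ge_def by simp
qed

lemma bilin_transpose: "bilin H I J u v = bilin (\<lambda>j i. H i j) J I v u"
  unfolding bilin_def by (subst sum.swap) (simp add: mult_ac)

lemma norm_ge_transpose: "norm_ge H I J r \<Longrightarrow> norm_ge (\<lambda>j i. H i j) J I r"
  unfolding norm_ge_def bilin_transpose[of H] by blast

text \<open>The witness vectors are extended by zero. This makes the event increasing in the
  support, as the comparison of sizes requires.\<close>

lemma norm_ge_mono:
  assumes "norm_ge H I J r" "finite I'" "finite J'" "I \<subseteq> I'" "J \<subseteq> J'"
  shows "norm_ge H I' J' r"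
proof -
  obtain u v where uv: "(\<Sum>i\<in>I. (u i)\<^sup>2) \<le> 1" "(\<Sum>j\<in>J. (v j)\<^sup>2) \<le> 1" "r \<le> bilin H I J u v"
    using assms(1) unfolding norm_ge_def by blast
  define u' where "u' i = (if i \<in> I then u i else 0)" for i
  define v' where "v' j = (if j \<in> J then v j else 0)" for j
  have "(\<Sum>i\<in>I'. (u' i)\<^sup>2) = (\<Sum>i\<in>I. (u i)\<^sup>2)" "(\<Sum>j\<in>J'. (v' j)\<^sup>2) = (\<Sum>j\<in>J. (v j)\<^sup>2)"
    using assms by (auto simp: u'_def v'_def intro!: sum.mono_neutral_cong_right)
  moreover have "bilin H I' J' u' v' = bilin H I J u v"
  proof -
    have "finite I" "finite J" using assms finite_subset by auto
    have "(\<Sum>j\<in>J'. u' i * H i j * v' j) = (\<Sum>j\<in>J. u' i * H i j * v j)" for i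
      using assms by (intro sum.mono_neutral_cong_right) (auto simp: v'_def)
    then have "bilin H I' J' u' v' = (\<Sum>i\<in>I'. \<Sum>j\<in>J. u' i * H i j * v j)"
      by (simp add: bilin_def)
    also have "\<dots> = bilin H I J u v"
      unfolding bilin_def using assms \<open>finite J\<close>
      by (intro sum.mono_neutral_cong_right) (auto simp: u'_def)
    finally show ?thesis .
  qed
  ultimately show ?thesis using uv by (intro norm_geI[of u' I' v' J']) auto
qed

lemma bilin_eq_sum: "bilin H I J u v = (\<Sum>j\<in>J. (\<Sum>i\<in>I. H i j * u i) * v j)"
  unfolding bilin_def by (subst sum.swap) (simp add: sum_distrib_left mult_ac)

text \<open>Cauchy-Schwarz eliminates \<open>v\<close> and leaves the quadratic form of the columns,
  to which the Chernoff bound applies.\<close>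

lemma norm_ge_imp_sum_squares:
  assumes "norm_ge H I J r" "0 \<le> r"
  shows "\<exists>u. (\<Sum>i\<in>I. (u i)\<^sup>2) \<le> 1 \<and> r\<^sup>2 \<le> (\<Sum>j\<in>J. (\<Sum>i\<in>I. H i j * u i)\<^sup>2)"
proof -
  obtain u v where uv: "(\<Sum>i\<in>I. (u i)\<^sup>2) \<le> 1" "(\<Sum>j\<in>J. (v j)\<^sup>2) \<le> 1" "r \<le> bilin H I J u v"
    using assms(1) unfolding norm_ge_def by blast
  have "r\<^sup>2 \<le> (bilin H I J u v)\<^sup>2" using uv assms(2) by (intro power_mono)
  also have "\<dots> \<le> (\<Sum>j\<in>J. (\<Sum>i\<in>I. H i j * u i)\<^sup>2) * (\<Sum>j\<in>J. (v j)\<^sup>2)"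
    unfolding bilin_eq_sum by (rule Cauchy_Schwarz_ineq_sum)
  also have "\<dots> \<le> (\<Sum>j\<in>J. (\<Sum>i\<in>I. H i j * u i)\<^sup>2) * 1"
    using uv(2) by (intro mult_left_mono sum_nonneg) auto
  finally show ?thesis using uv(1) by auto
qed

text \<open>The optimal \<open>v\<close> is the normalised image of \<open>u\<close> under the
  transposed block.\<close>

lemma sum_squares_imp_norm_ge:
  assumes "(\<Sum>i\<in>I. (u i)\<^sup>2) \<le> 1" "0 < t" "t \<le> (\<Sum>j\<in>J. (\<Sum>i\<in>I. H i j * u i)\<^sup>2)"
  shows "norm_ge H I J (sqrt t)"
proof -
  define c where "c j = (\<Sum>i\<in>I. H i j * u i)" for j
  define s where "s = sqrt (\<Sum>j\<in>J. (c j)\<^sup>2)"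
  have s2: "s\<^sup>2 = (\<Sum>j\<in>J. (c j)\<^sup>2)" by (simp add: s_def sum_nonneg)
  have s: "sqrt t \<le> s" "0 < s" using assms unfolding s_def c_def
    by (auto intro: real_sqrt_le_mono less_le_trans)
  have "(\<Sum>j\<in>J. (c j / s)\<^sup>2) = 1"
    using s(2) by (simp add: power_divide sum_divide_distrib[symmetric] s2[symmetric])
  moreover have "bilin H I J u (\<lambda>j. c j / s) = s"
  proof -
    have "bilin H I J u (\<lambda>j. c j / s) = (\<Sum>j\<in>J. (c j)\<^sup>2) / s"
      by (simp add: bilin_eq_sum c_def[symmetric] power2_eq_square sum_divide_distrib)
    also have "\<dots> = s\<^sup>2 / s" unfolding s2 ..
    finally show ?thesis using s(2) by (simp add: power2_eq_square)
  qed
  ultimately show ?thesis using assms(1) s(1) by (intro norm_geI[of u I "\<lambda>j. c j / s" J]) auto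
qed

text \<open>
  Given the row set \<open>I\<close>, the Chernoff bound is applied to the random columns. It needs that the block
  of \<open>H W\<close> with rows \<open>I\<close> has small norm (failure \<open>E2\<close>) and that the columns are short on \<open>I\<close>
  (failure \<open>E3\<close>). Both failures are again controlled by the Chernoff bound, now for the random rows.
\<close>
lemma off_diagonal_block_tail:
  fixes H :: "'a \<Rightarrow> 'a \<Rightarrow> real"
  assumes fin: "finite A" "finite B" and p: "\<And>i. i \<in> A \<union> B \<Longrightarrow> p i \<in> {0..1}"
    and r: "0 < r" and m: "0 < m"
    and op: "\<And>t. norm_ge (\<lambda>i j. sqrt (p i) * H i j * sqrt (p j)) A B t \<Longrightarrow> 2 * exp 1 ^ 2 * t \<le> r"
    and row: "\<And>i. i \<in> A \<Longrightarrow> m * (4 * exp 1 ^ 2 * (\<Sum>j\<in>B. (H i j)\<^sup>2 * p j)) \<le> r\<^sup>2"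
    and col: "\<And>j. j \<in> B \<Longrightarrow> m * (4 * exp 1 ^ 2 * (\<Sum>i\<in>A. p i * (H i j)\<^sup>2)) \<le> r\<^sup>2"
    and ent: "\<And>i j. i \<in> A \<Longrightarrow> j \<in> B \<Longrightarrow> m * (2 * \<bar>H i j\<bar>) \<le> r"
  shows "bern_exp A p (\<lambda>I. bern_exp B p (\<lambda>J. of_bool (norm_ge H I J (r / 2))))
    \<le> (real (card A) + 2 * real (card B)) * exp (- m)"
proof -
  define e2 where "e2 = (exp 1 :: real) ^ 2"
  have e2: "0 < e2" by (simp add: e2_def)
  \<comment> \<open>The squared column length for which the Chernoff exponent (r / 2)^2 / s2 equals
    \<open>m\<close>.\<close>
  define s2 where "s2 = r\<^sup>2 / (4 * m)"
  \<comment> \<open>The largest mean that the Chernoff bound tolerates at level (r / 2)^2.\<close>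
  define t1 where "t1 = r\<^sup>2 / (4 * e2)"
  have pos: "0 < s2" "0 < t1" using r m e2 by (auto simp: s2_def t1_def)
  have pA: "\<And>i. i \<in> A \<Longrightarrow> p i \<in> {0..1}" and pB: "\<And>i. i \<in> B \<Longrightarrow> p i \<in> {0..1}" using p by auto
  define z where "z i j = H i j * sqrt (p j)" for i j
  define E2 where "E2 I = (\<exists>w. (\<Sum>j\<in>B. (w j)\<^sup>2) \<le> 1 \<and> t1 \<le> (\<Sum>i\<in>I. (\<Sum>j\<in>B. z i j * w j)\<^sup>2))" for I
  define E3 where "E3 j I = (s2 \<le> (\<Sum>i\<in>I. (H i j)\<^sup>2))" for I j

  have stage1: "bern_exp B p (\<lambda>J. of_bool (norm_ge H I J (r / 2)))
    \<le> of_bool (E2 I) + (\<Sum>j\<in>B. of_bool (E3 j I)) + real (card A) * exp (- m)" if I: "I \<subseteq> A" for I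
  proof (cases "E2 I \<or> (\<exists>j\<in>B. E3 j I)")
    case True
    have "bern_exp B p (\<lambda>J. of_bool (norm_ge H I J (r / 2))) \<le> bern_exp B p (\<lambda>J. 1)"
      by (rule bern_exp_mono[OF pB]) auto
    also have "\<dots> \<le> of_bool (E2 I) + (\<Sum>j\<in>B. of_bool (E3 j I))"
    proof (cases "E2 I")
      case False
      then obtain j where j: "j \<in> B" "E3 j I" using True by auto
      have "(\<Sum>j\<in>{j}. of_bool (E3 j I) :: real) \<le> (\<Sum>j\<in>B. of_bool (E3 j I))"
        using j fin by (intro sum_mono2) auto
      then show ?thesis using j fin False by simp
    qed (use fin in \<open>simp add: sum_nonneg\<close>)
    also have "\<dots> \<le> \<dots> + real (card A) * exp (- m)" by simp
    finally show ?thesis .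
  next
    case False
    have finI: "finite I" using I fin finite_subset by auto
    have "bern_exp B p (\<lambda>J. of_bool (norm_ge H I J (r / 2)))
      \<le> bern_exp B p (\<lambda>J. of_bool (\<exists>x. (\<Sum>i\<in>I. (x i)\<^sup>2) \<le> 1
          \<and> r\<^sup>2 / 4 \<le> (\<Sum>j\<in>J. (\<Sum>i\<in>I. H i j * x i)\<^sup>2)))"
      using norm_ge_imp_sum_squares[of H I _ "r / 2"] r
      by (intro bern_exp_mono pB) (auto simp: power_divide)
    also have "\<dots> \<le> card I * exp (- (r\<^sup>2 / 4) / s2)"
    proof (rule matrix_chernoff[OF fin(2) finI pB _ pos(1)])
      show "(\<Sum>i\<in>I. (H i j)\<^sup>2) \<le> s2" if "j \<in> B" for j using False that by (auto simp: E3_def)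
      show "0 < r\<^sup>2 / 4" using r by simp
      fix x :: "'a \<Rightarrow> real" assume x: "(\<Sum>i\<in>I. (x i)\<^sup>2) \<le> 1"
      show "exp 1 ^ 2 * (\<Sum>j\<in>B. p j * (\<Sum>i\<in>I. H i j * x i)\<^sup>2) \<le> r\<^sup>2 / 4"
      proof (rule ccontr)
        assume "\<not> ?thesis"
        then have *: "t1 \<le> (\<Sum>j\<in>B. p j * (\<Sum>i\<in>I. H i j * x i)\<^sup>2)"
          using e2 by (simp add: t1_def e2_def divide_le_eq field_simps)
        have "(\<Sum>j\<in>B. p j * (\<Sum>i\<in>I. H i j * x i)\<^sup>2) = (\<Sum>j\<in>B. (\<Sum>i\<in>I. z i j * x i)\<^sup>2)"
        proof (rule sum.cong[OF refl])
          fix j assume "j \<in> B"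
          have "(\<Sum>i\<in>I. z i j * x i) = sqrt (p j) * (\<Sum>i\<in>I. H i j * x i)"
            by (simp add: z_def sum_distrib_left mult_ac)
          then show "p j * (\<Sum>i\<in>I. H i j * x i)\<^sup>2 = (\<Sum>i\<in>I. z i j * x i)\<^sup>2"
            using pB[OF \<open>j \<in> B\<close>] by (simp add: power_mult_distrib)
        qed
        then have ge: "norm_ge z I B (sqrt t1)"
          using sum_squares_imp_norm_ge[OF x pos(2), of z B] * by simp
        then have "E2 I"
          using norm_ge_imp_sum_squares[OF norm_ge_transpose[OF ge]] pos(2)
          unfolding E2_def by simp
        then show False using False by simp
      qed
    qed
    also have "\<dots> = card I * exp (- m)" using r m by (simp add: s2_def)
    also have "\<dots> \<le> real (card A) * exp (- m)"
      using I fin by (intro mult_right_mono) (auto simp: card_mono)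
    finally show ?thesis using False by simp
  qed

  \<comment> \<open>The row bound makes the exponent \<open>m\<close>. The mean condition is that
    the squared norm of the weighted block is at most t1 / e^2 = (r / (2 e^2))^2, which is what
    \<open>op\<close> provides.\<close>
  have stage2: "bern_exp A p (\<lambda>I. of_bool (E2 I)) \<le> real (card B) * exp (- m)"
  proof -
    have "bern_exp A p (\<lambda>I. of_bool (E2 I)) \<le> card B * exp (- t1 / (t1 / m))"
      unfolding E2_def
    proof (rule matrix_chernoff[OF fin pA _ _ pos(2)])
      show "0 < t1 / m" using pos m by simp
      show "(\<Sum>j\<in>B. (z i j)\<^sup>2) \<le> t1 / m" if "i \<in> A" for i
      proof -
        have "(\<Sum>j\<in>B. (z i j)\<^sup>2) = (\<Sum>j\<in>B. (H i j)\<^sup>2 * p j)"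
          using pB by (intro sum.cong) (auto simp: z_def power_mult_distrib)
        then show ?thesis using row[OF that] e2 m
          by (simp add: t1_def e2_def[symmetric] le_divide_eq mult_ac)
      qed
      fix w :: "'a \<Rightarrow> real" assume w: "(\<Sum>j\<in>B. (w j)\<^sup>2) \<le> 1"
      show "exp 1 ^ 2 * (\<Sum>i\<in>A. p i * (\<Sum>j\<in>B. z i j * w j)\<^sup>2) \<le> t1"
      proof (rule ccontr)
        assume less: "\<not> ?thesis"
        define G where "G = (\<lambda>i j. sqrt (p i) * H i j * sqrt (p j))"
        define q where "q = (\<Sum>i\<in>A. p i * (\<Sum>j\<in>B. z i j * w j)\<^sup>2)"
        have q: "t1 / e2 < q" using less e2
          unfolding q_def[symmetric] e2_def[symmetric] by (simp add: divide_less_eq mult.commute)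
        then have q0: "0 < q" using pos(2) e2 by (meson divide_pos_pos less_trans)
        have "q = (\<Sum>i\<in>A. (\<Sum>j\<in>B. G i j * w j)\<^sup>2)"
          unfolding q_def
        proof (rule sum.cong[OF refl])
          fix i assume "i \<in> A"
          have "(\<Sum>j\<in>B. G i j * w j) = sqrt (p i) * (\<Sum>j\<in>B. z i j * w j)"
            by (simp add: G_def z_def sum_distrib_left mult_ac)
          then show "p i * (\<Sum>j\<in>B. z i j * w j)\<^sup>2 = (\<Sum>j\<in>B. G i j * w j)\<^sup>2"
            using pA[OF \<open>i \<in> A\<close>] by (simp add: power_mult_distrib)
        qed
        then have "norm_ge (\<lambda>j i. G i j) B A (sqrt q)"
          by (intro sum_squares_imp_norm_ge[OF w q0]) simp
        then have "norm_ge G A B (sqrt q)"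
          using norm_ge_transpose[of "\<lambda>j i. G i j" B A "sqrt q"] by simp
        then have "2 * e2 * sqrt q \<le> r" unfolding e2_def G_def by (rule op)
        then have "(2 * e2 * sqrt q)\<^sup>2 \<le> r\<^sup>2" using e2 q0 by (intro power_mono) auto
        moreover have "(2 * e2 * sqrt q)\<^sup>2 = 4 * e2 * e2 * q"
          using q0 by (simp add: power_mult_distrib power2_eq_square[of e2])
        ultimately have "4 * e2 * e2 * q \<le> r\<^sup>2" by simp
        then show False using q e2 by (simp add: t1_def divide_less_eq mult_ac)
      qed
    qed
    then show ?thesis using pos m by simp
  qed

  \<comment> \<open>The Chernoff bound in dimension one, with \<open>j\<close> as the only
    coordinate: the column bound controls the mean, and the entry bound makes the exponent
    \<open>m\<close>.\<close>
  have stage3: "bern_exp A p (\<lambda>I. of_bool (E3 j I)) \<le> exp (- m)" if j: "j \<in> B" for j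
  proof -
    have "bern_exp A p (\<lambda>I. of_bool (E3 j I))
      \<le> bern_exp A p (\<lambda>I. of_bool (\<exists>x. (\<Sum>k\<in>{j}. (x k)\<^sup>2) \<le> 1 \<and> s2 \<le> (\<Sum>i\<in>I. (\<Sum>k\<in>{j}. H i k * x k)\<^sup>2)))"
    proof (rule bern_exp_mono[OF pA])
      fix I
      have "\<exists>x :: 'a \<Rightarrow> real. (\<Sum>k\<in>{j}. (x k)\<^sup>2) \<le> 1 \<and> s2 \<le> (\<Sum>i\<in>I. (\<Sum>k\<in>{j}. H i k * x k)\<^sup>2)" if "E3 j I"
        using that by (intro exI[of _ "\<lambda>_. 1"]) (simp add: E3_def)
      then show "(of_bool (E3 j I) :: real) \<le> of_bool (\<exists>x. (\<Sum>k\<in>{j}. (x k)\<^sup>2) \<le> 1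
          \<and> s2 \<le> (\<Sum>i\<in>I. (\<Sum>k\<in>{j}. H i k * x k)\<^sup>2))" by auto
    qed
    also have "\<dots> \<le> card {j} * exp (- s2 / (s2 / m))"
    proof (rule matrix_chernoff[OF fin(1) _ pA _ _ pos(1)])
      show "0 < s2 / m" using pos m by simp
      show "(\<Sum>k\<in>{j}. (H i k)\<^sup>2) \<le> s2 / m" if "i \<in> A" for i
      proof -
        have "(m * (2 * \<bar>H i j\<bar>))\<^sup>2 \<le> r\<^sup>2" using ent[OF that j] m by (intro power_mono) auto
        then show ?thesis using m by (simp add: s2_def le_divide_eq power2_eq_square mult_ac)
      qed
      fix x :: "'a \<Rightarrow> real" assume "(\<Sum>k\<in>{j}. (x k)\<^sup>2) \<le> 1"
      then have x: "(x j)\<^sup>2 \<le> 1" by simp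
      have "(\<Sum>i\<in>A. p i * (\<Sum>k\<in>{j}. H i k * x k)\<^sup>2) = (\<Sum>i\<in>A. p i * (H i j)\<^sup>2) * (x j)\<^sup>2"
        by (simp add: sum_distrib_left power_mult_distrib mult_ac)
      also have "\<dots> \<le> (\<Sum>i\<in>A. p i * (H i j)\<^sup>2) * 1"
        using x pA by (intro mult_left_mono sum_nonneg) auto
      finally have "e2 * (\<Sum>i\<in>A. p i * (\<Sum>k\<in>{j}. H i k * x k)\<^sup>2) \<le> e2 * (\<Sum>i\<in>A. p i * (H i j)\<^sup>2)"
        using e2 by (simp add: mult_left_mono)
      also have "\<dots> \<le> s2" using col[OF j] m by (simp add: s2_def e2_def le_divide_eq mult_ac)
      finally show "exp 1 ^ 2 * (\<Sum>i\<in>A. p i * (\<Sum>k\<in>{j}. H i k * x k)\<^sup>2) \<le> s2"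
        by (simp add: e2_def)
    qed simp
    finally show ?thesis using pos m by simp
  qed

  have "bern_exp A p (\<lambda>I. bern_exp B p (\<lambda>J. of_bool (norm_ge H I J (r / 2))))
    \<le> bern_exp A p (\<lambda>I. of_bool (E2 I) + (\<Sum>j\<in>B. of_bool (E3 j I)) + real (card A) * exp (- m))"
    by (rule bern_exp_mono[OF pA stage1])
  also have "\<dots> = bern_exp A p (\<lambda>I. of_bool (E2 I)) + (\<Sum>j\<in>B. bern_exp A p (\<lambda>I. of_bool (E3 j I)))
      + real (card A) * exp (- m)"
    using fin by (simp only: bern_exp_add bern_exp_sum bern_exp_const)
  also have "\<dots> \<le> real (card B) * exp (- m) + (\<Sum>j\<in>B. exp (- m)) + real (card A) * exp (- m)"
    by (intro add_mono stage2 sum_mono stage3) auto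
  also have "\<dots> = (real (card A) + 2 * real (card B)) * exp (- m)" by (simp add: algebra_simps)
  finally show ?thesis .
qed

text \<open>By homogeneity the bound passes from unit vectors to all vectors. It is strict except
  where both sides vanish, and this strictness is what later contradicts a nonstrict lower
  bound.\<close>

lemma not_norm_ge_imp:
  fixes u :: "'a \<Rightarrow> real" and v :: "'b \<Rightarrow> real"
  assumes fin: "finite I" "finite J" and nb: "\<not> norm_ge H I J \<rho>"
  defines "a \<equiv> sqrt (\<Sum>i\<in>I. (u i)\<^sup>2)" and "b \<equiv> sqrt (\<Sum>j\<in>J. (v j)\<^sup>2)"
  shows "bilin H I J u v < \<rho> * (a * b) \<or> bilin H I J u v = 0 \<and> a * b = 0"
proof (cases "a * b = 0")
  case True
  then have "(\<forall>i\<in>I. u i = 0) \<or> (\<forall>j\<in>J. v j = 0)"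
    using fin by (auto simp: a_def b_def sum_nonneg_eq_0_iff)
  then have "bilin H I J u v = 0" by (auto simp: bilin_def)
  then show ?thesis using True by simp
next
  case False
  then have ab: "0 < a" "0 < b" by (auto simp: a_def b_def sum_nonneg order_less_le)
  have sq: "a\<^sup>2 = (\<Sum>i\<in>I. (u i)\<^sup>2)" "b\<^sup>2 = (\<Sum>j\<in>J. (v j)\<^sup>2)" by (simp_all add: a_def b_def sum_nonneg)
  have "(\<Sum>i\<in>I. (u i / a)\<^sup>2) = 1" "(\<Sum>j\<in>J. (v j / b)\<^sup>2) = 1"
    using ab by (simp_all add: power_divide sum_divide_distrib[symmetric] sq[symmetric])
  then have "bilin H I J (\<lambda>i. u i / a) (\<lambda>j. v j / b) < \<rho>"
    using nb norm_geI[of "\<lambda>i. u i / a" I "\<lambda>j. v j / b" J \<rho> H] by force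
  moreover have "bilin H I J (\<lambda>i. u i / a) (\<lambda>j. v j / b) = bilin H I J u v / (a * b)"
    by (simp add: bilin_def sum_divide_distrib)
  ultimately show ?thesis using ab by (simp add: divide_less_eq)
qed

text \<open>The two blocks act on orthogonal parts of \<open>u\<close> and \<open>v\<close>, so the
  norm of their sum is the maximum of their norms: a b + c d \<le> 1. Hence one of the blocks
  carries the full \<open>r\<close>.\<close>

lemma norm_ge_block:
  assumes fin: "finite I" and r: "0 < r"
    and u: "(\<Sum>i\<in>I. (u i)\<^sup>2) \<le> 1" and v: "(\<Sum>i\<in>I. (v i)\<^sup>2) \<le> 1"
    and ge: "r \<le> bilin H (I \<inter> A) (I - A) u v + bilin H (I - A) (I \<inter> A) u v"
  shows "norm_ge H (I \<inter> A) (I - A) r \<or> norm_ge H (I - A) (I \<inter> A) r"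
proof (rule ccontr)
  assume no: "\<not> ?thesis"
  define a where "a = sqrt (\<Sum>i\<in>I \<inter> A. (u i)\<^sup>2)"
  define b where "b = sqrt (\<Sum>i\<in>I - A. (v i)\<^sup>2)"
  define c where "c = sqrt (\<Sum>i\<in>I - A. (u i)\<^sup>2)"
  define d where "d = sqrt (\<Sum>i\<in>I \<inter> A. (v i)\<^sup>2)"
  have nn: "0 \<le> a" "0 \<le> b" "0 \<le> c" "0 \<le> d" by (simp_all add: a_def b_def c_def d_def sum_nonneg)
  have "a\<^sup>2 + c\<^sup>2 \<le> 1" "b\<^sup>2 + d\<^sup>2 \<le> 1"
    using u v sum.Int_Diff[OF fin, of "\<lambda>i. (u i)\<^sup>2" A] sum.Int_Diff[OF fin, of "\<lambda>i. (v i)\<^sup>2" A]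
    by (simp_all add: a_def b_def c_def d_def sum_nonneg)
  moreover have "2 * (a * b) \<le> a\<^sup>2 + b\<^sup>2" "2 * (c * d) \<le> c\<^sup>2 + d\<^sup>2"
    using sum_squares_bound[of a b] sum_squares_bound[of c d] by simp_all
  ultimately have le1: "a * b + c * d \<le> 1" by linarith
  have 1: "bilin H (I \<inter> A) (I - A) u v < r * (a * b) \<or> bilin H (I \<inter> A) (I - A) u v = 0 \<and> a * b = 0"
    unfolding a_def b_def using no fin by (intro not_norm_ge_imp) auto
  have 2: "bilin H (I - A) (I \<inter> A) u v < r * (c * d) \<or> bilin H (I - A) (I \<inter> A) u v = 0 \<and> c * d = 0"
    unfolding c_def d_def using no fin by (intro not_norm_ge_imp) auto
  have "r * (a * b) + r * (c * d) \<le> r"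
    using mult_left_mono[OF le1, of r] r by (simp add: distrib_left)
  moreover have "bilin H (I \<inter> A) (I - A) u v \<le> r * (a * b)" "bilin H (I - A) (I \<inter> A) u v \<le> r * (c * d)"
    using 1 2 by auto
  ultimately show False using 1 2 ge r by (elim disjE conjE) linarith+
qed

text \<open>With s_i the sign for membership in \<open>A\<close>, the off-diagonal blocks carry half
  of the bilinear form minus half of the sum of s_i s_j u_i H_ij v_j. This is why \<open>c\<close>
  has a minus sign: a nonnegative chaos means that the two blocks carry at least half of the form.
  The zero diagonal accounts for the pairs i = j that a chaos excludes.\<close>

lemma decoupling_prob:
  fixes H :: "'a \<Rightarrow> 'a \<Rightarrow> real"
  assumes V: "finite V" "I \<subseteq> V" and diag: "\<And>i. i \<in> I \<Longrightarrow> H i i = 0"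
    and r: "0 < r" and big: "norm_ge H I I r"
  shows "1 / 36 \<le> rad_exp V (\<lambda>A. of_bool (norm_ge H (I \<inter> A) (I - A) (r / 2) \<or> norm_ge H (I - A) (I \<inter> A) (r / 2)))"
proof -
  have fin: "finite I" using V finite_subset by auto
  obtain u v where uv: "(\<Sum>i\<in>I. (u i)\<^sup>2) \<le> 1" "(\<Sum>j\<in>I. (v j)\<^sup>2) \<le> 1" "r \<le> bilin H I I u v"
    using big unfolding norm_ge_def by blast
  define c where "c i j = (if i \<in> I \<and> j \<in> I then - (u i * H i j * v j) else 0)" for i j
  have quad: "rad_quad V c A = 2 * (bilin H (I \<inter> A) (I - A) u v + bilin H (I - A) (I \<inter> A) u v) - bilin H I I u v"
    for A
  proof -
    have split: "(\<Sum>i\<in>I. \<Sum>j\<in>I. f i j) = (\<Sum>i\<in>I \<inter> A. \<Sum>j\<in>I \<inter> A. f i j)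
      + (\<Sum>i\<in>I \<inter> A. \<Sum>j\<in>I - A. f i j) + (\<Sum>i\<in>I - A. \<Sum>j\<in>I \<inter> A. f i j)
      + (\<Sum>i\<in>I - A. \<Sum>j\<in>I - A. f i j)" for f :: "'a \<Rightarrow> 'a \<Rightarrow> real"
      by (simp only: sum.Int_Diff[OF fin, of _ A] sum.distrib add.assoc)
    have sgn: "(\<Sum>i\<in>P. \<Sum>j\<in>Q. u i * H i j * v j * (sgn_in A i * sgn_in A j)) = a * b * bilin H P Q u v"
      if "\<forall>i\<in>P. sgn_in A i = a" "\<forall>j\<in>Q. sgn_in A j = b" for P Q a b
      unfolding bilin_def sum_distrib_left using that by (intro sum.cong refl) simp
    have inner: "(\<Sum>j\<in>V - {i}. c i j * sgn_in A i * sgn_in A j)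
      = (\<Sum>j\<in>I. c i j * sgn_in A i * sgn_in A j)" for i
      using V fin diag by (intro sum.mono_neutral_cong) (auto simp: c_def)
    have "rad_quad V c A = (\<Sum>i\<in>I. \<Sum>j\<in>I. c i j * sgn_in A i * sgn_in A j)"
      unfolding rad_quad_def inner using V fin by (intro sum.mono_neutral_cong_right) (auto simp: c_def)
    also have "\<dots> = - (\<Sum>i\<in>I. \<Sum>j\<in>I. u i * H i j * v j * (sgn_in A i * sgn_in A j))"
      unfolding sum_negf[symmetric] by (intro sum.cong) (auto simp: c_def)
    also have "\<dots> = - (bilin H (I \<inter> A) (I \<inter> A) u v - bilin H (I \<inter> A) (I - A) u v
        - bilin H (I - A) (I \<inter> A) u v + bilin H (I - A) (I - A) u v)"
      unfolding split using sgn[of "I \<inter> A" 1 "I \<inter> A" 1] sgn[of "I \<inter> A" 1 "I - A" "- 1"]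
        sgn[of "I - A" "- 1" "I \<inter> A" 1] sgn[of "I - A" "- 1" "I - A" "- 1"]
      by (simp add: sgn_in_def)
    finally show ?thesis using split[of "\<lambda>i j. u i * H i j * v j"] unfolding bilin_def by simp
  qed
  have "1 / 36 \<le> rad_exp V (\<lambda>A. of_bool (0 \<le> rad_quad V c A))"
    by (rule rad_quad_nonneg_prob[OF V(1)])
  also have "\<dots> \<le> rad_exp V (\<lambda>A. of_bool (norm_ge H (I \<inter> A) (I - A) (r / 2) \<or> norm_ge H (I - A) (I \<inter> A) (r / 2)))"
  proof (rule bern_exp_mono)
    fix A
    have "norm_ge H (I \<inter> A) (I - A) (r / 2) \<or> norm_ge H (I - A) (I \<inter> A) (r / 2)" if "0 \<le> rad_quad V c A"
      using that uv r unfolding quad by (intro norm_ge_block[OF fin _ uv(1,2)]) auto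
    then show "(of_bool (0 \<le> rad_quad V c A) :: real)
      \<le> of_bool (norm_ge H (I \<inter> A) (I - A) (r / 2) \<or> norm_ge H (I - A) (I \<inter> A) (r / 2))" by auto
  qed auto
  finally show ?thesis .
qed

text \<open>For a fixed partition the two parts of the support are independent, which is the gain
  from decoupling.\<close>

lemma bern_exp_split:
  assumes "finite V" "A \<subseteq> V"
  shows "bern_exp V p (\<lambda>I. f (I \<inter> A) (I - A)) = bern_exp A p (\<lambda>I. bern_exp (V - A) p (\<lambda>J. f I J))"
proof -
  have "bern_exp V p (\<lambda>I. f (I \<inter> A) (I - A))
    = bern_exp A p (\<lambda>I. bern_exp (V - A) p (\<lambda>J. f ((I \<union> J) \<inter> A) (I \<union> J - A)))"
    using assms bern_exp_union[of A "V - A" p "\<lambda>I. f (I \<inter> A) (I - A)"]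
    by (simp add: Un_absorb1 finite_subset)
  also have "\<dots> = bern_exp A p (\<lambda>I. bern_exp (V - A) p (\<lambda>J. f I J))"
  proof (intro bern_exp_cong refl)
    fix I J assume "I \<subseteq> A" "J \<subseteq> V - A"
    then have "(I \<union> J) \<inter> A = I" "I \<union> J - A = J" by auto
    then show "f ((I \<union> J) \<inter> A) (I \<union> J - A) = f I J" by simp
  qed
  finally show ?thesis .
qed

text \<open>The averages over the support and over the partition are exchanged, so that the block
  bound applies to each fixed partition. Its asymmetric factor and the mirror image add up to 3 card
  V whatever the partition.\<close>

lemma poisson_tail:
  fixes H :: "'a \<Rightarrow> 'a \<Rightarrow> real"
  assumes V: "finite V" and p: "\<And>i. i \<in> V \<Longrightarrow> p i \<in> {0..1}" and diag: "\<And>i. i \<in> V \<Longrightarrow> H i i = 0"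
    and r: "0 < r" and m: "0 < m"
    and op: "\<And>t. norm_ge (\<lambda>i j. sqrt (p i) * H i j * sqrt (p j)) V V t \<Longrightarrow> 2 * exp 1 ^ 2 * t \<le> r"
    and row: "\<And>i. i \<in> V \<Longrightarrow> m * (4 * exp 1 ^ 2 * (\<Sum>j\<in>V. (H i j)\<^sup>2 * p j)) \<le> r\<^sup>2"
    and col: "\<And>j. j \<in> V \<Longrightarrow> m * (4 * exp 1 ^ 2 * (\<Sum>i\<in>V. p i * (H i j)\<^sup>2)) \<le> r\<^sup>2"
    and ent: "\<And>i j. i \<in> V \<Longrightarrow> j \<in> V \<Longrightarrow> m * (2 * \<bar>H i j\<bar>) \<le> r"
  shows "bern_exp V p (\<lambda>I. of_bool (norm_ge H I I r)) \<le> 108 * real (card V) * exp (- m)"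
proof -
  let ?b1 = "\<lambda>I A. norm_ge H (I \<inter> A) (I - A) (r / 2)" and ?b2 = "\<lambda>I A. norm_ge H (I - A) (I \<inter> A) (r / 2)"
  have block: "bern_exp A p (\<lambda>I. bern_exp B p (\<lambda>J. of_bool (norm_ge H I J (r / 2))))
    \<le> (real (card A) + 2 * real (card B)) * exp (- m)" if AB: "A \<subseteq> V" "B \<subseteq> V" for A B
  proof (rule off_diagonal_block_tail[OF _ _ _ r m])
    show fin: "finite A" "finite B" using AB V finite_subset by auto
    show "p i \<in> {0..1}" if "i \<in> A \<union> B" for i using that AB by (intro p) auto
    show "2 * exp 1 ^ 2 * t \<le> r" if "norm_ge (\<lambda>i j. sqrt (p i) * H i j * sqrt (p j)) A B t" for t
      by (rule op[OF norm_ge_mono[OF that V V AB]])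
    show "m * (4 * exp 1 ^ 2 * (\<Sum>j\<in>B. (H i j)\<^sup>2 * p j)) \<le> r\<^sup>2" if "i \<in> A" for i
    proof -
      have "(\<Sum>j\<in>B. (H i j)\<^sup>2 * p j) \<le> (\<Sum>j\<in>V. (H i j)\<^sup>2 * p j)"
        using V AB p by (intro sum_mono2) auto
      then have "m * (4 * exp 1 ^ 2 * (\<Sum>j\<in>B. (H i j)\<^sup>2 * p j))
        \<le> m * (4 * exp 1 ^ 2 * (\<Sum>j\<in>V. (H i j)\<^sup>2 * p j))"
        using m by (intro mult_left_mono) auto
      also have "\<dots> \<le> r\<^sup>2" using that AB by (intro row) auto
      finally show ?thesis .
    qed
    show "m * (4 * exp 1 ^ 2 * (\<Sum>i\<in>A. p i * (H i j)\<^sup>2)) \<le> r\<^sup>2" if "j \<in> B" for j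
    proof -
      have "(\<Sum>i\<in>A. p i * (H i j)\<^sup>2) \<le> (\<Sum>i\<in>V. p i * (H i j)\<^sup>2)"
        using V AB p by (intro sum_mono2) auto
      then have "m * (4 * exp 1 ^ 2 * (\<Sum>i\<in>A. p i * (H i j)\<^sup>2))
        \<le> m * (4 * exp 1 ^ 2 * (\<Sum>i\<in>V. p i * (H i j)\<^sup>2))"
        using m by (intro mult_left_mono) auto
      also have "\<dots> \<le> r\<^sup>2" using that AB by (intro col) auto
      finally show ?thesis .
    qed
    show "m * (2 * \<bar>H i j\<bar>) \<le> r" if "i \<in> A" "j \<in> B" for i j using that AB by (intro ent) auto
  qed
  have "bern_exp V p (\<lambda>I. of_bool (norm_ge H I I r))
    \<le> bern_exp V p (\<lambda>I. 36 * rad_exp V (\<lambda>A. of_bool (?b1 I A \<or> ?b2 I A)))"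
  proof (rule bern_exp_mono[OF p])
    fix I assume I: "I \<subseteq> V"
    have "0 \<le> rad_exp V (\<lambda>A. of_bool (?b1 I A \<or> ?b2 I A))" by (rule rad_exp_nonneg) auto
    moreover have "1 / 36 \<le> rad_exp V (\<lambda>A. of_bool (?b1 I A \<or> ?b2 I A))" if "norm_ge H I I r"
      using I diag by (intro decoupling_prob[OF V I _ r that]) auto
    ultimately show "of_bool (norm_ge H I I r) \<le> 36 * rad_exp V (\<lambda>A. of_bool (?b1 I A \<or> ?b2 I A))"
      by auto
  qed
  also have "\<dots> = 36 * rad_exp V (\<lambda>A. bern_exp V p (\<lambda>I. of_bool (?b1 I A \<or> ?b2 I A)))"
    by (simp only: bern_exp_cmult bern_exp_swap[of V p V])
  also have "\<dots> \<le> 36 * rad_exp V (\<lambda>A. 3 * real (card V) * exp (- m))"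
  proof (intro mult_left_mono bern_exp_mono)
    fix A assume A: "A \<subseteq> V"
    have "bern_exp V p (\<lambda>I. of_bool (?b1 I A \<or> ?b2 I A))
      \<le> bern_exp V p (\<lambda>I. of_bool (?b1 I A) + of_bool (?b2 I A))"
      by (intro bern_exp_mono p) auto
    also have "\<dots> = bern_exp V p (\<lambda>I. of_bool (?b1 I A)) + bern_exp V p (\<lambda>I. of_bool (?b2 I A))"
      by (rule bern_exp_add)
    also have "bern_exp V p (\<lambda>I. of_bool (?b1 I A))
      = bern_exp A p (\<lambda>I. bern_exp (V - A) p (\<lambda>J. of_bool (norm_ge H I J (r / 2))))"
      by (rule bern_exp_split[OF V A])
    also have "\<dots> \<le> (real (card A) + 2 * real (card (V - A))) * exp (- m)"
      using A by (intro block) auto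
    also have "bern_exp V p (\<lambda>I. of_bool (?b2 I A))
      = bern_exp (V - A) p (\<lambda>J. bern_exp A p (\<lambda>I. of_bool (norm_ge H J I (r / 2))))"
      unfolding bern_exp_swap[of "V - A" p A]
      by (rule bern_exp_split[OF V A, where f = "\<lambda>I J. of_bool (norm_ge H J I (r / 2))"])
    also have "\<dots> \<le> (real (card (V - A)) + 2 * real (card A)) * exp (- m)"
      using A by (intro block) auto
    also have "(real (card A) + 2 * real (card (V - A))) * exp (- m)
        + (real (card (V - A)) + 2 * real (card A)) * exp (- m) = 3 * real (card V) * exp (- m)"
    proof -
      have "card V = card A + card (V - A)"
        using V A by (simp add: card_Diff_subset finite_subset card_mono)
      then show ?thesis by (simp add: algebra_simps)
    qed
    finally show "bern_exp V p (\<lambda>I. of_bool (?b1 I A \<or> ?b2 I A)) \<le> 3 * real (card V) * exp (- m)"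
      by simp
  qed auto
  also have "\<dots> = 108 * real (card V) * exp (- m)" using V by simp
  finally show ?thesis .
qed

section \<open>Rejective sampling\<close>

lemma pmf_poisson_sampling:
  assumes p: "\<And>i. i < K \<Longrightarrow> p i \<in> {0..1}" and I: "I \<subseteq> {..<K}"
  shows "pmf (poisson_sampling K p) I = bern_weight {..<K} p I"
proof -
  let ?P = "Pi_pmf {..<K} False (\<lambda>i. bernoulli_pmf (p i))"
  \<comment> \<open>The default value \<open>False\<close> outside the index range makes the
    indicator function recoverable from its set.\<close>
  have supp: "\<delta> = (\<lambda>i. i \<in> {i. i < K \<and> \<delta> i})" if "\<delta> \<in> set_pmf ?P" for \<delta>
    using set_Pi_pmf_subset[of "{..<K}" False "\<lambda>i. bernoulli_pmf (p i)"] that by fastforce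
  have "(\<lambda>\<delta>. {i. i < K \<and> \<delta> i}) -` {I} \<inter> set_pmf ?P = {\<lambda>i. i \<in> I} \<inter> set_pmf ?P"
  proof (intro Set.set_eqI iffI)
    fix \<delta> assume \<delta>: "\<delta> \<in> (\<lambda>\<delta>. {i. i < K \<and> \<delta> i}) -` {I} \<inter> set_pmf ?P"
    then have "{i. i < K \<and> \<delta> i} = I" "\<delta> \<in> set_pmf ?P" by auto
    then show "\<delta> \<in> {\<lambda>i. i \<in> I} \<inter> set_pmf ?P" using supp[of \<delta>] by simp
  qed (use I in auto)
  then have "pmf (poisson_sampling K p) I = pmf ?P (\<lambda>i. i \<in> I)"
    unfolding poisson_sampling_def pmf_map by (metis measure_Int_set_pmf measure_pmf_single)
  also have "\<dots> = (\<Prod>i<K. pmf (bernoulli_pmf (p i)) (i \<in> I))"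
    using I by (subst pmf_Pi) auto
  also have "\<dots> = (\<Prod>i<K. if i \<in> I then p i else 1 - p i)"
    using p by (intro prod.cong) auto
  also have "\<dots> = bern_weight {..<K} p I"
  proof -
    have "{..<K} \<inter> {i. i \<in> I} = I" "{..<K} \<inter> - {i. i \<in> I} = {..<K} - I" using I by auto
    then show ?thesis by (simp add: bern_weight_def prod.If_cases)
  qed
  finally show ?thesis .
qed

lemma set_poisson_sampling: "set_pmf (poisson_sampling K p) \<subseteq> Pow {..<K}"
  by (auto simp: poisson_sampling_def)

lemma prob_poisson_sampling:
  assumes "\<And>i. i < K \<Longrightarrow> p i \<in> {0..1}"
  shows "measure_pmf.prob (poisson_sampling K p) F = bern_exp {..<K} p (\<lambda>I. of_bool (I \<in> F))"
proof -
  let ?M = "poisson_sampling K p"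
  have "F \<inter> set_pmf ?M = (F \<inter> Pow {..<K}) \<inter> set_pmf ?M" using set_poisson_sampling by auto
  then have "measure_pmf.prob ?M F = measure_pmf.prob ?M (F \<inter> Pow {..<K})"
    by (metis measure_Int_set_pmf)
  also have "\<dots> = (\<Sum>I\<in>F \<inter> Pow {..<K}. pmf ?M I)" by (rule measure_measure_pmf_finite) simp
  also have "\<dots> = bern_exp {..<K} p (\<lambda>I. of_bool (I \<in> F))"
    unfolding bern_exp_def using pmf_poisson_sampling[OF assms]
    by (intro sum.mono_neutral_cong_left) auto
  finally show ?thesis .
qed

text \<open>A set of positive weight consists of all indices of probability 1 and some of those
  strictly between 0 and 1. The sum condition bounds the number of the former by \<open>S\<close>
  and the number of both from below by \<open>S\<close>. Positivity makes the conditional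
  distribution meaningful.\<close>

lemma bern_exp_card_pos:
  fixes p :: "nat \<Rightarrow> real"
  assumes p: "\<And>i. i < K \<Longrightarrow> p i \<in> {0..1}" and S: "(\<Sum>i<K. p i) = real S"
  shows "0 < bern_exp {..<K} p (\<lambda>I. of_bool (card I = S))"
proof -
  define A where "A = {i. i < K \<and> p i = 1}"
  define G where "G = {i. i < K \<and> 0 < p i \<and> p i < 1}"
  have fin: "finite A" "finite G" "A \<inter> G = {}" by (auto simp: A_def G_def)
  have "(\<Sum>i\<in>A. p i) \<le> (\<Sum>i<K. p i)" using p by (intro sum_mono2) (auto simp: A_def)
  then have "card A \<le> S" using S by (simp add: A_def)
  moreover have "S \<le> card A + card G"
  proof -
    have "(\<Sum>i<K. p i) \<le> (\<Sum>i\<in>A \<union> G. 1)"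
    proof -
      have "(\<Sum>i<K. p i) = (\<Sum>i\<in>A \<union> G. p i)"
        using p by (intro sum.mono_neutral_right) (force simp: A_def G_def)+
      also have "\<dots> \<le> (\<Sum>i\<in>A \<union> G. 1)" using p by (intro sum_mono) (auto simp: A_def G_def)
      finally show ?thesis .
    qed
    then show ?thesis using S fin by (simp add: card_Un_disjoint)
  qed
  ultimately have "S - card A \<le> card G" by linarith
  then obtain T where T: "T \<subseteq> G" "card T = S - card A"
    by (rule obtain_subset_with_card_n)
  let ?I = "A \<union> T"
  have finT: "finite T" "A \<inter> T = {}" using T fin finite_subset by auto
  have cI: "card ?I = S" using T finT fin \<open>card A \<le> S\<close> by (simp add: card_Un_disjoint)
  have I: "?I \<subseteq> {..<K}" using T by (auto simp: A_def G_def)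
  have "0 < bern_weight {..<K} p ?I"
    unfolding bern_weight_def
  proof (intro mult_pos_pos prod_pos ballI)
    show "0 < p i" if "i \<in> ?I" for i using that T by (auto simp: A_def G_def)
    show "0 < 1 - p i" if "i \<in> {..<K} - ?I" for i
      using that p[of i] by (auto simp: A_def order_less_le)
  qed
  also have "\<dots> = (\<Sum>I\<in>{?I}. bern_weight {..<K} p I * of_bool (card I = S))" using cI by simp
  also have "\<dots> \<le> bern_exp {..<K} p (\<lambda>I. of_bool (card I = S))"
    unfolding bern_exp_def using I p
    by (intro sum_mono2) (auto intro!: mult_nonneg_nonneg bern_weight_nonneg)
  finally show ?thesis .
qed

lemma prob_rejective_sampling:
  assumes p: "\<And>i. i < K \<Longrightarrow> p i \<in> {0..1}" and S: "(\<Sum>i<K. p i) = real S"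
  shows "measure_pmf.prob (rejective_sampling K p S) F * bern_exp {..<K} p (\<lambda>I. of_bool (card I = S))
    = bern_exp {..<K} p (\<lambda>I. of_bool (card I = S \<and> I \<in> F))"
proof -
  let ?M = "poisson_sampling K p" and ?C = "{I :: nat set. card I = S}"
  let ?R = "rejective_sampling K p S"
  have w: "measure_pmf.prob ?M ?C = bern_exp {..<K} p (\<lambda>I. of_bool (card I = S))"
    using prob_poisson_sampling[OF p] by simp
  have pos: "0 < measure_pmf.prob ?M ?C" unfolding w by (rule bern_exp_card_pos[OF p S])
  have ne: "set_pmf ?M \<inter> ?C \<noteq> {}"
  proof
    assume "set_pmf ?M \<inter> ?C = {}"
    then have "measure_pmf.prob ?M ?C = 0" by (metis Int_commute measure_Int_set_pmf measure_empty)
    then show False using pos by simp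
  qed
  have "set_pmf ?R \<subseteq> Pow {..<K}"
    unfolding rejective_sampling_def set_cond_pmf[OF ne] using set_poisson_sampling by auto
  then have "F \<inter> set_pmf ?R = (F \<inter> Pow {..<K}) \<inter> set_pmf ?R" by auto
  then have "measure_pmf.prob ?R F = measure_pmf.prob ?R (F \<inter> Pow {..<K})"
    by (metis measure_Int_set_pmf)
  also have "\<dots> = (\<Sum>I\<in>F \<inter> Pow {..<K}. pmf ?R I)" by (rule measure_measure_pmf_finite) simp
  also have "\<dots> = (\<Sum>I\<in>F \<inter> Pow {..<K}. of_bool (card I = S) * bern_weight {..<K} p I / measure_pmf.prob ?M ?C)"
    unfolding rejective_sampling_def pmf_cond[OF ne]
    using pmf_poisson_sampling[OF p] by (intro sum.cong) auto
  also have "\<dots> * measure_pmf.prob ?M ?C = (\<Sum>I\<in>F \<inter> Pow {..<K}. of_bool (card I = S) * bern_weight {..<K} p I)"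
    using pos by (simp add: sum_distrib_right)
  also have "\<dots> = bern_exp {..<K} p (\<lambda>I. of_bool (card I = S \<and> I \<in> F))"
    unfolding bern_exp_def by (intro sum.mono_neutral_cong_left) auto
  finally show ?thesis unfolding w .
qed

text \<open>The condition on \<open>F\<close> concerns only sets of size \<open>S\<close>: the mixed
  norm of the empty submatrix is unspecified, so \<open>F\<close> is compared with a norm event only
  where both are meaningful.\<close>

lemma rejective_tail:
  fixes H :: "nat \<Rightarrow> nat \<Rightarrow> real"
  assumes p: "\<And>i. i < K \<Longrightarrow> p i \<in> {0..1}" and S: "(\<Sum>i<K. p i) = real S"
    and diag: "\<And>i. i < K \<Longrightarrow> H i i = 0" and r: "0 < r" and m: "0 < m"
    and op: "\<And>t. norm_ge (\<lambda>i j. sqrt (p i) * H i j * sqrt (p j)) {..<K} {..<K} t \<Longrightarrow> 2 * exp 1 ^ 2 * t \<le> r"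
    and row: "\<And>i. i < K \<Longrightarrow> m * (4 * exp 1 ^ 2 * (\<Sum>j<K. (H i j)\<^sup>2 * p j)) \<le> r\<^sup>2"
    and col: "\<And>j. j < K \<Longrightarrow> m * (4 * exp 1 ^ 2 * (\<Sum>i<K. p i * (H i j)\<^sup>2)) \<le> r\<^sup>2"
    and ent: "\<And>i j. i < K \<Longrightarrow> j < K \<Longrightarrow> m * (2 * \<bar>H i j\<bar>) \<le> r"
    and F: "\<And>I. I \<subseteq> {..<K} \<Longrightarrow> card I = S \<Longrightarrow> I \<in> F \<Longrightarrow> norm_ge H I I r"
  shows "measure_pmf.prob (rejective_sampling K p S) F \<le> 216 * real K * exp (- m)"
proof -
  let ?w = "bern_exp {..<K} p (\<lambda>I. of_bool (card I = S))"
  have p': "\<And>i. i \<in> {..<K} \<Longrightarrow> p i \<in> {0..1}" using p by simp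
  have w: "0 < ?w" by (rule bern_exp_card_pos[OF p S])
  have "measure_pmf.prob (rejective_sampling K p S) F * ?w
    = bern_exp {..<K} p (\<lambda>I. of_bool (card I = S \<and> I \<in> F))"
    by (rule prob_rejective_sampling[OF p S])
  also have "\<dots> \<le> bern_exp {..<K} p (\<lambda>I. of_bool (card I = S \<and> norm_ge H I I r))"
    using F by (intro bern_exp_mono p') auto
  also have "\<dots> \<le> 2 * bern_exp {..<K} p (\<lambda>I. of_bool (norm_ge H I I r)) * ?w"
  proof (rule bern_exp_fixed_card_le[OF finite_lessThan p'])
    show "norm_ge H J J r" if "I \<subseteq> J" "J \<subseteq> {..<K}" "norm_ge H I I r" for I J
      using that finite_subset[OF that(2)] by (intro norm_ge_mono[OF that(3)]) auto
    show "1 / 2 \<le> bern_exp {..<K} p (\<lambda>I. of_bool (S \<le> card I))"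
      by (rule poisson_binomial_median[OF p S])
  qed
  also have "\<dots> \<le> 2 * (108 * real (card {..<K}) * exp (- m)) * ?w"
    using w diag row col ent op
    by (intro mult_right_mono mult_left_mono poisson_tail[OF finite_lessThan p' _ r m]) auto
  finally show ?thesis using w by simp
qed

section \<open>Mixed norms\<close>

text \<open>The simplifier rewrites the numeral \<open>2\<close> of type \<open>ereal\<close> to \<open>ereal 2\<close>.\<close>
lemma lp_norm_2:
  "lp_norm 2 v = sqrt (\<Sum>i<dim_vec v. (v $ i)\<^sup>2)"
  "lp_norm (ereal 2) v = sqrt (\<Sum>i<dim_vec v. (v $ i)\<^sup>2)"
  by (simp_all add: lp_norm_def powr_half_sqrt sum_nonneg)

lemma lp_norm_1: "lp_norm 1 v = (\<Sum>i<dim_vec v. \<bar>v $ i\<bar>)"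
  by (simp add: lp_norm_def sum_nonneg)

lemma lp_norm_infinity_ge: "i < dim_vec v \<Longrightarrow> \<bar>v $ i\<bar> \<le> lp_norm \<infinity> v"
  unfolding lp_norm_def by (auto intro!: Max_ge)

text \<open>A crude bound for the finiteness of the suprema. Positive dimension makes the maximum
  one over a nonempty set.\<close>

lemma lp_norm_le_sum:
  assumes "p = 2 \<or> p = \<infinity>" "0 < dim_vec v"
  shows "lp_norm p v \<le> (\<Sum>i<dim_vec v. \<bar>v $ i\<bar>)"
proof (cases "p = 2")
  case True
  have "sqrt (\<Sum>i<dim_vec v. (v $ i)\<^sup>2) \<le> (\<Sum>i<dim_vec v. \<bar>v $ i\<bar>)"
    using L2_set_le_sum_abs[of "\<lambda>i. v $ i" "{..<dim_vec v}"] by (simp add: L2_set_def)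
  then show ?thesis by (simp add: True lp_norm_2)
next
  case False
  have "Max {\<bar>v $ i\<bar> | i. i < dim_vec v} \<le> (\<Sum>i<dim_vec v. \<bar>v $ i\<bar>)"
    using assms(2) by (subst Max_le_iff) (auto intro: member_le_sum)
  then show ?thesis using False assms(1) by (auto simp: lp_norm_def)
qed

lemma lp_norm_entry_le:
  assumes "q = 1 \<or> q = 2" "lp_norm q v = 1" "i < dim_vec v"
  shows "\<bar>v $ i\<bar> \<le> 1"
proof (cases "q = 1")
  case True
  have "\<bar>v $ i\<bar> \<le> (\<Sum>i<dim_vec v. \<bar>v $ i\<bar>)" using assms(3) by (intro member_le_sum) auto
  then show ?thesis using assms(2) by (simp add: True lp_norm_1)
next
  case False
  have "(v $ i)\<^sup>2 \<le> (\<Sum>i<dim_vec v. (v $ i)\<^sup>2)" using assms(3) by (intro member_le_sum) auto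
  then have "(v $ i)\<^sup>2 \<le> 1" using assms(1,2) False by (simp add: lp_norm_2)
  then show ?thesis by (simp add: abs_square_le_1)
qed

lemma mult_mat_vec_index:
  assumes "A \<in> carrier_mat n k" "x \<in> carrier_vec k" "i < n"
  shows "(A *\<^sub>v x) $ i = (\<Sum>j<k. A $$ (i, j) * x $ j)"
  using assms by (simp add: scalar_prod_def atLeast0LessThan)

text \<open>A supremum of reals dominates the members of a bounded set; the bound is the sum of the
  absolute values of all entries.\<close>

lemma mixed_norm_ge:
  assumes A: "A \<in> carrier_mat n k" "0 < n" and pq: "p = 2 \<or> p = \<infinity>" "q = 1 \<or> q = 2"
    and x: "x \<in> carrier_vec k" "lp_norm q x = 1"
  shows "lp_norm p (A *\<^sub>v x) \<le> mixed_norm p q A"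
proof -
  have "bdd_above {lp_norm p (A *\<^sub>v x) | x. x \<in> carrier_vec (dim_col A) \<and> lp_norm q x = 1}"
  proof (rule bdd_aboveI, clarify)
    fix x assume x: "x \<in> carrier_vec (dim_col A)" "lp_norm q x = 1"
    have xk: "x \<in> carrier_vec k" using x A by simp
    have "lp_norm p (A *\<^sub>v x) \<le> (\<Sum>i<dim_vec (A *\<^sub>v x). \<bar>(A *\<^sub>v x) $ i\<bar>)"
      using A by (intro lp_norm_le_sum pq) auto
    also have "\<dots> \<le> (\<Sum>i<n. \<Sum>j<k. \<bar>A $$ (i, j)\<bar>)"
    proof -
      have "\<bar>(A *\<^sub>v x) $ i\<bar> \<le> (\<Sum>j<k. \<bar>A $$ (i, j)\<bar>)" if i: "i < n" for i
      proof -
        have "\<bar>(A *\<^sub>v x) $ i\<bar> \<le> (\<Sum>j<k. \<bar>A $$ (i, j) * x $ j\<bar>)"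
          unfolding mult_mat_vec_index[OF A(1) xk i] by (rule sum_abs)
        also have "\<dots> \<le> (\<Sum>j<k. \<bar>A $$ (i, j)\<bar>)"
          using lp_norm_entry_le[OF pq(2) x(2)] xk
          by (intro sum_mono) (auto simp: abs_mult intro!: mult_left_le)
        finally show ?thesis .
      qed
      then show ?thesis using A by (auto intro!: sum_mono)
    qed
    finally show "lp_norm p (A *\<^sub>v x) \<le> (\<Sum>i<n. \<Sum>j<k. \<bar>A $$ (i, j)\<bar>)" .
  qed
  then show ?thesis unfolding mixed_norm_def using A x by (intro cSup_upper) auto
qed

lemma lp_norm_unit_vec:
  assumes "j < n"
  shows "lp_norm 1 (unit_vec n j) = 1" "lp_norm 2 (unit_vec n j) = 1"
proof -
  have "(\<Sum>i<n. \<bar>unit_vec n j $ i :: real\<bar>) = (\<Sum>i<n. if i = j then 1 else 0)"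
    by (rule sum.cong) (use assms in auto)
  moreover have "(\<Sum>i<n. (unit_vec n j $ i :: real)\<^sup>2) = (\<Sum>i<n. if i = j then 1 else 0)"
    by (rule sum.cong) (use assms in auto)
  moreover have "(\<Sum>i<n. if i = j then 1 else 0 :: real) = 1" using assms by simp
  ultimately have "(\<Sum>i<n. \<bar>unit_vec n j $ i :: real\<bar>) = 1" "(\<Sum>i<n. (unit_vec n j $ i :: real)\<^sup>2) = 1"
    by (simp_all only:)
  then show "lp_norm 1 (unit_vec n j) = 1" "lp_norm 2 (unit_vec n j) = 1"
    by (simp_all only: lp_norm_1 lp_norm_2 index_unit_vec(3) real_sqrt_one)
qed

lemma mixed_norm_2_2_nonneg:
  assumes "A \<in> carrier_mat n k" "0 < n" "0 < k"
  shows "0 \<le> mixed_norm 2 2 A"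
proof -
  have "0 \<le> lp_norm 2 (A *\<^sub>v unit_vec k 0)" by (simp add: lp_norm_2 sum_nonneg)
  also have "\<dots> \<le> mixed_norm 2 2 A"
    using assms by (intro mixed_norm_ge lp_norm_unit_vec) auto
  finally show ?thesis .
qed

lemma mult_unit_vec_index:
  assumes "A \<in> carrier_mat n k" "i < n" "j < k"
  shows "(A *\<^sub>v unit_vec k j) $ i = (A $$ (i, j) :: real)"
proof -
  have "(A *\<^sub>v unit_vec k j) $ i = (\<Sum>l<k. A $$ (i, l) * unit_vec k j $ l)"
    using assms by (intro mult_mat_vec_index) auto
  also have "\<dots> = (\<Sum>l<k. if l = j then A $$ (i, j) else 0)"
    using assms by (intro sum.cong) auto
  finally show ?thesis using assms by simp
qed

lemma mixed_norm_infinity_1_ge: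
  assumes "A \<in> carrier_mat n k" "i < n" "j < k"
  shows "\<bar>A $$ (i, j)\<bar> \<le> mixed_norm \<infinity> 1 A"
proof -
  have "\<bar>A $$ (i, j)\<bar> \<le> lp_norm \<infinity> (A *\<^sub>v unit_vec k j)"
    using lp_norm_infinity_ge[of i "A *\<^sub>v unit_vec k j"] assms by (simp add: mult_unit_vec_index)
  also have "\<dots> \<le> mixed_norm \<infinity> 1 A"
    using assms by (intro mixed_norm_ge lp_norm_unit_vec) auto
  finally show ?thesis .
qed

lemma mixed_norm_2_1_ge:
  assumes "A \<in> carrier_mat n k" "0 < n" "j < k"
  shows "(\<Sum>i<n. (A $$ (i, j))\<^sup>2) \<le> (mixed_norm 2 1 A)\<^sup>2"
proof -
  have "lp_norm 2 (A *\<^sub>v unit_vec k j) \<le> mixed_norm 2 1 A"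
    using assms by (intro mixed_norm_ge lp_norm_unit_vec) auto
  then have "sqrt (\<Sum>i<n. (A $$ (i, j))\<^sup>2) \<le> mixed_norm 2 1 A"
    using assms by (simp add: lp_norm_2 mult_unit_vec_index del: index_mult_mat_vec)
  then have "(sqrt (\<Sum>i<n. (A $$ (i, j))\<^sup>2))\<^sup>2 \<le> (mixed_norm 2 1 A)\<^sup>2"
    by (intro power_mono) (auto simp: sum_nonneg)
  then show ?thesis by (simp add: sum_nonneg)
qed

text \<open>The test vector is the normalised row, where Cauchy-Schwarz is an equality.\<close>

lemma mixed_norm_infinity_2_ge:
  assumes A: "A \<in> carrier_mat n k" and i: "i < n"
  shows "(\<Sum>j<k. (A $$ (i, j))\<^sup>2) \<le> (mixed_norm \<infinity> 2 A)\<^sup>2"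
proof (cases "(\<Sum>j<k. (A $$ (i, j))\<^sup>2) = 0")
  case False
  define s where "s = sqrt (\<Sum>j<k. (A $$ (i, j))\<^sup>2)"
  have s2: "s\<^sup>2 = (\<Sum>j<k. (A $$ (i, j))\<^sup>2)" by (simp add: s_def sum_nonneg)
  have s: "0 < s" using False by (auto simp: s_def sum_nonneg order_less_le)
  define x where "x = vec k (\<lambda>j. A $$ (i, j) / s)"
  have x: "x \<in> carrier_vec k" by (simp add: x_def)
  have "(\<Sum>j<k. (x $ j)\<^sup>2) = (\<Sum>j<k. (A $$ (i, j))\<^sup>2) / s\<^sup>2"
    by (simp add: x_def power_divide sum_divide_distrib)
  then have "lp_norm 2 x = 1" using s by (simp add: lp_norm_2 s2[symmetric]) (simp add: x_def)
  then have "lp_norm \<infinity> (A *\<^sub>v x) \<le> mixed_norm \<infinity> 2 A"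
    using A i x by (intro mixed_norm_ge) auto
  moreover have "(A *\<^sub>v x) $ i = s"
  proof -
    have "(A *\<^sub>v x) $ i = (\<Sum>j<k. (A $$ (i, j))\<^sup>2) / s"
      unfolding mult_mat_vec_index[OF A x i]
      by (simp add: x_def power2_eq_square sum_divide_distrib)
    also have "\<dots> = s\<^sup>2 / s" by (simp only: s2)
    finally show ?thesis using s by (simp add: power2_eq_square)
  qed
  ultimately have "s \<le> mixed_norm \<infinity> 2 A"
    using lp_norm_infinity_ge[of i "A *\<^sub>v x"] A i s by simp
  then have "s\<^sup>2 \<le> (mixed_norm \<infinity> 2 A)\<^sup>2" using s by (intro power_mono) auto
  then show ?thesis by (simp add: s2)
qed simp

text \<open>A witness in the unit ball is scaled up to the unit sphere, over which the supremum is
  taken; division by its length s \<le> 1 only increases the value.\<close>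

lemma norm_ge_le_mixed_norm:
  assumes A: "A \<in> carrier_mat n k" "0 < n" "0 < k"
    and ge: "norm_ge (\<lambda>i j. A $$ (i, j)) {..<n} {..<k} t"
  shows "t \<le> mixed_norm 2 2 A"
proof (cases "0 < t")
  case True
  obtain v where v: "(\<Sum>j<k. (v j)\<^sup>2) \<le> 1" "t\<^sup>2 \<le> (\<Sum>i<n. (\<Sum>j<k. A $$ (i, j) * v j)\<^sup>2)"
    using norm_ge_imp_sum_squares[OF norm_ge_transpose[OF ge]] True by auto
  define s where "s = sqrt (\<Sum>j<k. (v j)\<^sup>2)"
  have s2: "s\<^sup>2 = (\<Sum>j<k. (v j)\<^sup>2)" "0 \<le> s" by (simp_all add: s_def sum_nonneg)
  have "s \<noteq> 0"
  proof
    assume "s = 0"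
    then have "(\<Sum>j<k. (v j)\<^sup>2) = 0" using s2 by simp
    then have "\<forall>j<k. v j = 0" by (simp add: sum_nonneg_eq_0_iff)
    then have "t\<^sup>2 \<le> 0" using v(2) by simp
    then show False using True by simp
  qed
  then have s: "0 < s" "s \<le> 1" using s2 v(1) by (auto simp: s_def)
  define x where "x = vec k (\<lambda>j. v j / s)"
  have x: "x \<in> carrier_vec k" by (simp add: x_def)
  have "(\<Sum>j<k. (x $ j)\<^sup>2) = (\<Sum>j<k. (v j)\<^sup>2) / s\<^sup>2"
    by (simp add: x_def power_divide sum_divide_distrib)
  then have "lp_norm 2 x = 1" using s by (simp add: lp_norm_2 s2(1)[symmetric]) (simp add: x_def)
  then have 1: "lp_norm 2 (A *\<^sub>v x) \<le> mixed_norm 2 2 A"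
    using A x by (intro mixed_norm_ge) auto
  have "(A *\<^sub>v x) $ i = (\<Sum>j<k. A $$ (i, j) * v j) / s" if "i < n" for i
    unfolding mult_mat_vec_index[OF A(1) x that] by (simp add: x_def sum_divide_distrib)
  then have "lp_norm 2 (A *\<^sub>v x) = sqrt ((\<Sum>i<n. (\<Sum>j<k. A $$ (i, j) * v j)\<^sup>2) / s\<^sup>2)"
    using A by (simp add: lp_norm_2 power_divide sum_divide_distrib[symmetric] del: index_mult_mat_vec)
  also have "\<dots> = sqrt (\<Sum>i<n. (\<Sum>j<k. A $$ (i, j) * v j)\<^sup>2) / s"
    using s by (simp add: real_sqrt_divide)
  finally have "sqrt (\<Sum>i<n. (\<Sum>j<k. A $$ (i, j) * v j)\<^sup>2) / s \<le> mixed_norm 2 2 A" using 1 by simp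
  moreover have "t \<le> sqrt (\<Sum>i<n. (\<Sum>j<k. A $$ (i, j) * v j)\<^sup>2)"
    using v(2) True by (simp add: real_le_rsqrt)
  moreover have "\<dots> \<le> sqrt (\<Sum>i<n. (\<Sum>j<k. A $$ (i, j) * v j)\<^sup>2) / s"
    using s by (simp add: le_divide_eq mult_left_le sum_nonneg)
  ultimately show ?thesis by linarith
qed (use mixed_norm_2_2_nonneg[OF A] in simp)

text \<open>The event includes norm exactly \<open>r\<close>, so an exact maximiser is required. It
  exists by compactness of the sphere, represented by functions that vanish from index
  \<open>n\<close> on.\<close>

lemma mixed_norm_2_2_attained:
  assumes A: "A \<in> carrier_mat n n" "0 < n" and r: "0 < r" "r \<le> mixed_norm 2 2 A"
  shows "norm_ge (\<lambda>i j. A $$ (i, j)) {..<n} {..<n} r"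
proof -
  define X where "X = {x. \<forall>i. x i \<in> (if i < n then {- 1..1} else {0 :: real})} \<inter> {x. (\<Sum>i<n. (x i)\<^sup>2) = 1}"
  define f where "f x = sqrt (\<Sum>i<n. (\<Sum>j<n. A $$ (i, j) * x j)\<^sup>2)" for x :: "nat \<Rightarrow> real"
  have cont: "continuous_on UNIV f" "continuous_on UNIV (\<lambda>x :: nat \<Rightarrow> real. \<Sum>i<n. (x i)\<^sup>2)"
    unfolding f_def by (intro continuous_intros continuous_on_product_coordinates)+
  have X: "compact X" unfolding X_def
    by (intro compact_Int_closed compact_box closed_Collect_eq cont continuous_on_const) auto
  have fX: "\<exists>y\<in>X. lp_norm 2 (A *\<^sub>v x) = f y" if x: "x \<in> carrier_vec n" "lp_norm 2 x = 1" for x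
  proof
    define y where "y i = (if i < n then x $ i else 0)" for i
    have "(\<Sum>i<n. (y i)\<^sup>2) = 1" using x by (simp add: lp_norm_2 y_def)
    moreover have "y i \<in> (if i < n then {- 1..1} else {0})" for i
    proof (cases "i < n")
      case True
      then have "\<bar>x $ i\<bar> \<le> 1" using lp_norm_entry_le[of 2 x i] x by auto
      then show ?thesis using True by (simp add: y_def abs_le_iff minus_le_iff)
    qed (simp add: y_def)
    ultimately show "y \<in> X" unfolding X_def by blast
    show "lp_norm 2 (A *\<^sub>v x) = f y"
      using A mult_mat_vec_index[OF A(1) x(1)] by (simp add: lp_norm_2 f_def y_def del: index_mult_mat_vec)
  qed
  have ne: "unit_vec n 0 \<in> carrier_vec n" "lp_norm 2 (unit_vec n 0) = 1"
    using A lp_norm_unit_vec by auto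
  then have "X \<noteq> {}" using fX by blast
  then obtain y where y: "y \<in> X" "\<And>z. z \<in> X \<Longrightarrow> f z \<le> f y"
    using continuous_attains_sup[OF X _ continuous_on_subset[OF cont(1)]] by blast
  have "mixed_norm 2 2 A \<le> f y"
    unfolding mixed_norm_def
  proof (rule cSup_least)
    show "{lp_norm 2 (A *\<^sub>v x) |x. x \<in> carrier_vec (dim_col A) \<and> lp_norm 2 x = 1} \<noteq> {}"
    proof -
      have "unit_vec n 0 \<in> carrier_vec (dim_col A)" using A by auto
      then show ?thesis using ne(2) by blast
    qed
    fix c assume "c \<in> {lp_norm 2 (A *\<^sub>v x) |x. x \<in> carrier_vec (dim_col A) \<and> lp_norm 2 x = 1}"
    then obtain x where "c = lp_norm 2 (A *\<^sub>v x)" "x \<in> carrier_vec n" "lp_norm 2 x = 1" using A by auto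
    then show "c \<le> f y" using fX y(2) by metis
  qed
  then have "r \<le> f y" using r by simp
  then have "r\<^sup>2 \<le> (f y)\<^sup>2" using r by (intro power_mono) auto
  then have "r\<^sup>2 \<le> (\<Sum>i<n. (\<Sum>j<n. A $$ (i, j) * y j)\<^sup>2)" by (simp add: f_def sum_nonneg)
  then have "norm_ge (\<lambda>j i. A $$ (i, j)) {..<n} {..<n} (sqrt (r\<^sup>2))"
    using y(1) r by (intro sum_squares_imp_norm_ge[of y]) (auto simp: X_def)
  then show ?thesis using norm_ge_transpose r by fastforce
qed

section \<open>From submatrices to index sets\<close>

lemma norm_ge_reindex:
  fixes \<phi> :: "'a \<Rightarrow> 'b" and H :: "'b \<Rightarrow> 'b \<Rightarrow> real"
  assumes "bij_betw \<phi> J I" "norm_ge (\<lambda>a b. H (\<phi> a) (\<phi> b)) J J r"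
  shows "norm_ge H I I r"
proof -
  let ?\<psi> = "inv_into J \<phi>"
  obtain u v where uv: "(\<Sum>i\<in>J. (u i)\<^sup>2) \<le> 1" "(\<Sum>j\<in>J. (v j)\<^sup>2) \<le> 1"
    "r \<le> bilin (\<lambda>a b. H (\<phi> a) (\<phi> b)) J J u v"
    using assms(2) unfolding norm_ge_def by blast
  have inv: "\<And>j. j \<in> J \<Longrightarrow> ?\<psi> (\<phi> j) = j" using assms(1) by (simp add: bij_betw_def)
  have re: "(\<Sum>i\<in>I. h i) = (\<Sum>j\<in>J. h (\<phi> j))" for h :: "'b \<Rightarrow> real"
    by (rule sum.reindex_bij_betw[OF assms(1), symmetric])
  show ?thesis
  proof (rule norm_geI[of "u \<circ> ?\<psi>" I "v \<circ> ?\<psi>" I])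
    show "(\<Sum>i\<in>I. ((u \<circ> ?\<psi>) i)\<^sup>2) \<le> 1" "(\<Sum>i\<in>I. ((v \<circ> ?\<psi>) i)\<^sup>2) \<le> 1"
      using uv unfolding re by (simp_all add: inv cong: sum.cong)
    show "r \<le> bilin H I I (u \<circ> ?\<psi>) (v \<circ> ?\<psi>)"
      using uv unfolding bilin_def re by (simp add: inv cong: sum.cong)
  qed
qed

lemma submatrix_norm_ge:
  assumes H: "H \<in> carrier_mat K K" and I: "I \<subseteq> {..<K}" "0 < card I"
    and r: "0 < r" "r \<le> mixed_norm 2 2 (submatrix H I I)"
  shows "norm_ge (\<lambda>i j. H $$ (i, j)) I I r"
proof -
  have eq: "{i. i < dim_row H \<and> i \<in> I} = I" "{j. j < dim_col H \<and> j \<in> I} = I" using H I by auto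
  have "submatrix H I I \<in> carrier_mat (card I) (card I)" by (intro carrier_matI) (simp_all add: dim_submatrix eq)
  then have "norm_ge (\<lambda>a b. submatrix H I I $$ (a, b)) {..<card I} {..<card I} r"
    by (intro mixed_norm_2_2_attained I(2) r)
  moreover have "submatrix H I I $$ (a, b) = H $$ (pick I a, pick I b)" if "a < card I" "b < card I" for a b
    using that by (intro submatrix_index) (simp_all add: eq)
  ultimately have "norm_ge (\<lambda>a b. H $$ (pick I a, pick I b)) {..<card I} {..<card I} r"
    by (subst (asm) norm_ge_cong) auto
  moreover have "bij_betw (pick I) {..<card I} I"
  proof -
    have inj: "inj_on (pick I) {..<card I}"
      by (rule linorder_inj_onI') (metis lessThan_iff pick_mono_le nat_neq_iff)
    have "pick I ` {..<card I} \<subseteq> I" using pick_in_set_le by auto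
    moreover have "finite I" using I(2) card_gt_0_iff by blast
    ultimately have "pick I ` {..<card I} = I" using inj by (intro card_subset_eq) (auto simp: card_image)
    then show ?thesis using inj by (simp add: bij_betw_def)
  qed
  ultimately show ?thesis
    using norm_ge_reindex[of "pick I" "{..<card I}" I "\<lambda>i j. H $$ (i, j)" r] by simp
qed

text \<open>Multiplying out also covers b = 0, where the quotient may be infinite and the conclusion
  becomes 0 \<le> a.\<close>

lemma le_ereal_divide_imp:
  assumes "ereal m \<le> ereal a / ereal b" "0 \<le> a" "0 \<le> b"
  shows "m * b \<le> a"
proof (cases "b = 0")
  case False
  then have "m \<le> a / b" using assms(1) by simp
  then show ?thesis using False assms(3) by (simp add: le_divide_eq)
next
  case True
  then show ?thesis using assms(2) by simp
qed

lemma weight_mat_mult_index: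
  assumes "H \<in> carrier_mat K K" "i < K" "j < K"
  shows "(H * weight_mat K p) $$ (i, j) = H $$ (i, j) * sqrt (p j)"
    and "(weight_mat K p * H) $$ (i, j) = sqrt (p i) * H $$ (i, j)"
    and "(weight_mat K p * H * weight_mat K p) $$ (i, j) = sqrt (p i) * H $$ (i, j) * sqrt (p j)"
proof -
  have r: "(A * weight_mat K p) $$ (i, j) = A $$ (i, j) * sqrt (p j)" if "A \<in> carrier_mat K K" for A
    using mat_diag_mult_right[OF that, of "\<lambda>i. sqrt (p i)"] assms(2,3)
    by (simp add: weight_mat_def mult.commute)
  have l: "(weight_mat K p * A) $$ (i, j) = sqrt (p i) * A $$ (i, j)" if "A \<in> carrier_mat K K" for A
    using mat_diag_mult_left[OF that, of "\<lambda>i. sqrt (p i)"] assms(2,3)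
    by (simp add: weight_mat_def)
  have W: "weight_mat K p * H \<in> carrier_mat K K" 
    unfolding weight_mat_def by (rule mult_carrier_mat[OF mat_diag_dim assms(1)])
  show "(H * weight_mat K p) $$ (i, j) = H $$ (i, j) * sqrt (p j)"
    "(weight_mat K p * H) $$ (i, j) = sqrt (p i) * H $$ (i, j)"
    "(weight_mat K p * H * weight_mat K p) $$ (i, j) = sqrt (p i) * H $$ (i, j) * sqrt (p j)"
    using r[OF assms(1)] l[OF assms(1)] r[OF W] by simp_all
qed

theorem theorem3:
  fixes K S :: nat and p :: "nat \<Rightarrow> real" and H :: "real Matrix.mat" and r :: real
  assumes H: "H \<in> carrier_mat K K"
    and zero_diag: "\<And>i. i < K \<Longrightarrow> H $$ (i, i) = 0"
    and p: "\<And>i. i < K \<Longrightarrow> p i \<in> {0..1}"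
    and S: "S > 0" "(\<Sum>i<K. p i) = real S"
    and r: "r \<ge> 2 * exp 1 ^ 2 * mixed_norm 2 2 (weight_mat K p * H * weight_mat K p)"
  shows "ereal (measure_pmf.prob (rejective_sampling K p S)
                  {I. mixed_norm 2 2 (submatrix H I I) \<ge> r})
     \<le> ereal (216 * real K) * exp_ereal (- Min
          {ereal (r ^ 2) / ereal (4 * exp 1 ^ 2 * mixed_norm \<infinity> 2 (H * weight_mat K p) ^ 2),
           ereal (r ^ 2) / ereal (4 * exp 1 ^ 2 * mixed_norm 2 1 (weight_mat K p * H) ^ 2),
           ereal r / ereal (2 * mixed_norm \<infinity> 1 H)})"
proof -
  let ?W = "weight_mat K p"
  let ?P = "measure_pmf.prob (rejective_sampling K p S) {I. mixed_norm 2 2 (submatrix H I I) \<ge> r}"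
  define N1 where "N1 = mixed_norm \<infinity> 2 (H * ?W)"
  define N2 where "N2 = mixed_norm 2 1 (?W * H)"
  define N3 where "N3 = mixed_norm \<infinity> 1 H"
  define q where "q = Min {ereal (r ^ 2) / ereal (4 * exp 1 ^ 2 * N1 ^ 2),
    ereal (r ^ 2) / ereal (4 * exp 1 ^ 2 * N2 ^ 2), ereal r / ereal (2 * N3)}"
  \<comment> \<open>An empty sum could not equal S > 0; positive dimension gives the suprema in the
    mixed norms candidates.\<close>
  have K: "0 < K"
  proof (rule ccontr)
    assume "\<not> 0 < K"
    then show False using S by simp
  qed
  have "?W \<in> carrier_mat K K" by (simp add: weight_mat_def)
  then have WH: "?W * H \<in> carrier_mat K K" "H * ?W \<in> carrier_mat K K" "?W * H * ?W \<in> carrier_mat K K"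
    using H by (meson mult_carrier_mat)+
  have "0 \<le> mixed_norm 2 2 (?W * H * ?W)" by (rule mixed_norm_2_2_nonneg[OF WH(3) K K])
  then have "0 \<le> 2 * exp 1 ^ 2 * mixed_norm 2 2 (?W * H * ?W)" by simp
  then have r0: "0 \<le> r" using r by linarith
  have N3: "0 \<le> N3" using mixed_norm_infinity_1_ge[OF H K K] by (simp add: N3_def)
  \<comment> \<open>Stated for every positive real \<open>m\<close> up to \<open>q\<close>, because
    \<open>q\<close> itself may be infinite.\<close>
  have tail: "?P \<le> 216 * real K * exp (- m)" if "0 < r" and m: "0 < m" "ereal m \<le> q" for m
  proof (rule rejective_tail[OF p S(2) _ \<open>0 < r\<close> m(1), where H = "\<lambda>i j. H $$ (i, j)"])
    have q: "ereal m \<le> ereal (r ^ 2) / ereal (4 * exp 1 ^ 2 * N1 ^ 2)"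
      "ereal m \<le> ereal (r ^ 2) / ereal (4 * exp 1 ^ 2 * N2 ^ 2)" "ereal m \<le> ereal r / ereal (2 * N3)"
      using m(2) by (simp_all add: q_def)
    show "H $$ (i, i) = 0" if "i < K" for i by (rule zero_diag[OF that])
    show "2 * exp 1 ^ 2 * t \<le> r"
      if "norm_ge (\<lambda>i j. sqrt (p i) * H $$ (i, j) * sqrt (p j)) {..<K} {..<K} t" for t
    proof -
      have "norm_ge (\<lambda>i j. (?W * H * ?W) $$ (i, j)) {..<K} {..<K} t"
        using that by (subst norm_ge_cong) (auto simp: weight_mat_mult_index(3)[OF H] simp del: index_mult_mat)
      then have "t \<le> mixed_norm 2 2 (?W * H * ?W)" by (rule norm_ge_le_mixed_norm[OF WH(3) K K])
      then have "2 * exp 1 ^ 2 * t \<le> 2 * exp 1 ^ 2 * mixed_norm 2 2 (?W * H * ?W)" by simp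
      then show ?thesis using r by linarith
    qed
    show "m * (4 * exp 1 ^ 2 * (\<Sum>j<K. (H $$ (i, j))\<^sup>2 * p j)) \<le> r\<^sup>2" if "i < K" for i
    proof -
      have "(\<Sum>j<K. (H $$ (i, j))\<^sup>2 * p j) = (\<Sum>j<K. ((H * ?W) $$ (i, j))\<^sup>2)"
        using H that p by (intro sum.cong)
          (auto simp: weight_mat_mult_index power_mult_distrib simp del: index_mult_mat)
      also have "\<dots> \<le> N1\<^sup>2" unfolding N1_def by (rule mixed_norm_infinity_2_ge[OF WH(2) that])
      finally have "m * (4 * exp 1 ^ 2 * (\<Sum>j<K. (H $$ (i, j))\<^sup>2 * p j)) \<le> m * (4 * exp 1 ^ 2 * N1\<^sup>2)"
        using m by (intro mult_left_mono) auto
      also have "\<dots> \<le> r\<^sup>2" using q by (intro le_ereal_divide_imp) auto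
      finally show ?thesis .
    qed
    show "m * (4 * exp 1 ^ 2 * (\<Sum>i<K. p i * (H $$ (i, j))\<^sup>2)) \<le> r\<^sup>2" if "j < K" for j
    proof -
      have "(\<Sum>i<K. p i * (H $$ (i, j))\<^sup>2) = (\<Sum>i<K. ((?W * H) $$ (i, j))\<^sup>2)"
        using H that p by (intro sum.cong)
          (auto simp: weight_mat_mult_index power_mult_distrib simp del: index_mult_mat)
      also have "\<dots> \<le> N2\<^sup>2" unfolding N2_def by (rule mixed_norm_2_1_ge[OF WH(1) K that])
      finally have "m * (4 * exp 1 ^ 2 * (\<Sum>i<K. p i * (H $$ (i, j))\<^sup>2)) \<le> m * (4 * exp 1 ^ 2 * N2\<^sup>2)"
        using m by (intro mult_left_mono) auto
      also have "\<dots> \<le> r\<^sup>2" using q by (intro le_ereal_divide_imp) auto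
      finally show ?thesis .
    qed
    show "m * (2 * \<bar>H $$ (i, j)\<bar>) \<le> r" if "i < K" "j < K" for i j
    proof -
      have "m * (2 * \<bar>H $$ (i, j)\<bar>) \<le> m * (2 * N3)"
        using m mixed_norm_infinity_1_ge[OF H that] by (intro mult_left_mono) (auto simp: N3_def)
      also have "\<dots> \<le> r" using q N3 r0 by (intro le_ereal_divide_imp) auto
      finally show ?thesis .
    qed
    show "norm_ge (\<lambda>i j. H $$ (i, j)) I I r"
      if "I \<subseteq> {..<K}" "card I = S" "I \<in> {I. mixed_norm 2 2 (submatrix H I I) \<ge> r}" for I
      using that S \<open>0 < r\<close> by (intro submatrix_norm_ge[OF H]) auto
  qed
  have P1: "?P \<le> 1" by simp
  have "ereal ?P \<le> ereal (216 * real K) * exp_ereal (- q)"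
  proof (cases "r = 0")
    case True
    \<comment> \<open>All three quotients are 0, even over a vanishing denominator, since 0 / 0 = 0
      for extended reals; the bound is then at least 1.\<close>
    then have "q = 0" by (simp add: q_def zero_ereal_def[symmetric])
    then have "exp_ereal (- q) = 1" by (simp add: exp_ereal_def zero_ereal_def one_ereal_def)
    moreover have "?P \<le> 216 * real K" by (rule order_trans[OF P1]) (use K in simp)
    ultimately show ?thesis by (simp only: mult_1_right ereal_less_eq)
  next
    case False
    then have rpos: "0 < r" using r0 by simp
    have quot: "0 < ereal a / ereal b" if "0 < a" "0 \<le> b" for a b
      using that by (cases "b = 0") auto
    have qpos: "0 < q" unfolding q_def using rpos N3 by (auto intro!: quot)
    show ?thesis
    proof (cases q)
      case (real x)
      then have "?P \<le> 216 * real K * exp (- x)" using qpos by (intro tail rpos) auto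
      then show ?thesis by (simp add: real exp_ereal_def)
    next
      case PInf
      \<comment> \<open>All three denominators vanish. The bound holds for every \<open>m\<close>,
        and letting \<open>m\<close> tend to infinity shows that the probability is 0.\<close>
      have "(\<lambda>m. 216 * real K * exp (- real m)) \<longlonglongrightarrow> 216 * real K * 0"
        by (intro tendsto_mult tendsto_const filterlim_compose[OF exp_at_bot]
            filterlim_compose[OF filterlim_uminus_at_bot_at_top] filterlim_real_sequentially)
      moreover have "\<forall>\<^sub>F m in sequentially. ?P \<le> 216 * real K * exp (- real m)"
        using eventually_gt_at_top[of 0] by eventually_elim (intro tail rpos, auto simp: PInf)
      ultimately have "?P \<le> 216 * real K * 0" by (rule tendsto_lowerbound[OF _ _ sequentially_bot])
      then show ?thesis by (simp add: PInf exp_ereal_def)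
    next
      case MInf
      then show ?thesis using qpos by simp
    qed
  qed
  then show ?thesis unfolding q_def N1_def N2_def N3_def .
qed

end
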